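(* Let $\pi=\pi_1\pi_2\cdots\pi_T$ be a binary string of length $T\ge 1$. Then, as formal power series in $z$ with coefficients in $\mathbb{Q}(q,t)$, $$\sum_{\mathfrak c\in \mathrm{CPP}(\pi)} W_{\mathfrak c}(q,t)\, z^{|\mathfrak c|}=\prod_{n\ge 0}\left(\frac{1}{1-z^{(n+1)T}}\prod_{\substack{1\le i<j\le T\\ \pi_i>\pi_j}}\frac{(tz^{j-i+nT};q)_\infty}{(z^{j-i+nT};q)_\infty}\prod_{\substack{1\le j<i\le T\\ \pi_i>\pi_j}}\frac{(tz^{j-i+(n+1)T};q)_\infty}{(z^{j-i+(n+1)T};q)_\infty}\right),$$ where for $\mathfrak c=(\mu^0,\mu^1,\dots,\mu^T)\in\mathrm{CPP}(\pi)$, $$W_{\mathfrak c}(q,t)=\prod_{\substack{1\le k\le T\\ \pi_k=1}}\varphi_{\mu^k/\mu^{k-1}}(q,t)\prod_{\substack{1\le k\le T\\ \pi_k=0}}\psi_{\mu^{k-1}/\mu^k}(q,t).$$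
   Context: Integer partitions are weakly decreasing finite sequences of nonnegative integers, identified with Young diagrams (boxes $(i,j)$ with $1\le j\le\lambda_i$); $\lambda'$ is the conjugate partition and $|\lambda|=\sum_i\lambda_i$. For partitions $\mu\subseteq\lambda$, $\lambda/\mu$ is a horizontal strip if $\lambda_1\ge\mu_1\ge\lambda_2\ge\mu_2\ge\cdots$. A cylindric plane partition with profile $\pi$ is a sequence of partitions $\mathfrak c=(\mu^0,\mu^1,\dots,\mu^T)$ with $\mu^0=\mu^T$ such that for each $1\le k\le T$: if $\pi_k=1$ then $\mu^k/\mu^{k-1}$ is a horizontal strip, and if $\pi_k=0$ then $\mu^{k-1}/\mu^k$ is a horizontal strip; $\mathrm{CPP}(\pi)$ is the set of these, and $|\mathfrak c|=|\mu^1|+\cdots+|\mu^T|$. For a box $s=(i,j)\in\lambda$ let $a_\lambda(s)=\lambda_i-j$ (arm length) and $\ell_\lambda(s)=\lambda'_j-i$ (leg length), and set $b_\lambda(s)=\frac{1-q^{a_\lambda(s)}t^{\ell_\lambda(s)+1}}{1-q^{a_\lambda(s)+1}t^{\ell_\lambda(s)}}$ if $s\in\lambda$ and $b_\lambda(s)=1$ if $s\notin\lambda$. For a horizontal strip $\lambda/\mu$, let $C_{\lambda/\mu}$ be the set of boxes $(i,j)$ (of $\lambda$ or $\mu$) lying in a column $j$ with $\lambda'_j>\mu'_j$. The Macdonald Pieri coefficients are $\varphi_{\lambda/\mu}(q,t)=\prod_{s\in C_{\lambda/\mu}} b_\lambda(s)/b_\mu(s)$ and $\psi_{\lambda/\mu}(q,t)=\prod_{s\in(\lambda\cup\mu)\setminus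 C_{\lambda/\mu}} b_\mu(s)/b_\lambda(s)$. The Pochhammer symbol is $(a;q)_\infty=\prod_{n\ge0}(1-aq^n)$. *)

theory Defs
  imports "HOL-Analysis.Analysis" "HOL-Computational_Algebra.Computational_Algebra"
begin

(* Trailing zeros are dropped, so that a partition (= Young diagram) has a unique representative. *)
definition is_partition :: "nat list \<Rightarrow> bool" where
  "is_partition lam \<longleftrightarrow> sorted_wrt (\<ge>) lam \<and> 0 \<notin> set lam"

(* Parts, rows and columns are numbered from 1; parts beyond the length are 0. *)
definition part :: "nat list \<Rightarrow> nat \<Rightarrow> nat" where
  "part lam i = (if 1 \<le> i \<and> i \<le> length lam then lam ! (i - 1) else 0)"

definition conj_part :: "nat list \<Rightarrow> nat \<Rightarrow> nat" where
  "conj_part lam j = card {i \<in> {1..length lam}. j \<le> part lam i}"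

definition boxes :: "nat list \<Rightarrow> (nat \<times> nat) set" where
  "boxes lam = {(i, j). 1 \<le> i \<and> 1 \<le> j \<and> j \<le> part lam i}"

(* The interlacing conditions include that the diagram of mu is contained in that of lam. *)
definition horizontal_strip :: "nat list \<Rightarrow> nat list \<Rightarrow> bool" where
  "horizontal_strip lam mu \<longleftrightarrow>
     (\<forall>i\<ge>1. part lam i \<ge> part mu i \<and> part mu i \<ge> part lam (i + 1))"

(* Only meaningful for boxes of the diagram, where the subtractions do not truncate. *)
definition arm :: "nat list \<Rightarrow> nat \<times> nat \<Rightarrow> nat" where
  "arm lam s = part lam (fst s) - snd s"

definition leg :: "nat list \<Rightarrow> nat \<times> nat \<Rightarrow> nat" where
  "leg lam s = conj_part lam (snd s) - fst s"

definition b_weight :: "'a::field \<Rightarrow> 'a \<Rightarrow> nat list \<Rightarrow> nat \<times> nat \<Rightarrow> 'a" where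
  "b_weight q t lam s =
     (if s \<in> boxes lam
      then (1 - q ^ arm lam s * t ^ (leg lam s + 1)) / (1 - q ^ (arm lam s + 1) * t ^ leg lam s)
      else 1)"

definition C_boxes :: "nat list \<Rightarrow> nat list \<Rightarrow> (nat \<times> nat) set" where
  "C_boxes lam mu = {s \<in> boxes lam \<union> boxes mu. conj_part lam (snd s) > conj_part mu (snd s)}"

definition phi :: "'a::field \<Rightarrow> 'a \<Rightarrow> nat list \<Rightarrow> nat list \<Rightarrow> 'a" where
  "phi q t lam mu = (\<Prod>s\<in>C_boxes lam mu. b_weight q t lam s / b_weight q t mu s)"

definition psi :: "'a::field \<Rightarrow> 'a \<Rightarrow> nat list \<Rightarrow> nat list \<Rightarrow> 'a" where
  "psi q t lam mu =
     (\<Prod>s\<in>(boxes lam \<union> boxes mu) - C_boxes lam mu. b_weight q t mu s / b_weight q t lam s)"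

(* A binary string is a bool list, with True for 1 and False for 0, so that > on bool is the
   comparison of digits. The digit in position k (counted from 1) is bs ! (k - 1). *)
definition CPP :: "bool list \<Rightarrow> nat list list set" where
  "CPP bs = {c. length c = length bs + 1 \<and> (\<forall>mu\<in>set c. is_partition mu) \<and> c ! 0 = c ! length bs \<and>
     (\<forall>k\<in>{1..length bs}.
        if bs ! (k - 1) then horizontal_strip (c ! k) (c ! (k - 1))
        else horizontal_strip (c ! (k - 1)) (c ! k))}"

(* The initial partition, which equals the final one, is not counted. *)
definition cpp_size :: "nat list list \<Rightarrow> nat" where
  "cpp_size c = (\<Sum>k\<in>{1..<length c}. sum_list (c ! k))"

definition cpp_weight :: "'a::field \<Rightarrow> 'a \<Rightarrow> bool list \<Rightarrow> nat list list \<Rightarrow> 'a" where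
  "cpp_weight q t bs c =
     (\<Prod>k\<in>{k \<in> {1..length bs}. bs ! (k - 1)}. phi q t (c ! k) (c ! (k - 1))) *
     (\<Prod>k\<in>{k \<in> {1..length bs}. \<not> bs ! (k - 1)}. psi q t (c ! (k - 1)) (c ! k))"

(* The field Q(q,t), as the fraction field of Q[t][q]: the outer polynomial variable is q. *)
type_synonym ratfun = "rat poly poly fract"

definition q_var :: ratfun where
  "q_var = to_fract [:0, 1:]"

definition t_var :: ratfun where
  "t_var = to_fract [:[:0, 1:]:]"

(* Convergence in Q(q,t) for the q-adic topology. The fractions p / r with r not divisible by q
   form the valuation ring of the q-adic valuation. *)
definition q_adic_limit :: "(nat \<Rightarrow> ratfun) \<Rightarrow> ratfun \<Rightarrow> bool" where
  "q_adic_limit x l \<longleftrightarrow>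
     (\<forall>k. \<forall>\<^sub>F n in sequentially.
        \<exists>p r. coeff r 0 \<noteq> 0 \<and> x n - l = q_var ^ k * (to_fract p / to_fract r))"

(* The Pochhammer symbol (a; q)_infinity for a power series a in z over Q(q,t). The z-adic topology
   ignores that q^n tends to 0: the product over n of 1 - z q^n has no z-adic limit. The limit is
   therefore taken coefficientwise, q-adically in each coefficient. For a = z^m or a = t z^m it
   exists in Q(q,t)[[z]], by Euler's expansion of (a; q)_infinity in powers of a. *)
definition q_pochhammer_inf :: "ratfun fps \<Rightarrow> ratfun fps" where
  "q_pochhammer_inf a =
     (THE F. \<forall>m. q_adic_limit (\<lambda>N. fps_nth (\<Prod>n<N. 1 - a * fps_const (q_var ^ n)) m) (fps_nth F m))"

end

theory Submission
  imports Defs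
begin

text \<open>
  The generating function is the trace of a product of operators on partitions, one per digit:
  a digit 1 adds a horizontal strip with weight $\varphi$, a digit 0 removes one with weight
  $\psi$, and $z$ records the size. Removing with parameter $v$ after adding with parameter $u$
  equals $(tuv;q)_\infty/(uv;q)_\infty$ times adding after removing. Moving all adding operators
  to one side and then cyclically around the trace produces the factors of the product; each lap
  multiplies the parameters by $z^T$, so in the limit only the constant sequences survive, and
  they contribute $\prod_n 1/(1-z^{(n+1)T})$.

  The commutation relation is proved matrix entry by matrix entry. In terms of the columns of the
  diagrams, $\varphi$ and $\psi$ are products of $F(x)=(1-qx)(1-tx/q)/((1-x)(1-tx))$ over pairs of
  columns, and for fixed outer partitions both sides become sums over sets $S$ of columns. They are
  the limits, as the number $N$ of columns grows, of the two sides of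
  $\sum_S\prod_{i\in S,k\notin S}F(y_i/y_k)=\sum_S\prod_{i\in S,k\notin S}F(y_k/y_i)$
  (sums over subsets of fixed size), where on the right the last columns split off and contribute the
  coefficients of the infinite products.
\<close>

section \<open>A reversal identity for sums over subsets of nodes\<close>

text \<open>The finite identity sums over all sets of columns, including those whose change does not
  leave a partition. These drop out by themselves: adjacent columns of equal height have nodes in
  ratio \<open>1 / q\<close>, and \<open>F (1 / q) = 0\<close>. The zero needs both columns to be
  present. A raised column can conflict only with its left neighbour, which lies among the first
  \<open>N\<close> columns; a lowered column conflicts with its right neighbour, and column
  \<open>N\<close> has none. Hence sets that contain a final run of empty columns survive on the
  removal side. Such a run moves off to infinity and leaves only a scalar. A finite \<open>N\<close>
  also leaves a boundary factor \<open>tail\<close> for every raised column. Both effects settle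
  only as \<open>N\<close> grows, and in the \<open>q\<close>-adic topology, because the node of a
  column near \<open>N\<close> carries the power \<open>q ^ N\<close>; this is also the topology in
  which the Pochhammer symbol is defined. The function \<open>F\<close> is the ratio by which the
  interaction of two columns changes when their height difference grows by one.\<close>

definition pair_factor :: "'a::field \<Rightarrow> 'a \<Rightarrow> 'a \<Rightarrow> 'a" where
  "pair_factor q t x = (1 - q * x) * (1 - t * x / q) / ((1 - x) * (1 - t * x))"

lemma poly_linear: "poly [:- a, 1:] x = x - a" "poly [:a, - b:] x = a - b * (x::'a::comm_ring_1)"
  by (simp_all add: mult.commute)

lemma cancel_factors: "c \<noteq> 0 \<Longrightarrow> d \<noteq> 0 \<Longrightarrow> c * e * d * (n / (c * d)) = n * (e::'a::field)"
  by simp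

lemma cancel_factors_minus:
  "c \<noteq> 0 \<Longrightarrow> e \<noteq> 0 \<Longrightarrow> (- c) * e * d * (n / (c * e)) = - (n * (d::'a::field))"
  by simp

text \<open>Clears the inner fractions, so that numerator and denominator become products of linear
  polynomials in \<open>x\<close>.\<close>

lemma pair_factor_ratio:
  assumes "q \<noteq> 0" "x \<noteq> 0"
  shows "pair_factor q t (v / x) = ((x - q * v) * (x - t * v / q)) / ((x - v) * (x - t * v))"
proof -
  have e: "1 - q * (v / x) = (x - q * v) / x" "1 - t * (v / x) / q = (x - t * v / q) / x"
    "1 - v / x = (x - v) / x" "1 - t * (v / x) = (x - t * v) / x"
    using assms by (simp_all add: diff_divide_distrib)
  show ?thesis unfolding pair_factor_def e using assms(2) by simp
qed

text \<open>\<open>pair_factor q t\<close> is invariant under the involution sending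
  \<open>u\<close> to \<open>1 / (t * u)\<close>: up to monomials it swaps the two numerator factors
  and the two denominator factors, and these monomials agree.\<close>

lemma pair_factor_inverse:
  assumes "q \<noteq> 0" "t \<noteq> 0" "x \<noteq> 0"
  shows "pair_factor q t (1 / x) = pair_factor q t (x / t)"
proof -
  have "(1 - q / x) * (1 - t / (q * x)) = t * ((1 - q * x / t) * (1 - x / q)) / x ^ 2"
    using assms by (simp add: field_simps power2_eq_square)
  moreover have "(1 - 1 / x) * (1 - t / x) = t * ((1 - x / t) * (1 - x)) / x ^ 2"
    using assms by (simp add: field_simps power2_eq_square)
  ultimately show ?thesis
    using assms unfolding pair_factor_def by (simp add: mult.commute)
qed

lemma pair_factor_flip:
  assumes "q \<noteq> 0" "t \<noteq> 0" "x \<noteq> 0" "y \<noteq> 0"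
  shows "pair_factor q t (x / y) = pair_factor q t (y / (t * x))"
  using pair_factor_inverse[of q t "y / x"] assms by (simp add: mult.commute)

definition subset_weight :: "('b \<Rightarrow> 'b \<Rightarrow> 'a::comm_ring_1) \<Rightarrow> 'b set \<Rightarrow> 'b set \<Rightarrow> 'a" where
  "subset_weight f Y S = (\<Prod>i\<in>S. \<Prod>k\<in>Y - S. f i k)"

text \<open>\<open>h\<close> stays arbitrary because the induction below passes from
  \<open>h\<close> to \<open>h \<circ> Suc\<close>; an indicator function recovers the subsets of a
  fixed size.\<close>

definition subset_sum :: "('b \<Rightarrow> 'b \<Rightarrow> 'a::comm_ring_1) \<Rightarrow> 'b set \<Rightarrow> (nat \<Rightarrow> 'a) \<Rightarrow> 'a" where
  "subset_sum f Y h = (\<Sum>S\<in>Pow Y. h (card S) * subset_weight f Y S)"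

lemma subset_weight_insert_out:
  assumes "finite Y" "z \<notin> Y" "S \<subseteq> Y"
  shows "subset_weight f (insert z Y) S = subset_weight f Y S * (\<Prod>i\<in>S. f i z)"
proof -
  have eq: "insert z Y - S = insert z (Y - S)" using assms by auto
  show ?thesis unfolding subset_weight_def eq using assms
    by (simp add: prod.distrib mult.commute)
qed

lemma subset_weight_insert_in:
  assumes "finite Y" "z \<notin> Y" "S \<subseteq> Y"
  shows "subset_weight f (insert z Y) (insert z S) = subset_weight f Y S * (\<Prod>k\<in>Y - S. f z k)"
proof -
  have eq: "insert z Y - insert z S = Y - S" using assms by auto
  have "finite S" "z \<notin> S" using assms finite_subset by auto
  then show ?thesis unfolding subset_weight_def eq
    by (simp add: mult.commute)
qed

lemma sum_Pow_insert:
  assumes "finite Y" "z \<notin> Y"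
  shows "(\<Sum>S\<in>Pow (insert z Y). g S) = (\<Sum>S\<in>Pow Y. g S + (g (insert z S) :: 'a::comm_monoid_add))"
proof -
  have "inj_on (insert z) (Pow Y)" using assms(2) by (auto simp: inj_on_def)
  moreover have "Pow Y \<inter> insert z ` Pow Y = {}" using assms by auto
  ultimately show ?thesis using assms
    by (simp add: Pow_insert sum.union_disjoint sum.reindex sum.distrib)
qed

text \<open>The shape of a subset sum over \<open>Y\<close> and one more node, after multiplication
  by a common denominator \<open>prod d Y\<close>. The first summand belongs to the sets without the
  new node, the second to those with it; the new node occurs only in \<open>a\<close>,
  \<open>b\<close> and \<open>d\<close>.\<close>

definition two_term_sum ::
  "'b set \<Rightarrow> ('b set \<Rightarrow> 'a) \<Rightarrow> ('b set \<Rightarrow> 'a) \<Rightarrow> ('b \<Rightarrow> 'a) \<Rightarrow> ('b \<Rightarrow> 'a) \<Rightarrow> ('b \<Rightarrow> 'a) \<Rightarrow> 'a::comm_ring_1" where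
  "two_term_sum Y c0 c1 a b d =
     (\<Sum>S\<in>Pow Y. c0 S * (prod a S * prod d (Y - S)) + c1 S * (prod b (Y - S) * prod d S))"

lemma subset_sum_insert:
  assumes "finite Y" "z \<notin> Y"
  shows "(\<Prod>i\<in>Y. d i) * subset_sum f (insert z Y) h =
    two_term_sum Y (\<lambda>S. h (card S) * subset_weight f Y S) (\<lambda>S. h (Suc (card S)) * subset_weight f Y S)
      (\<lambda>i. d i * f i z) (\<lambda>k. d k * f z k) d"
proof -
  have "prod d Y * (h (card S) * subset_weight f (insert z Y) S +
      h (card (insert z S)) * subset_weight f (insert z Y) (insert z S))
     = h (card S) * subset_weight f Y S * ((\<Prod>i\<in>S. d i * f i z) * prod d (Y - S)) +
       h (Suc (card S)) * subset_weight f Y S * ((\<Prod>k\<in>Y - S. d k * f z k) * prod d S)"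
    if "S \<in> Pow Y" for S
  proof -
    have S: "S \<subseteq> Y" "finite S" "z \<notin> S" using that assms finite_subset by auto
    have "prod d Y = prod d S * prod d (Y - S)"
      using prod.subset_diff[OF S(1) assms(1), of d] by (simp add: mult.commute)
    then show ?thesis using S assms
      by (simp add: subset_weight_insert_out subset_weight_insert_in prod.distrib algebra_simps)
  qed
  then show ?thesis unfolding subset_sum_def two_term_sum_def
    by (subst sum_Pow_insert[OF assms]) (simp add: sum_distrib_left)
qed

text \<open>At a zero of \<open>d k\<close> the first summand survives only if \<open>k\<close> lies
  in the set, the second only if it does not. Each \<open>S\<close> without \<open>k\<close>
  therefore receives one term from \<open>insert k S\<close> and one from \<open>S\<close>, both
  with \<open>h (Suc (card S))\<close>.\<close>

lemma two_term_sum_zero: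
  fixes f :: "'b \<Rightarrow> 'b \<Rightarrow> 'a::comm_ring_1"
  assumes fin: "finite Y" and k: "k \<notin> Y" and d: "d k = 0"
    and a: "\<And>i. i \<in> Y \<Longrightarrow> a i = d i * \<alpha> i" and b: "\<And>i. i \<in> Y \<Longrightarrow> b i = d i * \<beta> i"
  shows "two_term_sum (insert k Y) (\<lambda>S. h (card S) * subset_weight f (insert k Y) S)
      (\<lambda>S. h (Suc (card S)) * subset_weight f (insert k Y) S) a b d =
    (\<Sum>S\<in>Pow Y. h (Suc (card S)) * subset_weight f Y S * prod d Y *
      (a k * ((\<Prod>j\<in>Y - S. f k j) * prod \<alpha> S) + b k * ((\<Prod>i\<in>S. f i k) * prod \<beta> (Y - S))))"
proof -
  have "h (card S) * subset_weight f (insert k Y) S * (prod a S * prod d (insert k Y - S)) +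
       h (Suc (card S)) * subset_weight f (insert k Y) S * (prod b (insert k Y - S) * prod d S) +
      (h (card (insert k S)) * subset_weight f (insert k Y) (insert k S) *
         (prod a (insert k S) * prod d (insert k Y - insert k S)) +
       h (Suc (card (insert k S))) * subset_weight f (insert k Y) (insert k S) *
         (prod b (insert k Y - insert k S) * prod d (insert k S)))
    = h (Suc (card S)) * subset_weight f Y S * prod d Y *
      (a k * ((\<Prod>j\<in>Y - S. f k j) * prod \<alpha> S) + b k * ((\<Prod>i\<in>S. f i k) * prod \<beta> (Y - S)))"
    if "S \<in> Pow Y" for S
  proof -
    have S: "S \<subseteq> Y" "finite S" "k \<notin> S" "finite (Y - S)" using that assms finite_subset by auto
    have e: "insert k Y - S = insert k (Y - S)" "insert k Y - insert k S = Y - S" using S k by auto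
    have pd: "prod d Y = prod d S * prod d (Y - S)"
      using prod.subset_diff[OF S(1) fin, of d] by (simp add: mult.commute)
    have pa: "prod a S = prod d S * prod \<alpha> S"
      unfolding prod.distrib[symmetric] by (rule prod.cong) (use S a in auto)
    have pb: "prod b (Y - S) = prod d (Y - S) * prod \<beta> (Y - S)"
      unfolding prod.distrib[symmetric] by (rule prod.cong) (use S b in auto)
    show ?thesis using S fin k d unfolding e pd
      by (simp add: subset_weight_insert_out subset_weight_insert_in pa pb algebra_simps)
  qed
  then show ?thesis unfolding two_term_sum_def
    by (subst sum_Pow_insert[OF fin k]) simp
qed

section \<open>Degrees and top coefficients of the cleared sums\<close>

lemma coeff_prod_cubic:
  fixes p :: "'b \<Rightarrow> 'a::idom poly"
  assumes "finite A" "\<And>i. i \<in> A \<Longrightarrow> degree (p i) \<le> 3"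
  shows "degree (prod p A) \<le> 3 * card A \<and> coeff (prod p A) (3 * card A) = (\<Prod>i\<in>A. coeff (p i) 3)"
  using assms
proof (induction A rule: finite_induct)
  case (insert x A)
  have d: "degree (p x) \<le> 3" "degree (prod p A) \<le> 3 * card A" using insert by auto
  have "degree (p x * prod p A) \<le> 3 + 3 * card A"
    using degree_mult_le[of "p x" "prod p A"] d by linarith
  moreover have "coeff (p x * prod p A) (3 + 3 * card A) = coeff (p x) 3 * coeff (prod p A) (3 * card A)"
  proof (cases "degree (p x) = 3 \<and> degree (prod p A) = 3 * card A")
    case True
    then show ?thesis using coeff_mult_degree_sum[of "p x" "prod p A"] by simp
  next
    case False
    then have "degree (p x) < 3 \<or> degree (prod p A) < 3 * card A" using d by linarith
    moreover have "degree (p x * prod p A) < 3 + 3 * card A"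
      using degree_mult_le[of "p x" "prod p A"] d False by linarith
    ultimately show ?thesis by (auto simp: coeff_eq_0)
  qed
  ultimately show ?case using insert by simp
qed auto

text \<open>All cubic factors share the top coefficient \<open>u\<close>, so every term contributes
  \<open>u ^ card Y\<close> whatever \<open>S\<close> is, and only the coefficients
  \<open>c0\<close> and \<open>c1\<close> remain visible.\<close>

lemma coeff_two_term_sum:
  fixes a b d :: "'b \<Rightarrow> 'a::idom poly" and c0 c1 :: "'b set \<Rightarrow> 'a"
  assumes "finite Y"
    and "\<And>i. i \<in> Y \<Longrightarrow> degree (a i) \<le> 3 \<and> coeff (a i) 3 = u"
    and "\<And>i. i \<in> Y \<Longrightarrow> degree (b i) \<le> 3 \<and> coeff (b i) 3 = u"
    and "\<And>i. i \<in> Y \<Longrightarrow> degree (d i) \<le> 3 \<and> coeff (d i) 3 = u"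
  defines "P \<equiv> two_term_sum Y (\<lambda>S. [:c0 S:]) (\<lambda>S. [:c1 S:]) a b d"
  shows "degree P \<le> 3 * card Y" "coeff P (3 * card Y) = u ^ card Y * (\<Sum>S\<in>Pow Y. c0 S + c1 S)"
proof -
  have *: "degree (prod e S * prod g (Y - S)) \<le> 3 * card Y \<and>
      coeff (prod e S * prod g (Y - S)) (3 * card Y) = u ^ card Y"
    if "S \<subseteq> Y" and "\<And>i. i \<in> Y \<Longrightarrow> degree (e i) \<le> 3 \<and> coeff (e i) 3 = u"
      and "\<And>i. i \<in> Y \<Longrightarrow> degree (g i) \<le> 3 \<and> coeff (g i) 3 = u" for e g :: "'b \<Rightarrow> 'a poly" and S
  proof -
    let ?p = "\<lambda>i. if i \<in> S then e i else g i"
    have 1: "prod ?p S = prod e S" "prod ?p (Y - S) = prod g (Y - S)" by (auto intro: prod.cong)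
    have "prod e S * prod g (Y - S) = prod ?p Y"
      using prod.subset_diff[OF that(1) assms(1), of ?p] unfolding 1 by (simp add: mult.commute)
    moreover have "(\<Prod>i\<in>Y. coeff (?p i) 3) = (\<Prod>i\<in>Y. u)" using that by (intro prod.cong) auto
    ultimately show ?thesis using coeff_prod_cubic[of Y ?p] that assms(1) by auto
  qed
  have 1: "degree (prod a S * prod d (Y - S)) \<le> 3 * card Y \<and>
      coeff (prod a S * prod d (Y - S)) (3 * card Y) = u ^ card Y" if "S \<subseteq> Y" for S
    using * assms that by auto
  have 2: "degree (prod b (Y - S) * prod d S) \<le> 3 * card Y \<and>
      coeff (prod b (Y - S) * prod d S) (3 * card Y) = u ^ card Y" if "S \<subseteq> Y" for S
    using *[OF that assms(4) assms(3)] by (simp add: mult.commute)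
  show "degree P \<le> 3 * card Y" unfolding P_def two_term_sum_def
    by (rule degree_sum_le) (use 1 2 assms(1) in \<open>auto intro!: degree_add_le order_trans[OF degree_smult_le]\<close>)
  show "coeff P (3 * card Y) = u ^ card Y * (\<Sum>S\<in>Pow Y. c0 S + c1 S)"
    unfolding P_def two_term_sum_def coeff_sum sum_distrib_left
    by (rule sum.cong) (use 1 2 in \<open>auto simp: algebra_simps\<close>)
qed

lemma poly_two_term_sum:
  "poly (two_term_sum Y (\<lambda>S. [:c0 S:]) (\<lambda>S. [:c1 S:]) a b d) x =
    two_term_sum Y c0 c1 (\<lambda>i. poly (a i) x) (\<lambda>i. poly (b i) x) (\<lambda>i. poly (d i) x)"
  unfolding two_term_sum_def by (simp add: poly_sum poly_prod)

text \<open>The conditions keep the denominators of the pair factors nonzero and the points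
  \<open>y k\<close>, \<open>y k / t\<close>, \<open>t * y k\<close> of different nodes apart; the
  one with \<open>t ^ 2\<close> separates \<open>y i / t\<close> from
  \<open>t * y k\<close>.\<close>

definition generic_nodes :: "'a::field \<Rightarrow> ('b \<Rightarrow> 'a) \<Rightarrow> 'b set \<Rightarrow> bool" where
  "generic_nodes t y Z \<longleftrightarrow> (\<forall>i\<in>Z. y i \<noteq> 0) \<and>
     (\<forall>i\<in>Z. \<forall>k\<in>Z. i \<noteq> k \<longrightarrow> y i \<noteq> y k \<and> y i \<noteq> t * y k \<and> y i \<noteq> t ^ 2 * y k)"

lemma generic_nodes_subset: "generic_nodes t y Z \<Longrightarrow> Y \<subseteq> Z \<Longrightarrow> generic_nodes t y Y"
  unfolding generic_nodes_def by (meson subsetD)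

text \<open>
  After clearing denominators both sides are polynomials in the node \<open>y z\<close> of degree
  at most \<open>3 * card Y\<close>; their difference vanishes at the \<open>3 * card Y\<close> points
  \<open>y k\<close>, \<open>y k / t\<close>, \<open>t * y k\<close> and its top coefficient vanishes by induction.
\<close>
theorem subset_sum_reverse:
  fixes y :: "'b \<Rightarrow> 'a::field"
  assumes "finite Z" "generic_nodes t y Z" and q0: "q \<noteq> 0" and t: "t \<noteq> 0" "t \<noteq> 1" "t ^ 2 \<noteq> 1"
  shows "subset_sum (\<lambda>i k. pair_factor q t (y i / y k)) Z h =
         subset_sum (\<lambda>i k. pair_factor q t (y k / y i)) Z h"
  using assms(1,2)
proof (induction "card Z" arbitrary: Z h rule: less_induct)
  case (less Z)
  show ?case
  proof (cases "Z = {}")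
    case True
    then show ?thesis by (simp add: subset_sum_def subset_weight_def)
  next
    case False
    then obtain z where z: "z \<in> Z" by blast
    define Y where "Y = Z - {z}"
    have Z: "Z = insert z Y" "z \<notin> Y" "finite Y" using z less.prems unfolding Y_def by auto
    define F where "F = pair_factor q t"
    define f where "f = (\<lambda>i k. F (y i / y k))"
    define g where "g = (\<lambda>i k. F (y k / y i))"
    \<comment> \<open>\<open>F (y i / x)\<close> and \<open>F (x / y i)\<close> have the
      denominators \<open>(x - y i) * (x - t * y i)\<close> and
      \<open>(y i - x) * (y i - t * x)\<close>. They share a factor up to sign, so the cubic
      \<open>D i\<close> clears both; \<open>A i\<close> and \<open>B i\<close> are the resulting
      numerators, and the sign is the minus in \<open>B i\<close>.\<close>
    define D where "D = (\<lambda>i. [:- y i, 1:] * [:y i, - t:] * [:- (t * y i), 1:])"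
    define A where "A = (\<lambda>i. [:- (q * y i), 1:] * [:- (t * y i / q), 1:] * [:y i, - t:])"
    define B where "B = (\<lambda>i. - ([:y i, - q:] * [:y i, - (t / q):] * [:- (t * y i), 1:]))"
    note gen = less.prems(2)[unfolded generic_nodes_def]
    have genY: "generic_nodes t y Y" using generic_nodes_subset[OF less.prems(2)] Z by blast
    have ynz: "y i \<noteq> 0" if "i \<in> Z" for i using gen that by auto
    have D: "poly (D i) x = (x - y i) * (y i - t * x) * (x - t * y i)" for i x
      unfolding D_def poly_mult poly_linear ..
    have A: "poly (A i) x = ((x - q * y i) * (x - t * y i / q)) * (y i - t * x)" for i x
      unfolding A_def poly_mult poly_linear ..
    have B: "poly (B i) x = - (((y i - q * x) * (y i - t * x / q)) * (x - t * y i))" for i x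
      unfolding B_def poly_mult poly_linear poly_minus by simp
    have Ax: "poly (A i) x = poly (D i) x * F (y i / x)" and Bx: "poly (B i) x = poly (D i) x * F (x / y i)"
      if "i \<in> Y" "x \<noteq> 0" "x \<noteq> y i" "y i \<noteq> t * x" "x \<noteq> t * y i" for i x
    proof -
      have yi: "y i \<noteq> 0" using ynz that Z by auto
      show "poly (A i) x = poly (D i) x * F (y i / x)"
        unfolding A D F_def pair_factor_ratio[OF q0 that(2)]
        by (rule cancel_factors[symmetric]) (use that in simp_all)
      have "x - y i = - (y i - x)" by simp
      then show "poly (B i) x = poly (D i) x * F (x / y i)"
        unfolding B D F_def pair_factor_ratio[OF q0 yi]
        by (simp only:) (rule cancel_factors_minus[symmetric]; use that in simp)
    qed
    define L where "L = (\<lambda>f a b. two_term_sum Y (\<lambda>S. [:h (card S) * subset_weight f Y S:])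
      (\<lambda>S. [:h (Suc (card S)) * subset_weight f Y S:]) a b D)"
    \<comment> \<open>Inverting the arguments of the pair factor exchanges the two
      numerators.\<close>
    define P where "P = L f A B - L g B A"
    have top: "degree (D i) \<le> 3 \<and> coeff (D i) 3 = - t" "degree (A i) \<le> 3 \<and> coeff (A i) 3 = - t"
      "degree (B i) \<le> 3 \<and> coeff (B i) 3 = - t" for i
      using q0 unfolding D_def A_def B_def by (auto simp: numeral_3_eq_3)
    have IHY: "subset_sum f Y h = subset_sum g Y h" for h
      using less.hyps[of Y h] genY Z unfolding f_def g_def F_def by auto
    have degP: "degree P \<le> 3 * card Y"
      unfolding P_def L_def
      by (intro degree_diff_le coeff_two_term_sum(1)[where u = "- t"]) (use top Z in auto)
    \<comment> \<open>The top coefficients are subset sums over \<open>Y\<close> alone, where the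
      induction hypothesis applies to \<open>h\<close> and to its shift.\<close>
    have "coeff (L f A B) (3 * card Y) = (- t) ^ card Y * (subset_sum f Y h + subset_sum f Y (h \<circ> Suc))"
      unfolding L_def subset_sum_def
      by (subst coeff_two_term_sum(2)[where u = "- t"]) (use top Z in \<open>auto simp: sum.distrib\<close>)
    moreover have "coeff (L g B A) (3 * card Y) = (- t) ^ card Y * (subset_sum g Y h + subset_sum g Y (h \<circ> Suc))"
      unfolding L_def subset_sum_def
      by (subst coeff_two_term_sum(2)[where u = "- t"]) (use top Z in \<open>auto simp: sum.distrib\<close>)
    ultimately have topP: "coeff P (3 * card Y) = 0" unfolding P_def by (simp add: IHY)
    have evalL: "poly (L f a b) x = two_term_sum Y (\<lambda>S. h (card S) * subset_weight f Y S)
       (\<lambda>S. h (Suc (card S)) * subset_weight f Y S)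
       (\<lambda>i. poly (a i) x) (\<lambda>i. poly (b i) x) (\<lambda>i. poly (D i) x)" for f a b x
      unfolding L_def by (rule poly_two_term_sum)
    define R where "R = (\<Union>k\<in>Y. {y k, y k / t, t * y k})"
    have roots: "poly P x = 0" if "x \<in> R" for x
    proof -
      obtain k where k: "k \<in> Y" "x \<in> {y k, y k / t, t * y k}" using \<open>x \<in> R\<close> unfolding R_def by auto
      define Y' where "Y' = Y - {k}"
      have Y': "Y = insert k Y'" "k \<notin> Y'" "finite Y'" using k Z unfolding Y'_def by auto
      have yk: "y k \<noteq> 0" using ynz k Z by auto
      have x0: "x \<noteq> 0" using k yk t by auto
      have good: "x \<noteq> y i" "y i \<noteq> t * x" "x \<noteq> t * y i" if "i \<in> Y'" for i
      proof -
        have "i \<in> Z" "k \<in> Z" "i \<noteq> k" using that Y' Z by auto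
        then have "y i \<noteq> y k" "y i \<noteq> t * y k" "y i \<noteq> t ^ 2 * y k" "y k \<noteq> t * y i" "y k \<noteq> t ^ 2 * y i"
          using gen by metis+
        then show "x \<noteq> y i" "y i \<noteq> t * x" "x \<noteq> t * y i" using k t
          by (auto simp: field_simps power2_eq_square)
      qed
      \<comment> \<open>The three points belonging to \<open>k\<close> are exactly the zeros of
        \<open>D k\<close>, which is why the sums collapse to subsets of \<open>Y'\<close>.\<close>
      have Dk: "poly (D k) x = 0" unfolding D using k t by auto
      have IH': "subset_sum f Y' h = subset_sum g Y' h" for h
      proof -
        have "card Y' < card Z" using Y' Z by simp
        then show ?thesis
          using less.hyps[of Y' h] Y' generic_nodes_subset[OF genY, of Y'] unfolding f_def g_def F_def
          by blast
      qed
      define a b where "a = poly (A k) x" and "b = poly (B k) x"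
      define dd where "dd = (\<Prod>i\<in>Y'. poly (D i) x)"
      have e1: "poly (L f A B) x = (\<Sum>S\<in>Pow Y'. h (Suc (card S)) * subset_weight f Y' S * dd *
        (a * ((\<Prod>j\<in>Y' - S. f k j) * (\<Prod>i\<in>S. F (y i / x))) + b * ((\<Prod>i\<in>S. f i k) * (\<Prod>j\<in>Y' - S. F (x / y j)))))"
        unfolding evalL Y'(1) a_def b_def dd_def
        by (rule two_term_sum_zero) (use Y' Dk Ax Bx good x0 in auto)
      have e2: "poly (L g B A) x = (\<Sum>S\<in>Pow Y'. h (Suc (card S)) * subset_weight g Y' S * dd *
        (b * ((\<Prod>j\<in>Y' - S. g k j) * (\<Prod>i\<in>S. F (x / y i))) + a * ((\<Prod>i\<in>S. g i k) * (\<Prod>j\<in>Y' - S. F (y j / x)))))"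
        unfolding evalL Y'(1) a_def b_def dd_def
        by (rule two_term_sum_zero) (use Y' Dk Ax Bx good x0 in auto)
      have split: "prod u S * prod u (Y' - S) = prod u Y'" if "S \<in> Pow Y'" for S and u :: "'b \<Rightarrow> 'a"
        using prod.subset_diff[of S Y' u] that Y' by (auto simp: mult.commute)
      consider "x = y k" | "x = y k / t" | "x = t * y k" using k by blast
      then have "poly (L f A B) x = poly (L g B A) x"
      proof cases
        case 1
        \<comment> \<open>At \<open>x = y k\<close> the two surviving terms carry the same products,
          so opposite \<open>a\<close> and \<open>b\<close> cancel for each \<open>S\<close>
          separately.\<close>
        have ab: "b = - a" unfolding a_def b_def A B 1 by simp
        have "poly (L f A B) x = 0"
          unfolding e1 ab by (rule sum.neutral) (simp add: f_def 1 mult.commute)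
        moreover have "poly (L g B A) x = 0"
          unfolding e2 ab by (rule sum.neutral) (simp add: g_def 1 mult.commute)
        ultimately show ?thesis by simp
      next
        case 2
        have a0: "a = 0" unfolding a_def A 2 using t by simp
        \<comment> \<open>The involution turns the interaction with \<open>k\<close> into the one
          with \<open>x\<close>. The factors over \<open>S\<close> and over its complement then run
          together over all of \<open>Y'\<close>, which leaves a smaller subset sum times a
          constant.\<close>
        have fe: "F (y i / y k) = F (x / y i)" if "i \<in> Y'" for i
          using pair_factor_flip[of q t "y i" "y k"] that ynz Z Y' q0 t yk unfolding F_def 2 by (simp add: mult.commute)
        have "poly (L f A B) x = (\<Sum>S\<in>Pow Y'. (h \<circ> Suc) (card S) * subset_weight f Y' S) * (dd * b * (\<Prod>i\<in>Y'. F (x / y i)))"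
          unfolding e1 a0 sum_distrib_right
        proof (rule sum.cong[OF refl])
          fix S assume S: "S \<in> Pow Y'"
          have "(\<Prod>i\<in>S. f i k) = (\<Prod>i\<in>S. F (x / y i))"
            unfolding f_def by (rule prod.cong) (use S fe in auto)
          then show "h (Suc (card S)) * subset_weight f Y' S * dd *
              (0 * ((\<Prod>j\<in>Y' - S. f k j) * (\<Prod>i\<in>S. F (y i / x))) + b * ((\<Prod>i\<in>S. f i k) * (\<Prod>j\<in>Y' - S. F (x / y j)))) =
            (h \<circ> Suc) (card S) * subset_weight f Y' S * (dd * b * (\<Prod>i\<in>Y'. F (x / y i)))"
            using split[OF S, of "\<lambda>i. F (x / y i)"] by simp
        qed
        moreover have "poly (L g B A) x = (\<Sum>S\<in>Pow Y'. (h \<circ> Suc) (card S) * subset_weight g Y' S) * (dd * b * (\<Prod>i\<in>Y'. F (x / y i)))"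
          unfolding e2 a0 sum_distrib_right
        proof (rule sum.cong[OF refl])
          fix S assume S: "S \<in> Pow Y'"
          have "(\<Prod>j\<in>Y' - S. g k j) = (\<Prod>j\<in>Y' - S. F (x / y j))"
            unfolding g_def by (rule prod.cong) (use S fe in auto)
          then show "h (Suc (card S)) * subset_weight g Y' S * dd *
              (b * ((\<Prod>j\<in>Y' - S. g k j) * (\<Prod>i\<in>S. F (x / y i))) + 0 * ((\<Prod>i\<in>S. g i k) * (\<Prod>j\<in>Y' - S. F (y j / x)))) =
            (h \<circ> Suc) (card S) * subset_weight g Y' S * (dd * b * (\<Prod>i\<in>Y'. F (x / y i)))"
            using split[OF S, of "\<lambda>i. F (x / y i)"] by (simp add: mult.commute)
        qed
        ultimately show ?thesis using IH'[of "h \<circ> Suc"] unfolding subset_sum_def by simp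
      next
        case 3
        have b0: "b = 0" unfolding b_def B 3 by simp
        \<comment> \<open>The same collapse with the roles of \<open>a\<close> and \<open>b\<close>
          exchanged.\<close>
        have fe: "F (y k / y i) = F (y i / x)" if "i \<in> Y'" for i
          using pair_factor_flip[of q t "y k" "y i"] that ynz Z Y' q0 t yk unfolding F_def 3 by simp
        have "poly (L f A B) x = (\<Sum>S\<in>Pow Y'. (h \<circ> Suc) (card S) * subset_weight f Y' S) * (dd * a * (\<Prod>i\<in>Y'. F (y i / x)))"
          unfolding e1 b0 sum_distrib_right
        proof (rule sum.cong[OF refl])
          fix S assume S: "S \<in> Pow Y'"
          have "(\<Prod>j\<in>Y' - S. f k j) = (\<Prod>j\<in>Y' - S. F (y j / x))"
            unfolding f_def by (rule prod.cong) (use S fe in auto)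
          then show "h (Suc (card S)) * subset_weight f Y' S * dd *
              (a * ((\<Prod>j\<in>Y' - S. f k j) * (\<Prod>i\<in>S. F (y i / x))) + 0 * ((\<Prod>i\<in>S. f i k) * (\<Prod>j\<in>Y' - S. F (x / y j)))) =
            (h \<circ> Suc) (card S) * subset_weight f Y' S * (dd * a * (\<Prod>i\<in>Y'. F (y i / x)))"
            using split[OF S, of "\<lambda>i. F (y i / x)"] by (simp add: mult.commute)
        qed
        moreover have "poly (L g B A) x = (\<Sum>S\<in>Pow Y'. (h \<circ> Suc) (card S) * subset_weight g Y' S) * (dd * a * (\<Prod>i\<in>Y'. F (y i / x)))"
          unfolding e2 b0 sum_distrib_right
        proof (rule sum.cong[OF refl])
          fix S assume S: "S \<in> Pow Y'"
          have "(\<Prod>i\<in>S. g i k) = (\<Prod>i\<in>S. F (y i / x))"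
            unfolding g_def by (rule prod.cong) (use S fe in auto)
          then show "h (Suc (card S)) * subset_weight g Y' S * dd *
              (0 * ((\<Prod>j\<in>Y' - S. g k j) * (\<Prod>i\<in>S. F (x / y i))) + a * ((\<Prod>i\<in>S. g i k) * (\<Prod>j\<in>Y' - S. F (y j / x)))) =
            (h \<circ> Suc) (card S) * subset_weight g Y' S * (dd * a * (\<Prod>i\<in>Y'. F (y i / x)))"
            using split[OF S, of "\<lambda>i. F (y i / x)"] by simp
        qed
        ultimately show ?thesis using IH'[of "h \<circ> Suc"] unfolding subset_sum_def by simp
      qed
      then show ?thesis unfolding P_def by simp
    qed
    \<comment> \<open>The conditions on \<open>t\<close> separate the three points of one node,
      genericity those of different nodes.\<close>
    have cardR: "card R = 3 * card Y"
    proof -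
      have "card R = (\<Sum>k\<in>Y. card {y k, y k / t, t * y k})"
        unfolding R_def
      proof (rule card_UN_disjoint)
        show "\<forall>i\<in>Y. \<forall>j\<in>Y. i \<noteq> j \<longrightarrow> {y i, y i / t, t * y i} \<inter> {y j, y j / t, t * y j} = {}"
        proof (intro ballI impI)
          fix i j assume "i \<in> Y" "j \<in> Y" "i \<noteq> j"
          then have "y i \<noteq> y j" "y i \<noteq> t * y j" "y i \<noteq> t ^ 2 * y j" "y j \<noteq> t * y i" "y j \<noteq> t ^ 2 * y i"
            using genY unfolding generic_nodes_def by metis+
          then have n: "y i \<noteq> y j" "y i \<noteq> t * y j" "y i \<noteq> t * (t * y j)" "y j \<noteq> t * y i" "y j \<noteq> t * (t * y i)"
            by (simp_all add: power2_eq_square mult.assoc)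
          have "y i \<noteq> y j / t" "y i / t \<noteq> y j" "y i / t \<noteq> y j / t" "y i / t \<noteq> t * y j"
            "t * y i \<noteq> y j / t" "t * y i \<noteq> t * y j"
            using n t(1) by (metis nonzero_mult_div_cancel_left times_divide_eq_right)+
          then show "{y i, y i / t, t * y i} \<inter> {y j, y j / t, t * y j} = {}" using n by auto
        qed
      qed (use Z(3) in simp_all)
      also have "\<dots> = (\<Sum>k\<in>Y. 3)"
      proof (rule sum.cong[OF refl])
        fix k assume "k \<in> Y"
        then have yk: "y k \<noteq> 0" using ynz Z by auto
        have "y k \<noteq> y k / t" "y k \<noteq> t * y k" using yk t by (auto simp: field_simps)
        moreover have "y k / t \<noteq> t * y k"
        proof
          assume "y k / t = t * y k"
          then have "y k = t * t * y k" using t by (simp add: field_simps)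
          then show False using yk t by (simp add: power2_eq_square)
        qed
        ultimately show "card {y k, y k / t, t * y k} = 3" by simp
      qed
      finally show ?thesis by simp
    qed
    have "P = 0"
    proof (rule ccontr)
      assume P: "P \<noteq> 0"
      \<comment> \<open>The degree bound alone equals the number of known roots; the vanishing top
        coefficient makes it strictly smaller.\<close>
      have "degree P \<noteq> 3 * card Y" using topP P leading_coeff_0_iff[of P] by metis
      then have "degree P < card R" using degP cardR by simp
      moreover have "card R \<le> card {x. poly P x = 0}"
        by (rule card_mono[OF poly_roots_finite[OF P]]) (use roots in auto)
      ultimately show False using card_poly_roots_bound[OF P] by linarith
    qed
    then have eq: "poly (L f A B) (y z) = poly (L g B A) (y z)" unfolding P_def by simp
    define dd where "dd = (\<lambda>i. poly (D i) (y z))"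
    have goodz: "y z \<noteq> y i" "y i \<noteq> t * y z" "y z \<noteq> t * y i" if "i \<in> Y" for i
      using gen that Z by (metis insertCI)+
    have ddnz: "prod dd Y \<noteq> 0" using Z goodz unfolding dd_def D by auto
    have cong: "two_term_sum Y c0 c1 a b d = two_term_sum Y c0 c1 a' b' d"
      if "\<And>i. i \<in> Y \<Longrightarrow> a i = a' i" "\<And>i. i \<in> Y \<Longrightarrow> b i = b' i"
      for c0 c1 and a b a' b' d :: "'b \<Rightarrow> 'a"
    proof -
      have "prod a S = prod a' S" "prod b (Y - S) = prod b' (Y - S)" if "S \<in> Pow Y" for S
        using that \<open>\<And>i. i \<in> Y \<Longrightarrow> a i = a' i\<close> \<open>\<And>i. i \<in> Y \<Longrightarrow> b i = b' i\<close> by (auto intro!: prod.cong)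
      then show ?thesis unfolding two_term_sum_def by simp
    qed
    have "prod dd Y * subset_sum f Z h = poly (L f A B) (y z)"
      unfolding Z(1) subset_sum_insert[OF Z(3,2)] evalL unfolding dd_def
      by (rule cong) (use Ax Bx goodz ynz z in \<open>auto simp: f_def\<close>)
    moreover have "prod dd Y * subset_sum g Z h = poly (L g B A) (y z)"
      unfolding Z(1) subset_sum_insert[OF Z(3,2)] evalL unfolding dd_def
      by (rule cong) (use Ax Bx goodz ynz z in \<open>auto simp: g_def\<close>)
    ultimately have "subset_sum f Z h = subset_sum g Z h" using eq ddnz by (metis mult_left_cancel)
    then show ?thesis unfolding f_def g_def F_def .
  qed
qed

section \<open>The q-adic topology on the field of rational functions\<close>

definition q_integral :: "ratfun set" where
  "q_integral = {to_fract p / to_fract r |p r. coeff r 0 \<noteq> 0}"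

lemma q_adic_limit_alt:
  "q_adic_limit x l \<longleftrightarrow> (\<forall>k. \<forall>\<^sub>F n in sequentially. \<exists>u\<in>q_integral. x n - l = q_var ^ k * u)"
proof -
  have "(\<exists>p r. coeff r 0 \<noteq> 0 \<and> y = q_var ^ k * (to_fract p / to_fract r)) \<longleftrightarrow>
      (\<exists>u\<in>q_integral. y = q_var ^ k * u)" for y k
    unfolding q_integral_def by blast
  then show ?thesis unfolding q_adic_limit_def by simp
qed

lemma coeff_0_mult_nonzero: "coeff p 0 \<noteq> 0 \<Longrightarrow> coeff r 0 \<noteq> 0 \<Longrightarrow> coeff (p * r :: 'a::idom poly) 0 \<noteq> 0"
  by (simp add: coeff_mult_0)

lemma coeff_0_nonzero_imp: "coeff p 0 \<noteq> 0 \<Longrightarrow> p \<noteq> 0"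
  by auto

lemma q_integral_add: "x \<in> q_integral \<Longrightarrow> y \<in> q_integral \<Longrightarrow> x + y \<in> q_integral"
proof -
  assume "x \<in> q_integral" "y \<in> q_integral"
  then obtain p r p' r' where *: "x = to_fract p / to_fract r" "coeff r 0 \<noteq> 0"
    "y = to_fract p' / to_fract r'" "coeff r' 0 \<noteq> 0" unfolding q_integral_def by auto
  then have nz: "to_fract r \<noteq> 0" "to_fract r' \<noteq> 0" by auto
  have "x + y = to_fract (p * r' + p' * r) / to_fract (r * r')"
    using nz * by (simp add: add_frac_eq)
  then show ?thesis using coeff_0_mult_nonzero[OF *(2,4)] unfolding q_integral_def by blast
qed

lemma q_integral_mult: "x \<in> q_integral \<Longrightarrow> y \<in> q_integral \<Longrightarrow> x * y \<in> q_integral"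
proof -
  assume "x \<in> q_integral" "y \<in> q_integral"
  then obtain p r p' r' where *: "x = to_fract p / to_fract r" "coeff r 0 \<noteq> 0"
    "y = to_fract p' / to_fract r'" "coeff r' 0 \<noteq> 0" unfolding q_integral_def by auto
  have "x * y = to_fract (p * p') / to_fract (r * r')" using * by simp
  then show ?thesis using coeff_0_mult_nonzero[OF *(2,4)] unfolding q_integral_def by blast
qed

lemma q_integral_to_fract: "to_fract p \<in> q_integral"
  unfolding q_integral_def by (rule CollectI, rule exI[of _ p], rule exI[of _ 1]) simp

lemma q_integral_0: "0 \<in> q_integral" and q_integral_1: "1 \<in> q_integral"
  and q_integral_q: "q_var \<in> q_integral"
  using q_integral_to_fract[of 0] q_integral_to_fract[of 1] q_integral_to_fract
  unfolding q_var_def by auto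

lemma q_integral_uminus: "x \<in> q_integral \<Longrightarrow> - x \<in> q_integral"
  using q_integral_mult[of "- 1" x] q_integral_to_fract[of "- 1"] by simp

lemma q_integral_diff: "x \<in> q_integral \<Longrightarrow> y \<in> q_integral \<Longrightarrow> x - y \<in> q_integral"
  using q_integral_add[of x "- y"] q_integral_uminus[of y] by simp

lemma q_integral_power: "x \<in> q_integral \<Longrightarrow> x ^ n \<in> q_integral"
  by (induction n) (auto simp: q_integral_1 q_integral_mult)

lemma q_var_nonzero: "q_var \<noteq> 0" and t_var_nonzero: "t_var \<noteq> 0"
  unfolding q_var_def t_var_def by auto

text \<open>Over a denominator \<open>r\<close> of \<open>u\<close>, the numerator of
  \<open>1 + q_var * u\<close> has the same constant term in \<open>q\<close> as \<open>r\<close>.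
  So elements congruent to 1 modulo \<open>q\<close> are units of the valuation ring.\<close>

lemma q_integral_inverse_one_plus:
  assumes "u \<in> q_integral"
  shows "1 + q_var * u \<noteq> 0" "1 / (1 + q_var * u) \<in> q_integral"
proof -
  obtain p r where *: "u = to_fract p / to_fract r" "coeff r 0 \<noteq> 0"
    using assms unfolding q_integral_def by auto
  have nz: "to_fract r \<noteq> 0" using * by auto
  have e: "1 + q_var * u = to_fract (r + [:0, 1:] * p) / to_fract r"
  proof -
    have "1 + q_var * u = (to_fract r + q_var * to_fract p) / to_fract r"
      unfolding *(1) using nz by (simp add: field_simps)
    then show ?thesis unfolding to_fract_add to_fract_mult q_var_def .
  qed
  have c: "coeff (r + [:0, 1:] * p) 0 \<noteq> 0" using * by (simp add: coeff_mult_0)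
  then have "to_fract (r + [:0, 1:] * p) \<noteq> 0" by (metis coeff_0_nonzero_imp to_fract_eq_0_iff)
  then show "1 + q_var * u \<noteq> 0" using nz unfolding e by simp
  have "1 / (1 + q_var * u) = to_fract r / to_fract (r + [:0, 1:] * p)"
    unfolding e by simp
  then show "1 / (1 + q_var * u) \<in> q_integral" using c unfolding q_integral_def by blast
qed

lemma poly_split_q_power:
  fixes p :: "'a::idom poly"
  assumes "p \<noteq> 0"
  obtains d r where "p = [:0, 1:] ^ d * r" "coeff r 0 \<noteq> 0"
proof -
  obtain r where "p = [:0, 1:] ^ order 0 p * r" "\<not> [:0, 1:] dvd r"
    using order_decomp[OF assms, of 0] by auto
  moreover have "coeff r 0 \<noteq> 0" using calculation(2) by (simp add: dvd_iff_poly_eq_0[of 0 r] poly_0_coeff_0)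
  ultimately show thesis using that by blast
qed

lemma to_fract_power: "to_fract (x ^ n) = to_fract x ^ n"
  by (induction n) auto

text \<open>Poles at \<open>q = 0\<close> have finite order. This makes multiplication by a fixed
  element continuous and limits unique.\<close>

lemma ratfun_bounded: obtains d where "q_var ^ d * x \<in> q_integral"
proof -
  obtain a b where x: "x = to_fract a / to_fract b" "b \<noteq> 0"
    by (cases x) (auto simp: Fract_conv_to_fract)
  obtain d r where b: "b = [:0, 1:] ^ d * r" "coeff r 0 \<noteq> 0" using poly_split_q_power[OF x(2)] .
  have "to_fract b = q_var ^ d * to_fract r" unfolding b q_var_def by (simp add: to_fract_power)
  then have "q_var ^ d * x = to_fract a / to_fract r" using x q_var_nonzero by simp
  then show thesis using that b unfolding q_integral_def by blast
qed

lemma q_adic_limit_unique: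
  assumes "q_adic_limit x l" "q_adic_limit x l'"
  shows "l = l'"
proof (rule ccontr)
  assume ne: "l \<noteq> l'"
  obtain d where d: "q_var ^ d * (1 / (l - l')) \<in> q_integral" using ratfun_bounded .
  have "\<forall>\<^sub>F n in sequentially. (\<exists>u\<in>q_integral. x n - l = q_var ^ Suc d * u) \<and>
      (\<exists>u\<in>q_integral. x n - l' = q_var ^ Suc d * u)"
    using assms unfolding q_adic_limit_alt by (intro eventually_conj) blast+
  then obtain n u u' where u: "u \<in> q_integral" "u' \<in> q_integral"
    "x n - l = q_var ^ Suc d * u" "x n - l' = q_var ^ Suc d * u'"
    using eventually_happens sequentially_bot by blast
  then have "l - l' = q_var ^ Suc d * (u' - u)" by (simp add: algebra_simps)
  \<comment> \<open>Two different limits would make 1 a multiple of \<open>q\<close> inside the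
    valuation ring.\<close>
  then have "1 = q_var * ((q_var ^ d * (1 / (l - l'))) * (u' - u))"
    using ne by (simp add: field_simps)
  moreover define w where "w = - ((q_var ^ d * (1 / (l - l'))) * (u' - u))"
  ultimately have "1 + q_var * w = 0" by (simp add: algebra_simps)
  moreover have "w \<in> q_integral" unfolding w_def using u d
    by (intro q_integral_uminus q_integral_mult[OF d] q_integral_diff)
  ultimately show False using q_integral_inverse_one_plus(1) by blast
qed

lemma q_adic_limit_eventually_eq:
  assumes "q_adic_limit x l" "\<forall>\<^sub>F n in sequentially. x n = y n"
  shows "q_adic_limit y l"
  unfolding q_adic_limit_alt
proof
  fix k
  show "\<forall>\<^sub>F n in sequentially. \<exists>u\<in>q_integral. y n - l = q_var ^ k * u"
    using assms(2) spec[OF assms(1)[unfolded q_adic_limit_alt], of k]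
    by eventually_elim auto
qed

lemma q_adic_limit_const: "q_adic_limit (\<lambda>_. c) c"
  unfolding q_adic_limit_alt using q_integral_0 by force

lemma q_adic_limit_add:
  assumes "q_adic_limit x a" "q_adic_limit y b"
  shows "q_adic_limit (\<lambda>n. x n + y n) (a + b)"
  unfolding q_adic_limit_alt
proof
  fix k
  show "\<forall>\<^sub>F n in sequentially. \<exists>u\<in>q_integral. x n + y n - (a + b) = q_var ^ k * u"
    using spec[OF assms(1)[unfolded q_adic_limit_alt], of k]
      spec[OF assms(2)[unfolded q_adic_limit_alt], of k]
  proof eventually_elim
    case (elim n)
    then obtain u v where "u \<in> q_integral" "v \<in> q_integral" "x n - a = q_var ^ k * u" "y n - b = q_var ^ k * v"
      by auto
    then have "u + v \<in> q_integral" "x n + y n - (a + b) = q_var ^ k * (u + v)"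
      by (auto simp: algebra_simps intro: q_integral_add)
    then show ?case by blast
  qed
qed

lemma q_adic_limit_cmult:
  assumes "q_adic_limit x a"
  shows "q_adic_limit (\<lambda>n. c * x n) (c * a)"
  unfolding q_adic_limit_alt
proof
  fix k
  obtain d where d: "q_var ^ d * c \<in> q_integral" using ratfun_bounded .
  show "\<forall>\<^sub>F n in sequentially. \<exists>u\<in>q_integral. c * x n - c * a = q_var ^ k * u"
    using spec[OF assms(1)[unfolded q_adic_limit_alt], of "k + d"]
  proof eventually_elim
    case (elim n)
    then obtain u where u: "u \<in> q_integral" "x n - a = q_var ^ (k + d) * u" by auto
    have "c * x n - c * a = c * (x n - a)" by (simp add: algebra_simps)
    also have "\<dots> = q_var ^ k * ((q_var ^ d * c) * u)" unfolding u by (simp add: power_add)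
    finally show ?case using q_integral_mult[OF d u(1)] by blast
  qed
qed

lemma q_adic_limit_mult:
  assumes "q_adic_limit x a" "q_adic_limit y b"
  shows "q_adic_limit (\<lambda>n. x n * y n) (a * b)"
proof -
  \<comment> \<open>The product \<open>x y\<close> equals
    \<open>(x - a) (y - b) + b x + a y - a b\<close>, and the terms after the first are covered by
    scalar multiples and constants.\<close>
  have "q_adic_limit (\<lambda>n. (x n - a) * (y n - b)) 0"
    unfolding q_adic_limit_alt
  proof
    fix k
    show "\<forall>\<^sub>F n in sequentially. \<exists>u\<in>q_integral. (x n - a) * (y n - b) - 0 = q_var ^ k * u"
      using spec[OF assms(1)[unfolded q_adic_limit_alt], of k]
        spec[OF assms(2)[unfolded q_adic_limit_alt], of 0]
    proof eventually_elim
      case (elim n)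
      then obtain u v where "u \<in> q_integral" "v \<in> q_integral" "x n - a = q_var ^ k * u" "y n - b = v"
        by auto
      then have "u * v \<in> q_integral" "(x n - a) * (y n - b) - 0 = q_var ^ k * (u * v)"
        by (auto intro: q_integral_mult)
      then show ?case by blast
    qed
  qed
  from q_adic_limit_add[OF q_adic_limit_add[OF this q_adic_limit_cmult[OF assms(1), of b]]
      q_adic_limit_add[OF q_adic_limit_cmult[OF assms(2), of a] q_adic_limit_const[of "- (a * b)"]]]
  show ?thesis by (simp add: algebra_simps)
qed

lemma q_adic_limit_inverse:
  assumes "q_adic_limit x a" "a \<noteq> 0"
  shows "q_adic_limit (\<lambda>n. 1 / x n) (1 / a)"
proof -
  \<comment> \<open>Dividing by \<open>a\<close> moves the limit to 1, where inverses stay in the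
    valuation ring.\<close>
  have l: "q_adic_limit (\<lambda>n. 1 / a * x n) 1"
    using q_adic_limit_cmult[OF assms(1), of "1 / a"] assms(2) by simp
  have "q_adic_limit (\<lambda>n. 1 / (1 / a * x n)) 1"
    unfolding q_adic_limit_alt
  proof
    fix k
    show "\<forall>\<^sub>F n in sequentially. \<exists>u\<in>q_integral. 1 / (1 / a * x n) - 1 = q_var ^ k * u"
      using spec[OF l[unfolded q_adic_limit_alt], of "Suc k"]
    proof eventually_elim
      case (elim n)
      then obtain u where u: "u \<in> q_integral" "1 / a * x n - 1 = q_var ^ Suc k * u" by auto
      have v: "q_var ^ k * u \<in> q_integral" using u q_integral_q by (intro q_integral_mult q_integral_power)
      have e: "1 / a * x n = 1 + q_var * (q_var ^ k * u)" using u(2) by (simp add: algebra_simps)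
      define w where "w = 1 / (1 + q_var * (q_var ^ k * u))"
      have w: "w \<in> q_integral" "w * (1 + q_var * (q_var ^ k * u)) = 1"
        using q_integral_inverse_one_plus[OF v] unfolding w_def by auto
      have "1 / (1 / a * x n) - 1 = w - 1" unfolding e w_def ..
      also have "\<dots> = - (w * (q_var * (q_var ^ k * u)))" using w(2) by (simp add: algebra_simps)
      also have "\<dots> = q_var ^ k * (- (w * q_var * u))" by (simp add: algebra_simps)
      finally have "1 / (1 / a * x n) - 1 = q_var ^ k * (- (w * q_var * u))" .
      moreover have "- (w * q_var * u) \<in> q_integral"
        using w(1) u(1) q_integral_q by (intro q_integral_uminus q_integral_mult)
      ultimately show ?case by blast
    qed
  qed
  from q_adic_limit_cmult[OF this, of "1 / a"] show ?thesis
    using assms(2) by (simp add: field_simps)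
qed

lemma q_adic_limit_divide:
  assumes "q_adic_limit x a" "q_adic_limit y b" "b \<noteq> 0"
  shows "q_adic_limit (\<lambda>n. x n / y n) (a / b)"
  using q_adic_limit_mult[OF assms(1) q_adic_limit_inverse[OF assms(2,3)]] by simp

lemma q_adic_limit_diff:
  assumes "q_adic_limit x a" "q_adic_limit y b"
  shows "q_adic_limit (\<lambda>n. x n - y n) (a - b)"
  using q_adic_limit_add[OF assms(1) q_adic_limit_cmult[OF assms(2), of "- 1"]] by simp

lemma q_adic_limit_sum:
  assumes "\<And>i. i \<in> A \<Longrightarrow> q_adic_limit (x i) (l i)"
  shows "q_adic_limit (\<lambda>n. \<Sum>i\<in>A. x i n) (\<Sum>i\<in>A. l i)"
  using assms by (induction A rule: infinite_finite_induct)
    (auto intro: q_adic_limit_const q_adic_limit_add)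

lemma q_adic_limit_prod:
  assumes "\<And>i. i \<in> A \<Longrightarrow> q_adic_limit (x i) (l i)"
  shows "q_adic_limit (\<lambda>n. \<Prod>i\<in>A. x i n) (\<Prod>i\<in>A. l i)"
  using assms by (induction A rule: infinite_finite_induct)
    (auto intro: q_adic_limit_const q_adic_limit_mult)

lemma q_adic_limit_q_power: "q_adic_limit (\<lambda>n. q_var ^ n) 0"
  unfolding q_adic_limit_alt
proof
  fix k
  show "\<forall>\<^sub>F n in sequentially. \<exists>u\<in>q_integral. q_var ^ n - 0 = q_var ^ k * u"
    using eventually_ge_at_top[of k]
  proof eventually_elim
    case (elim n)
    then have "q_var ^ n - 0 = q_var ^ k * q_var ^ (n - k)" by (simp flip: power_add)
    then show ?case using q_integral_power[OF q_integral_q] by blast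
  qed
qed

lemma q_adic_limit_shift:
  assumes "q_adic_limit x a"
  shows "q_adic_limit (\<lambda>n. x (n - s)) a"
  unfolding q_adic_limit_alt
proof
  fix k
  have "filterlim (\<lambda>n. n - s) sequentially sequentially" by (rule filterlim_minus_const_nat_at_top)
  then show "\<forall>\<^sub>F n in sequentially. \<exists>u\<in>q_integral. x (n - s) - a = q_var ^ k * u"
    using spec[OF assms(1)[unfolded q_adic_limit_alt], of k] unfolding filterlim_iff by blast
qed

section \<open>Independence of the monomials in q and t\<close>

lemma q_t_monomial: "q_var ^ a * t_var ^ b = to_fract (monom (monom 1 b) a)"
proof -
  have "t_var ^ b = to_fract [:monom 1 b:]" unfolding t_var_def
    by (induction b) (auto simp flip: to_fract_mult one_pCons simp: monom_Suc)
  moreover have "q_var ^ a = to_fract (monom 1 a)" unfolding q_var_def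
    by (induction a) (auto simp flip: to_fract_mult simp: monom_Suc)
  ultimately show ?thesis by (simp flip: to_fract_mult add: smult_monom)
qed

lemma q_t_independent:
  assumes "q_var ^ a * t_var ^ b = q_var ^ c * t_var ^ d"
  shows "a = c \<and> b = d"
proof -
  have e: "monom (monom (1::rat) b) a = monom (monom 1 d) c"
    using assms unfolding q_t_monomial by simp
  have "degree (monom (monom (1::rat) b) a) = a" "degree (monom (monom (1::rat) d) c) = c"
    by (simp_all add: degree_monom_eq monom_eq_0_iff)
  then have "a = c" using e by simp
  then have "monom (1::rat) b = monom 1 d" using e by (simp add: monom_eq_iff)
  then show ?thesis using \<open>a = c\<close> by (metis degree_monom_eq one_neq_zero)
qed

lemma one_minus_monomial_nonzero: "a > 0 \<or> b > 0 \<Longrightarrow> 1 - q_var ^ a * t_var ^ b \<noteq> 0"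
  using q_t_independent[of a b 0 0] by auto

lemma one_minus_q_power_nonzero: "n > 0 \<Longrightarrow> 1 - q_var ^ n \<noteq> 0"
  using one_minus_monomial_nonzero[of n 0] by simp

section \<open>Euler's expansion of the Pochhammer symbol and the q-binomial theorem\<close>

primrec euler_coeff :: "nat \<Rightarrow> ratfun" where
  "euler_coeff 0 = 1"
| "euler_coeff (Suc k) = - (q_var ^ k * euler_coeff k) / (1 - q_var ^ Suc k)"

text \<open>The coefficient of \<open>x ^ k\<close> in the product of \<open>1 - x * q ^ n\<close>
  over \<open>n < N\<close>. Replacing \<open>q ^ N\<close> by its limit 0 turns the recursion into
  that of \<open>euler_coeff\<close>.\<close>

primrec finite_euler_coeff :: "nat \<Rightarrow> nat \<Rightarrow> ratfun" where
  "finite_euler_coeff N 0 = 1"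
| "finite_euler_coeff N (Suc k) = (q_var ^ N - q_var ^ k) * finite_euler_coeff N k / (1 - q_var ^ Suc k)"

text \<open>A q-Pascal rule: it expresses multiplication by the next factor
  \<open>1 - x * q ^ N\<close>.\<close>

lemma finite_euler_coeff_Suc:
  "finite_euler_coeff (Suc N) (Suc k) = finite_euler_coeff N (Suc k) - q_var ^ N * finite_euler_coeff N k"
proof (induction k)
  case 0
  show ?case using one_minus_q_power_nonzero[of 1] by (simp add: field_simps)
next
  case (Suc k)
  define A where "A = finite_euler_coeff N k"
  have nz: "1 - q_var ^ Suc k \<noteq> 0" "1 - q_var ^ Suc (Suc k) \<noteq> 0"
    using one_minus_q_power_nonzero[of "Suc k"] one_minus_q_power_nonzero[of "Suc (Suc k)"] by auto
  have 1: "finite_euler_coeff N (Suc k) * (1 - q_var ^ Suc k) = (q_var ^ N - q_var ^ k) * A"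
    using nz by (simp add: A_def)
  have "(q_var ^ Suc N - q_var ^ Suc k) * (finite_euler_coeff N (Suc k) - q_var ^ N * A) =
      (q_var ^ N - q_var ^ Suc k) * finite_euler_coeff N (Suc k) -
      q_var ^ N * finite_euler_coeff N (Suc k) * (1 - q_var ^ Suc (Suc k))"
  proof -
    define e where "e = finite_euler_coeff N (Suc k)"
    have "(q_var ^ Suc N - q_var ^ Suc k) * (e - q_var ^ N * A)
       - ((q_var ^ N - q_var ^ Suc k) * e - q_var ^ N * e * (1 - q_var ^ Suc (Suc k)))
      = q_var ^ Suc N * (e * (1 - q_var ^ Suc k) - (q_var ^ N - q_var ^ k) * A)"
      by (simp add: algebra_simps)
    also have "\<dots> = 0" using 1 unfolding e_def by simp
    finally show ?thesis unfolding e_def by simp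
  qed
  then show ?case using nz unfolding finite_euler_coeff.simps(2)[of _ "Suc k"] Suc.IH
    by (simp add: A_def diff_divide_distrib del: power_Suc finite_euler_coeff.simps)
qed

lemma finite_euler_coeff_limit: "q_adic_limit (\<lambda>N. finite_euler_coeff N k) (euler_coeff k)"
proof (induction k)
  case (Suc k)
  have "q_adic_limit (\<lambda>N. (q_var ^ N - q_var ^ k) * finite_euler_coeff N k / (1 - q_var ^ Suc k))
      ((0 - q_var ^ k) * euler_coeff k / (1 - q_var ^ Suc k))"
    using one_minus_q_power_nonzero[of "Suc k"]
    by (intro q_adic_limit_divide q_adic_limit_mult q_adic_limit_diff q_adic_limit_q_power Suc q_adic_limit_const) auto
  then show ?case by simp
qed (simp add: q_adic_limit_const)

text \<open>Substitutes \<open>fps_X ^ m\<close> into the power series with coefficients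
  \<open>f\<close>; meant for \<open>m > 0\<close>.\<close>

definition spread :: "(nat \<Rightarrow> 'a::comm_ring_1) \<Rightarrow> nat \<Rightarrow> 'a fps" where
  "spread f m = Abs_fps (\<lambda>n. if m dvd n then f (n div m) else 0)"

lemma finite_euler_coeff_zero: "k > N \<Longrightarrow> finite_euler_coeff N k = 0"
proof (induction k)
  case (Suc k)
  then show ?case by (cases "k = N") auto
qed simp

lemma finite_pochhammer:
  assumes "m > 0"
  shows "(\<Prod>n<N. 1 - (fps_const c * fps_X ^ m) * fps_const (q_var ^ n)) =
    spread (\<lambda>k. c ^ k * finite_euler_coeff N k) m"
proof (induction N)
  case 0
  show ?case unfolding spread_def
    by (rule fps_ext) (use assms in \<open>auto simp: finite_euler_coeff_zero\<close>)
next
  case (Suc N)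
  have "spread (\<lambda>k. c ^ k * finite_euler_coeff N k) m * (1 - (fps_const c * fps_X ^ m) * fps_const (q_var ^ N))
    = spread (\<lambda>k. c ^ k * finite_euler_coeff N k) m -
      fps_const (c * q_var ^ N) * (fps_X ^ m * spread (\<lambda>k. c ^ k * finite_euler_coeff N k) m)"
    by (simp add: algebra_simps flip: fps_const_mult)
  also have "\<dots> = spread (\<lambda>k. c ^ k * finite_euler_coeff (Suc N) k) m"
  proof (rule fps_ext)
    fix n
    show "fps_nth (spread (\<lambda>k. c ^ k * finite_euler_coeff N k) m -
      fps_const (c * q_var ^ N) * (fps_X ^ m * spread (\<lambda>k. c ^ k * finite_euler_coeff N k) m)) n =
      fps_nth (spread (\<lambda>k. c ^ k * finite_euler_coeff (Suc N) k) m) n"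
    proof (cases "m dvd n")
      case False
      then show ?thesis unfolding spread_def
        by (auto simp: fps_X_power_mult_nth dvd_minus_self)
    next
      case True
      then obtain k where k: "n = m * k" by auto
      show ?thesis
      proof (cases k)
        case 0
        then show ?thesis using k assms by (simp add: spread_def fps_X_power_mult_nth)
      next
        case (Suc k')
        then have "n \<ge> m" "n - m = m * k'" using k by auto
        then show ?thesis using k Suc assms unfolding spread_def
          by (simp add: fps_X_power_mult_nth finite_euler_coeff_Suc algebra_simps del: finite_euler_coeff.simps)
      qed
    qed
  qed
  finally show ?case by (simp add: Suc)
qed

text \<open>Each coefficient of the partial products is zero or a multiple of one finite Euler
  coefficient, so it converges; uniqueness of \<open>q\<close>-adic limits then settles the definite
  description.\<close>

lemma q_pochhammer_inf_monomial:
  assumes "m > 0"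
  shows "q_pochhammer_inf (fps_const c * fps_X ^ m) = spread (\<lambda>k. c ^ k * euler_coeff k) m"
proof -
  have lim: "q_adic_limit (\<lambda>N. fps_nth (\<Prod>n<N. 1 - (fps_const c * fps_X ^ m) * fps_const (q_var ^ n)) i)
      (fps_nth (spread (\<lambda>k. c ^ k * euler_coeff k) m) i)" for i
    unfolding finite_pochhammer[OF assms] spread_def
    by (auto intro: q_adic_limit_cmult finite_euler_coeff_limit q_adic_limit_const)
  show ?thesis unfolding q_pochhammer_inf_def
  proof (rule the_equality)
    show "\<forall>i. q_adic_limit (\<lambda>N. fps_nth (\<Prod>n<N. 1 - (fps_const c * fps_X ^ m) * fps_const (q_var ^ n)) i)
      (fps_nth (spread (\<lambda>k. c ^ k * euler_coeff k) m) i)" using lim by blast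
    fix F assume "\<forall>i. q_adic_limit (\<lambda>N. fps_nth (\<Prod>n<N. 1 - (fps_const c * fps_X ^ m) * fps_const (q_var ^ n)) i)
      (fps_nth F i)"
    then show "F = spread (\<lambda>k. c ^ k * euler_coeff k) m"
      using lim q_adic_limit_unique by (intro fps_ext) blast
  qed
qed

lemma spread_mult:
  assumes "m > 0"
  shows "spread f m * spread g m = spread (\<lambda>k. \<Sum>i\<le>k. f i * g (k - i)) m"
proof (rule fps_ext)
  fix n
  have "fps_nth (spread f m * spread g m) n = (\<Sum>i\<in>{0..n}. fps_nth (spread f m) i * fps_nth (spread g m) (n - i))"
    by (simp add: fps_mult_nth)
  also have "\<dots> = (\<Sum>i\<in>{0..n}. if m dvd i \<and> m dvd n then f (i div m) * g ((n - i) div m) else 0)"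
  proof (rule sum.cong[OF refl])
    fix i assume "i \<in> {0..n}"
    then have "m dvd i \<Longrightarrow> m dvd n - i \<longleftrightarrow> m dvd n" using dvd_add_left_iff[of m i "n - i"] by simp
    then show "fps_nth (spread f m) i * fps_nth (spread g m) (n - i) =
        (if m dvd i \<and> m dvd n then f (i div m) * g ((n - i) div m) else 0)"
      by (simp add: spread_def)
  qed
  also have "\<dots> = fps_nth (spread (\<lambda>k. \<Sum>i\<le>k. f i * g (k - i)) m) n"
  proof (cases "m dvd n")
    case True
    then obtain k where k: "n = m * k" by auto
    have "(\<Sum>i\<in>{0..n}. if m dvd i \<and> m dvd n then f (i div m) * g ((n - i) div m) else 0) =
        (\<Sum>i\<in>(\<lambda>i. m * i) ` {..k}. f (i div m) * g ((n - i) div m))"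
    proof (rule sum.mono_neutral_cong_right)
      show "\<forall>i\<in>{0..n} - (\<lambda>i. m * i) ` {..k}. (if m dvd i \<and> m dvd n then f (i div m) * g ((n - i) div m) else 0) = 0"
      proof
        fix i assume i: "i \<in> {0..n} - (\<lambda>i. m * i) ` {..k}"
        have "\<not> m dvd i"
        proof
          assume "m dvd i"
          then obtain j where "i = m * j" by auto
          then show False using i k assms by auto
        qed
        then show "(if m dvd i \<and> m dvd n then f (i div m) * g ((n - i) div m) else 0) = 0" by simp
      qed
    qed (use k True assms in auto)
    also have "\<dots> = (\<Sum>i\<le>k. f i * g (k - i))"
    proof (subst sum.reindex)
      show "inj_on (\<lambda>i. m * i) {..k}" using assms by (auto simp: inj_on_def)
      have "(n - m * i) div m = k - i" for i unfolding k using assms by (simp flip: diff_mult_distrib2)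
      then show "sum ((\<lambda>i. f (i div m) * g ((n - i) div m)) \<circ> (\<lambda>i. m * i)) {..k} = (\<Sum>i\<le>k. f i * g (k - i))"
        using assms by simp
    qed
    finally have "(\<Sum>i\<in>{0..n}. if m dvd i \<and> m dvd n then f (i div m) * g ((n - i) div m) else 0) = (\<Sum>i\<le>k. f i * g (k - i))" .
    then show ?thesis using assms k by (simp add: spread_def)
  qed (simp add: spread_def)
  finally show "fps_nth (spread f m * spread g m) n = \<dots>" .
qed

text \<open>The quotient (t;q)_k / (q;q)_k, which by the q-binomial theorem is the coefficient of
  x^k in the ratio of the Pochhammer symbols of tx and x.\<close>

primrec ratio_coeff :: "nat \<Rightarrow> ratfun" where
  "ratio_coeff 0 = 1"
| "ratio_coeff (Suc k) = (1 - t_var * q_var ^ k) * ratio_coeff k / (1 - q_var ^ Suc k)"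

text \<open>
  With $e(x)=(x;q)_\infty$ and $g$ the generating function of \<open>ratio_coeff\<close>, the equations
  $e(x)=(1-x)e(qx)$ and $(1-x)g(x)=(1-tx)g(qx)$ show that $g(x)e(x)$ and $e(tx)$ satisfy the same
  first order $q$-difference equation.
\<close>
lemma ratio_coeff_convolution:
  "(\<Sum>i\<le>k. ratio_coeff i * euler_coeff (k - i)) = t_var ^ k * euler_coeff k"
proof -
  define G where "G = Abs_fps ratio_coeff"
  define E where "E = Abs_fps euler_coeff"
  define Gq where "Gq = Abs_fps (\<lambda>k. q_var ^ k * ratio_coeff k)"
  define Eq where "Eq = Abs_fps (\<lambda>k. q_var ^ k * euler_coeff k)"
  have G: "(1 - fps_X) * G = (1 - fps_const t_var * fps_X) * Gq"
  proof (rule fps_ext)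
    fix n
    show "fps_nth ((1 - fps_X) * G) n = fps_nth ((1 - fps_const t_var * fps_X) * Gq) n"
    proof (cases n)
      case (Suc k)
      have nz: "1 - q_var ^ Suc k \<noteq> 0" using one_minus_q_power_nonzero[of "Suc k"] by auto
      then have "ratio_coeff (Suc k) * (1 - q_var ^ Suc k) = (1 - t_var * q_var ^ k) * ratio_coeff k" by simp
      then show ?thesis unfolding G_def Gq_def Suc
        by (simp add: left_diff_distrib mult.assoc del: ratio_coeff.simps) (simp add: algebra_simps del: ratio_coeff.simps)
    qed (simp add: G_def Gq_def)
  qed
  have E: "E = (1 - fps_X) * Eq"
  proof (rule fps_ext)
    fix n
    show "fps_nth E n = fps_nth ((1 - fps_X) * Eq) n"
    proof (cases n)
      case (Suc k)
      have nz: "1 - q_var ^ Suc k \<noteq> 0" using one_minus_q_power_nonzero[of "Suc k"] by auto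
      then have "euler_coeff (Suc k) * (1 - q_var ^ Suc k) = - (q_var ^ k * euler_coeff k)" by simp
      then show ?thesis unfolding E_def Eq_def Suc
        by (simp add: left_diff_distrib del: euler_coeff.simps) (simp add: algebra_simps del: euler_coeff.simps)
    qed (simp add: E_def Eq_def)
  qed
  have GE: "G * E = (1 - fps_const t_var * fps_X) * (Gq * Eq)"
  proof -
    have "G * E = ((1 - fps_X) * G) * Eq" by (subst E) (simp only: mult_ac)
    then show ?thesis unfolding G by (simp only: mult.assoc)
  qed
  have c: "fps_nth (G * E) n = (\<Sum>i\<le>n. ratio_coeff i * euler_coeff (n - i))" for n
    by (simp add: fps_mult_nth G_def E_def atLeast0AtMost)
  \<comment> \<open>Both factors are evaluated at \<open>q x\<close>, hence so is their product;
    together with \<open>GE\<close> this determines each coefficient from the preceding one.\<close>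
  have cq: "fps_nth (Gq * Eq) n = q_var ^ n * fps_nth (G * E) n" for n
  proof -
    have "q_var ^ i * ratio_coeff i * (q_var ^ (n - i) * euler_coeff (n - i)) =
        q_var ^ n * (ratio_coeff i * euler_coeff (n - i))" if "i \<le> n" for i
    proof -
      have "q_var ^ n = q_var ^ i * q_var ^ (n - i)" using that by (simp flip: power_add)
      then show ?thesis by (simp only: mult_ac)
    qed
    then have "(\<Sum>i\<le>n. q_var ^ i * ratio_coeff i * (q_var ^ (n - i) * euler_coeff (n - i))) =
        (\<Sum>i\<le>n. q_var ^ n * (ratio_coeff i * euler_coeff (n - i)))"
      by (intro sum.cong) auto
    then show ?thesis unfolding c
      by (simp add: fps_mult_nth Gq_def Eq_def atLeast0AtMost sum_distrib_left del: mult_cancel_left)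
  qed
  have "fps_nth (G * E) k = t_var ^ k * euler_coeff k"
  proof (induction k)
    case 0
    then show ?case by (simp add: G_def E_def)
  next
    case (Suc k)
    have nz: "1 - q_var ^ Suc k \<noteq> 0" using one_minus_q_power_nonzero[of "Suc k"] by auto
    have "fps_nth (G * E) (Suc k) = fps_nth (Gq * Eq) (Suc k) - t_var * fps_nth (Gq * Eq) k"
      unfolding GE by (simp add: left_diff_distrib mult.assoc)
    then have "fps_nth (G * E) (Suc k) * (1 - q_var ^ Suc k) = - (t_var * (q_var ^ k * (t_var ^ k * euler_coeff k)))"
      unfolding cq Suc by (simp add: algebra_simps)
    then show ?case using nz by (simp add: field_simps)
  qed
  then show ?thesis unfolding c .
qed

lemma q_pochhammer_inf_ratio:
  assumes "m > 0"
  shows "q_pochhammer_inf (fps_const t_var * fps_X ^ m) / q_pochhammer_inf (fps_X ^ m) = spread ratio_coeff m"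
proof -
  have e: "q_pochhammer_inf (fps_X ^ m) = spread euler_coeff m"
    using q_pochhammer_inf_monomial[OF assms, of 1] by simp
  have "fps_nth (spread euler_coeff m) 0 = 1" by (simp add: spread_def)
  then have nz: "spread euler_coeff m \<noteq> 0" by (metis fps_zero_nth zero_neq_one)
  have "q_pochhammer_inf (fps_const t_var * fps_X ^ m) = spread ratio_coeff m * spread euler_coeff m"
    unfolding q_pochhammer_inf_monomial[OF assms] spread_mult[OF assms] ratio_coeff_convolution ..
  then show ?thesis unfolding e using nz by simp
qed

section \<open>Partitions and their columns\<close>

lemma part_antimono:
  assumes "is_partition lam" "1 \<le> i" "i \<le> k"
  shows "part lam k \<le> part lam i"
proof (cases "k \<le> length lam \<and> i \<noteq> k")
  case True
  then have "i - 1 < k - 1" "k - 1 < length lam" using assms by auto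
  then have "lam ! (i - 1) \<ge> lam ! (k - 1)"
    using assms(1) sorted_wrt_nth_less[of "(\<ge>)" lam "i - 1" "k - 1"] unfolding is_partition_def by auto
  then show ?thesis using True assms by (simp add: part_def)
qed (auto simp: part_def)

text \<open>Column and row lengths are defined as cardinalities. The sets they count are downward
  closed, so comparing an index with the cardinality is the same as membership.\<close>

lemma down_closed_eq_interval:
  fixes A :: "nat set"
  assumes "finite A" "0 \<notin> A" "\<And>i k. k \<in> A \<Longrightarrow> 1 \<le> i \<Longrightarrow> i \<le> k \<Longrightarrow> i \<in> A"
  shows "A = {1..card A}"
proof (cases "A = {}")
  case False
  have m: "Max A \<in> A" using assms(1) False by simp
  have "A = {1..Max A}"
  proof
    show "A \<subseteq> {1..Max A}"
    proof
      fix x assume "x \<in> A"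
      then have "x \<noteq> 0" "x \<le> Max A" using assms(1,2) by (metis, simp)
      then show "x \<in> {1..Max A}" by auto
    qed
    show "{1..Max A} \<subseteq> A" using assms(3)[OF m] by auto
  qed
  then show ?thesis by (metis card_atLeastAtMost diff_Suc_1 add.commute plus_1_eq_Suc Suc_eq_plus1)
qed simp

text \<open>Both inequalities say that the box \<open>(i, j)\<close> lies in the diagram; this is
  the bridge from rows to columns.\<close>

lemma le_part_iff:
  assumes "is_partition lam" "1 \<le> i" "1 \<le> j"
  shows "j \<le> part lam i \<longleftrightarrow> i \<le> conj_part lam j"
proof -
  define A where "A = {i \<in> {1..length lam}. j \<le> part lam i}"
  have "A = {1..card A}"
  proof (rule down_closed_eq_interval)
    fix i k assume "k \<in> A" "1 \<le> i" "i \<le> k"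
    then show "i \<in> A" using part_antimono[OF assms(1), of i k] unfolding A_def by auto
  qed (auto simp: A_def)
  then have "i \<in> A \<longleftrightarrow> i \<in> {1..card A}" by (rule arg_cong)
  then have "i \<in> A \<longleftrightarrow> i \<le> conj_part lam j" using assms(2) unfolding conj_part_def A_def[symmetric] by simp
  moreover have "i \<in> A \<longleftrightarrow> j \<le> part lam i" using assms unfolding A_def part_def by auto
  ultimately show ?thesis by simp
qed

lemma conj_part_antimono:
  assumes "is_partition lam" "1 \<le> i" "i \<le> k"
  shows "conj_part lam k \<le> conj_part lam i"
proof (cases "conj_part lam k = 0")
  case False
  then have "k \<le> part lam (conj_part lam k)" using le_part_iff[OF assms(1), of "conj_part lam k" k] assms by simp
  then have "i \<le> part lam (conj_part lam k)" using assms by simp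
  then show ?thesis using le_part_iff[OF assms(1), of "conj_part lam k" i] assms False by simp
qed simp

lemma conj_part_eq_0:
  assumes "is_partition lam" "part lam 1 \<le> N" "N < k"
  shows "conj_part lam k = 0"
  using le_part_iff[OF assms(1), of 1 k] assms by (cases "conj_part lam k") auto

lemma part_le_of_conj_part_eq_0:
  assumes "is_partition lam" "conj_part lam (Suc N) = 0"
  shows "part lam 1 \<le> N"
  using le_part_iff[OF assms(1), of 1 "Suc N"] assms by auto

lemma nat_eqI_le:
  assumes "\<And>j. 1 \<le> j \<Longrightarrow> j \<le> a \<longleftrightarrow> j \<le> (b::nat)"
  shows "a = b"
proof (rule antisym)
  show "a \<le> b" using assms[of a] by (cases "a = 0") simp_all
  show "b \<le> a" using assms[of b] by (cases "b = 0") simp_all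
qed

lemma partition_eqI:
  assumes "is_partition lam" "is_partition mu" "\<And>j. j \<ge> 1 \<Longrightarrow> conj_part lam j = conj_part mu j"
  shows "lam = mu"
proof -
  have p: "part lam i = part mu i" if "i \<ge> 1" for i
  proof -
    have "j \<le> part lam i \<longleftrightarrow> j \<le> part mu i" if "j \<ge> 1" for j
      using le_part_iff[OF assms(1) \<open>i \<ge> 1\<close> that] le_part_iff[OF assms(2) \<open>i \<ge> 1\<close> that] assms(3)[OF that] by simp
    then show ?thesis by (rule nat_eqI_le)
  qed
  have len: "conj_part nu 1 = length nu" if "is_partition nu" for nu
  proof -
    have "1 \<le> part nu i" if "i \<in> {1..length nu}" for i
    proof -
      have "nu ! (i - 1) \<in> set nu" using that by (intro nth_mem) auto
      then have "nu ! (i - 1) \<noteq> 0" using \<open>is_partition nu\<close> unfolding is_partition_def by metis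
      then show ?thesis using that by (simp add: part_def)
    qed
    then have "{i \<in> {1..length nu}. 1 \<le> part nu i} = {1..length nu}" by auto
    then show ?thesis unfolding conj_part_def by simp
  qed
  have l: "length lam = length mu" using len[OF assms(1)] len[OF assms(2)] assms(3)[of 1] by simp
  show ?thesis
  proof (rule nth_equalityI[OF l])
    fix i assume "i < length lam"
    then show "lam ! i = mu ! i" using p[of "Suc i"] l by (simp add: part_def)
  qed
qed

text \<open>The prescribed column lengths \<open>m\<close> form a partition whose conjugate is the
  one sought. Its rows are listed only up to \<open>m 1\<close>, after which they are empty, so that
  no zero part occurs.\<close>

lemma partition_exists:
  assumes anti: "\<And>i k. 1 \<le> i \<Longrightarrow> i \<le> k \<Longrightarrow> m k \<le> m i" and zero: "\<And>k. k > N \<Longrightarrow> m k = 0"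
  obtains lam where "is_partition lam" "\<And>j. j \<ge> 1 \<Longrightarrow> conj_part lam j = m j"
proof -
  define r where "r = (\<lambda>i. card {j \<in> {1..N}. i \<le> m j})"
  have r: "j \<le> r i \<longleftrightarrow> i \<le> m j" if "i \<ge> 1" "j \<ge> 1" for i j
  proof -
    define A where "A = {j \<in> {1..N}. i \<le> m j}"
    have "A = {1..card A}"
    proof (rule down_closed_eq_interval)
      fix a b assume "b \<in> A" "1 \<le> a" "a \<le> b"
      then show "a \<in> A" using anti[of a b] unfolding A_def by auto
    qed (auto simp: A_def)
    then have "j \<in> A \<longleftrightarrow> j \<in> {1..card A}" by (rule arg_cong)
    then have "j \<in> A \<longleftrightarrow> j \<le> r i" using that unfolding r_def A_def[symmetric] by simp
    moreover have "j \<in> A \<longleftrightarrow> i \<le> m j" using that zero[of j] unfolding A_def by (cases "j \<le> N") auto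
    ultimately show ?thesis by simp
  qed
  define lam where "lam = map (\<lambda>i. r (Suc i)) [0..<m 1]"
  have part: "part lam i = r i" if "i \<ge> 1" for i
  proof (cases "i \<le> m 1")
    case True
    then show ?thesis using that by (cases i) (auto simp: part_def lam_def)
  next
    case False
    then have "\<not> 1 \<le> r i" using r[of i 1] that by simp
    then show ?thesis using False by (simp add: part_def lam_def)
  qed
  have lam: "is_partition lam"
    unfolding is_partition_def
  proof
    show "sorted_wrt (\<ge>) lam"
    proof (rule sorted_wrt_iff_nth_less[THEN iffD2], intro allI impI)
      fix i j assume ij: "i < j" "j < length lam"
      have "r (Suc j) \<le> r (Suc i)" unfolding r_def using ij by (intro card_mono) auto
      then show "lam ! j \<le> lam ! i" using ij by (simp add: lam_def)
    qed
    show "0 \<notin> set lam"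
    proof
      assume "0 \<in> set lam"
      then obtain i where "i < m 1" "r (Suc i) = 0" unfolding lam_def by auto
      then show False using r[of "Suc i" 1] by auto
    qed
  qed
  have "conj_part lam j = m j" if "j \<ge> 1" for j
  proof -
    have "i \<le> conj_part lam j \<longleftrightarrow> i \<le> m j" if "i \<ge> 1" for i
      using le_part_iff[OF lam that \<open>j \<ge> 1\<close>] part[OF that] r[OF that \<open>j \<ge> 1\<close>] by simp
    then show ?thesis by (rule nat_eqI_le)
  qed
  then show thesis using that lam by blast
qed

text \<open>Seen in columns, the interlacing chain decouples: each column gains no box or one box. A
  strip is thus encoded by a set of columns.\<close>

lemma horizontal_strip_iff:
  assumes "is_partition lam" "is_partition mu"
  shows "horizontal_strip lam mu \<longleftrightarrow>
    (\<forall>j\<ge>1. conj_part mu j \<le> conj_part lam j \<and> conj_part lam j \<le> Suc (conj_part mu j))" (is "_ \<longleftrightarrow> ?R")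
proof
  assume h: "horizontal_strip lam mu"
  show ?R
  proof (intro allI impI conjI)
    fix j :: nat assume j: "j \<ge> 1"
    show "conj_part mu j \<le> conj_part lam j"
    proof (cases "conj_part mu j = 0")
      case False
      then have "j \<le> part mu (conj_part mu j)" using le_part_iff[OF assms(2), of "conj_part mu j" j] j by simp
      also have "\<dots> \<le> part lam (conj_part mu j)" using h False unfolding horizontal_strip_def by simp
      finally show ?thesis using le_part_iff[OF assms(1), of "conj_part mu j" j] j False by simp
    qed simp
    show "conj_part lam j \<le> Suc (conj_part mu j)"
    proof (cases "conj_part lam j \<le> 1")
      case False
      then obtain c where c: "conj_part lam j = c + 1" "c \<ge> 1" by (cases "conj_part lam j") auto
      then have "j \<le> part lam (c + 1)" using le_part_iff[OF assms(1), of "c + 1" j] j by simp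
      also have "\<dots> \<le> part mu c" using h c unfolding horizontal_strip_def by blast
      finally show ?thesis using le_part_iff[OF assms(2), of c j] j c by simp
    qed simp
  qed
next
  assume R: ?R
  show "horizontal_strip lam mu"
    unfolding horizontal_strip_def
  proof (intro allI impI conjI)
    fix i :: nat assume i: "i \<ge> 1"
    show "part mu i \<le> part lam i"
    proof (cases "part mu i = 0")
      case False
      then have "i \<le> conj_part mu (part mu i)" using le_part_iff[OF assms(2), of i "part mu i"] i by simp
      also have "\<dots> \<le> conj_part lam (part mu i)" using R False by simp
      finally show ?thesis using le_part_iff[OF assms(1), of i "part mu i"] i False by simp
    qed simp
    show "part lam (i + 1) \<le> part mu i"
    proof (cases "part lam (i + 1) = 0")
      case False
      then have "i + 1 \<le> conj_part lam (part lam (i + 1))"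
        using le_part_iff[OF assms(1), of "i + 1" "part lam (i + 1)"] i by simp
      also have "\<dots> \<le> Suc (conj_part mu (part lam (i + 1)))" using R False by simp
      finally show ?thesis using le_part_iff[OF assms(2), of i "part lam (i + 1)"] i False by simp
    qed simp
  qed
qed

lemma sum_list_eq_sum_conj_part:
  assumes "is_partition lam" "part lam 1 \<le> N"
  shows "sum_list lam = (\<Sum>j\<in>{1..N}. conj_part lam j)"
proof -
  have le: "part lam i \<le> N" if "i \<ge> 1" for i using part_antimono[OF assms(1), of 1 i] that assms(2) by simp
  have c: "part lam i = (\<Sum>j\<in>{1..N}. if j \<le> part lam i then 1 else 0)" if "i \<ge> 1" for i
  proof -
    have "{1..N} \<inter> {j. j \<le> part lam i} = {1..part lam i}" using le[OF that] by auto
    then show ?thesis by (simp add: sum.If_cases)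
  qed
  have "sum_list lam = (\<Sum>i\<in>{0..<length lam}. part lam (Suc i))"
    by (simp add: sum_list_sum_nth part_def)
  also have "\<dots> = (\<Sum>i\<in>{1..length lam}. part lam i)"
    by (rule sum.reindex_bij_witness[of _ "\<lambda>i. i - 1" Suc]) auto
  also have "\<dots> = (\<Sum>i\<in>{1..length lam}. \<Sum>j\<in>{1..N}. if j \<le> part lam i then 1 else 0)"
    by (rule sum.cong[OF refl], rule c) simp
  also have "\<dots> = (\<Sum>j\<in>{1..N}. \<Sum>i\<in>{1..length lam}. if j \<le> part lam i then 1 else 0)"
    by (rule sum.swap)
  also have "\<dots> = (\<Sum>j\<in>{1..N}. conj_part lam j)"
    unfolding conj_part_def by (intro sum.cong refl) (simp add: sum.If_cases Int_def)
  finally show ?thesis .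
qed

lemma boxes_iff:
  assumes "is_partition lam"
  shows "(i, j) \<in> boxes lam \<longleftrightarrow> 1 \<le> j \<and> 1 \<le> i \<and> i \<le> conj_part lam j"
  using le_part_iff[OF assms, of i j] unfolding boxes_def by auto

section \<open>The Pieri coefficients column by column\<close>

definition raised :: "nat list \<Rightarrow> nat list \<Rightarrow> nat set" where
  "raised lam mu = {j. 1 \<le> j \<and> conj_part mu j < conj_part lam j}"

definition column_weight :: "'a::field \<Rightarrow> 'a \<Rightarrow> nat list \<Rightarrow> nat \<Rightarrow> 'a" where
  "column_weight q t lam j = (\<Prod>i\<in>{1..conj_part lam j}. b_weight q t lam (i, j))"

text \<open>\<open>b_weight\<close> is 1 outside the diagram, so two partitions can be multiplied
  over a common range of rows.\<close>

lemma prod_column: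
  assumes "is_partition lam" "1 \<le> j" "conj_part lam j \<le> n"
  shows "(\<Prod>i\<in>{1..n}. b_weight q t lam (i, j)) = column_weight q t lam j"
  unfolding column_weight_def
proof (rule prod.mono_neutral_right)
  show "\<forall>i\<in>{1..n} - {1..conj_part lam j}. b_weight q t lam (i, j) = 1"
    using boxes_iff[OF assms(1)] by (auto simp: b_weight_def)
qed (use assms in auto)

lemma set_eq_swapped_Sigma:
  assumes "\<And>i j. (i, j) \<in> A \<longleftrightarrow> j \<in> B \<and> i \<in> f j"
  shows "A = (\<lambda>(j, i). (i, j)) ` (SIGMA j:B. f j)"
proof (rule set_eqI)
  fix x show "x \<in> A \<longleftrightarrow> x \<in> (\<lambda>(j, i). (i, j)) ` (SIGMA j:B. f j)"
    using assms[of "fst x" "snd x"] by (cases x) (auto simp: image_iff)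
qed

text \<open>\<open>C_boxes\<close> consists of whole columns of \<open>lam\<close>, which contain
  those of \<open>mu\<close>; the product therefore factors over columns.\<close>

lemma phi_eq_columns:
  assumes "is_partition lam" "is_partition mu" "horizontal_strip lam mu" "part lam 1 \<le> N"
  shows "phi q t lam mu = (\<Prod>j\<in>raised lam mu. column_weight q t lam j / column_weight q t mu j)"
proof -
  note hs = assms(3)[unfolded horizontal_strip_iff[OF assms(1,2)]]
  have fin: "finite (raised lam mu)"
    by (rule finite_subset[of _ "{1..N}"]) (use conj_part_eq_0[OF assms(1,4)] in \<open>force simp: raised_def not_less[symmetric]\<close>)+
  have C: "C_boxes lam mu = (\<lambda>(j, i). (i, j)) ` (SIGMA j:raised lam mu. {1..conj_part lam j})"
  proof -
    have "(i, j) \<in> C_boxes lam mu \<longleftrightarrow> j \<in> raised lam mu \<and> i \<in> {1..conj_part lam j}" for i j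
    proof (cases "1 \<le> j")
      case True
      then have "conj_part mu j \<le> conj_part lam j" using hs by simp
      then show ?thesis using boxes_iff[OF assms(1), of i j] boxes_iff[OF assms(2), of i j] True
        unfolding C_boxes_def raised_def by auto
    qed (use boxes_iff assms in \<open>auto simp: C_boxes_def raised_def\<close>)
    then show ?thesis by (rule set_eq_swapped_Sigma)
  qed
  have "phi q t lam mu = (\<Prod>(j, i)\<in>(SIGMA j:raised lam mu. {1..conj_part lam j}).
      b_weight q t lam (i, j) / b_weight q t mu (i, j))"
    unfolding phi_def C by (subst prod.reindex) (auto simp: inj_on_def intro!: prod.cong)
  also have "\<dots> = (\<Prod>j\<in>raised lam mu. \<Prod>i\<in>{1..conj_part lam j}. b_weight q t lam (i, j) / b_weight q t mu (i, j))"
    by (subst prod.Sigma[symmetric]) (use fin in auto)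
  also have "\<dots> = (\<Prod>j\<in>raised lam mu. column_weight q t lam j / column_weight q t mu j)"
  proof (rule prod.cong[OF refl])
    fix j assume "j \<in> raised lam mu"
    then have "1 \<le> j" "conj_part mu j \<le> conj_part lam j" by (auto simp: raised_def)
    then show "(\<Prod>i\<in>{1..conj_part lam j}. b_weight q t lam (i, j) / b_weight q t mu (i, j)) =
        column_weight q t lam j / column_weight q t mu j"
      using prod_column[OF assms(1), of j "conj_part lam j" q t]
        prod_column[OF assms(2), of j "conj_part lam j" q t] \<open>j \<in> _\<close> hs
      by (auto simp: prod_dividef)
  qed
  finally show ?thesis .
qed

text \<open>The complementary columns may be taken up to any bound \<open>N\<close> on the diagram,
  since an empty column contributes 1.\<close>

lemma psi_eq_columns:
  assumes "is_partition lam" "is_partition mu" "horizontal_strip lam mu" "part lam 1 \<le> N"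
  shows "psi q t lam mu = (\<Prod>j\<in>{1..N} - raised lam mu. column_weight q t mu j / column_weight q t lam j)"
proof -
  note hs = assms(3)[unfolded horizontal_strip_iff[OF assms(1,2)]]
  have C: "(boxes lam \<union> boxes mu) - C_boxes lam mu =
      (\<lambda>(j, i). (i, j)) ` (SIGMA j:{1..N} - raised lam mu. {1..conj_part lam j})"
  proof -
    have "(i, j) \<in> (boxes lam \<union> boxes mu) - C_boxes lam mu \<longleftrightarrow> j \<in> {1..N} - raised lam mu \<and> i \<in> {1..conj_part lam j}" for i j
    proof (cases "1 \<le> j")
      case True
      then have "conj_part mu j \<le> conj_part lam j" using hs by simp
      moreover have "conj_part lam j \<ge> 1 \<Longrightarrow> j \<le> N" using conj_part_eq_0[OF assms(1,4), of j] by (cases "j \<le> N") auto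
      ultimately show ?thesis using boxes_iff[OF assms(1), of i j] boxes_iff[OF assms(2), of i j] True
        unfolding C_boxes_def raised_def by auto
    qed (use boxes_iff assms in \<open>auto simp: C_boxes_def raised_def\<close>)
    then show ?thesis by (rule set_eq_swapped_Sigma)
  qed
  have "psi q t lam mu = (\<Prod>(j, i)\<in>(SIGMA j:{1..N} - raised lam mu. {1..conj_part lam j}).
      b_weight q t mu (i, j) / b_weight q t lam (i, j))"
    unfolding psi_def C by (subst prod.reindex) (auto simp: inj_on_def intro!: prod.cong)
  also have "\<dots> = (\<Prod>j\<in>{1..N} - raised lam mu. \<Prod>i\<in>{1..conj_part lam j}. b_weight q t mu (i, j) / b_weight q t lam (i, j))"
    by (subst prod.Sigma[symmetric]) auto
  also have "\<dots> = (\<Prod>j\<in>{1..N} - raised lam mu. column_weight q t mu j / column_weight q t lam j)"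
  proof (rule prod.cong[OF refl])
    fix j assume "j \<in> {1..N} - raised lam mu"
    then have "1 \<le> j" "conj_part mu j \<le> conj_part lam j" using hs by auto
    then show "(\<Prod>i\<in>{1..conj_part lam j}. b_weight q t mu (i, j) / b_weight q t lam (i, j)) =
        column_weight q t mu j / column_weight q t lam j"
      using prod_column[OF assms(1), of j "conj_part lam j" q t]
        prod_column[OF assms(2), of j "conj_part lam j" q t] \<open>j \<in> _\<close> hs
      by (auto simp: prod_dividef)
  qed
  finally show ?thesis .
qed

section \<open>The Pieri coefficients as products over pairs of columns\<close>

locale generic_parameters =
  fixes q t :: "'a::field"
  assumes q_nonzero: "q \<noteq> 0" and t_nonzero: "t \<noteq> 0"
    and one_minus_nonzero: "\<And>a b. a > 0 \<or> b > 0 \<Longrightarrow> 1 - q ^ a * t ^ b \<noteq> 0"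
begin

text \<open>Numerators of \<open>b_weight\<close> for boxes with arm \<open>a\<close> and all legs
  below \<open>n\<close>; \<open>den_prod (Suc a) n\<close> gives the matching denominators.\<close>

definition num_prod :: "nat \<Rightarrow> nat \<Rightarrow> 'a" where
  "num_prod a n = (\<Prod>d<n. 1 - q ^ a * t ^ Suc d)"

definition den_prod :: "nat \<Rightarrow> nat \<Rightarrow> 'a" where
  "den_prod a n = (\<Prod>d<n. 1 - q ^ a * t ^ d)"

text \<open>The interaction of two columns at distance \<open>a\<close> whose heights differ by
  \<open>d\<close>.\<close>

definition col_factor :: "nat \<Rightarrow> nat \<Rightarrow> 'a" where
  "col_factor a d = num_prod (a - 1) d * den_prod (Suc a) d / (num_prod a d * den_prod a d)"

lemma num_prod_nonzero: "num_prod a n \<noteq> 0"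
  unfolding num_prod_def using one_minus_nonzero by (auto simp del: power_Suc)

lemma den_prod_nonzero: "a > 0 \<Longrightarrow> den_prod a n \<noteq> 0"
  unfolding den_prod_def using one_minus_nonzero by auto

lemma num_prod_diff: "m \<le> n \<Longrightarrow> (\<Prod>d\<in>{m..<n}. 1 - q ^ a * t ^ Suc d) = num_prod a n / num_prod a m"
  using prod.atLeastLessThan_concat[of 0 m n "\<lambda>d. 1 - q ^ a * t ^ Suc d"] num_prod_nonzero[of a m]
  unfolding num_prod_def by (simp add: atLeast0LessThan field_simps)

lemma den_prod_diff: "a > 0 \<Longrightarrow> m \<le> n \<Longrightarrow> (\<Prod>d\<in>{m..<n}. 1 - q ^ a * t ^ d) = den_prod a n / den_prod a m"
  using prod.atLeastLessThan_concat[of 0 m n "\<lambda>d. 1 - q ^ a * t ^ d"] den_prod_nonzero[of a m]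
  unfolding den_prod_def by (simp add: atLeast0LessThan field_simps)

text \<open>These rows have length exactly \<open>k\<close>, so in column \<open>j\<close> the arm
  is constantly \<open>k - j\<close> while the leg runs through an interval.\<close>

lemma column_rows:
  assumes lam: "is_partition lam" and "1 \<le> j" "j \<le> k"
  defines "l \<equiv> conj_part lam"
  shows "(\<Prod>i\<in>{l (Suc k)<..l k}. b_weight q t lam (i, j)) =
    num_prod (k - j) (l j - l (Suc k)) / num_prod (k - j) (l j - l k) *
    (den_prod (Suc (k - j)) (l j - l k) / den_prod (Suc (k - j)) (l j - l (Suc k)))"
proof -
  have le: "l (Suc k) \<le> l k" "l k \<le> l j" unfolding l_def using conj_part_antimono[OF lam] assms by auto
  have b: "b_weight q t lam (i, j) = (1 - q ^ (k - j) * t ^ Suc (l j - i)) / (1 - q ^ Suc (k - j) * t ^ (l j - i))"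
    if "i \<in> {l (Suc k)<..l k}" for i
  proof -
    have i: "1 \<le> i" "i \<le> l k" "\<not> i \<le> l (Suc k)" using that by auto
    have "k \<le> part lam i" "\<not> Suc k \<le> part lam i"
      using le_part_iff[OF lam i(1), of k] le_part_iff[OF lam i(1), of "Suc k"] i assms unfolding l_def by auto
    then have "part lam i = k" by simp
    moreover have "(i, j) \<in> boxes lam" using boxes_iff[OF lam] i le assms unfolding l_def by simp
    ultimately show ?thesis by (simp add: b_weight_def arm_def leg_def l_def)
  qed
  have "(\<Prod>i\<in>{l (Suc k)<..l k}. b_weight q t lam (i, j)) =
      (\<Prod>d\<in>{l j - l k..<l j - l (Suc k)}. (1 - q ^ (k - j) * t ^ Suc d) / (1 - q ^ Suc (k - j) * t ^ d))"
    by (rule prod.reindex_bij_witness[of _ "\<lambda>d. l j - d" "\<lambda>i. l j - i"]) (use le b in auto)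
  also have "\<dots> = num_prod (k - j) (l j - l (Suc k)) / num_prod (k - j) (l j - l k) /
      (den_prod (Suc (k - j)) (l j - l (Suc k)) / den_prod (Suc (k - j)) (l j - l k))"
    unfolding prod_dividef using le by (simp only: num_prod_diff den_prod_diff diff_le_mono2 zero_less_Suc)
  finally show ?thesis by simp
qed

text \<open>The rows are grouped into blocks of equal length. The end of one block and the start of
  the next meet at the same leg, and their contributions there combine into one
  \<open>col_factor\<close>.\<close>

lemma column_weight_partial:
  assumes lam: "is_partition lam" and "1 \<le> j" "j \<le> k"
  defines "l \<equiv> conj_part lam"
  shows "(\<Prod>i\<in>{l (Suc k)<..l j}. b_weight q t lam (i, j)) =
    num_prod (k - j) (l j - l (Suc k)) / den_prod (Suc (k - j)) (l j - l (Suc k)) *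
    (\<Prod>i\<in>{j<..k}. col_factor (i - j) (l j - l i))"
  using assms(3)
proof (induction k rule: dec_induct)
  case base
  show ?case unfolding l_def by (subst column_rows[OF lam assms(2)]) (auto simp: num_prod_def den_prod_def)
next
  case (step k)
  have le: "l (Suc (Suc k)) \<le> l (Suc k)" "l (Suc k) \<le> l j" unfolding l_def using conj_part_antimono[OF lam] assms(2) step by auto
  have "{l (Suc (Suc k))<..l j} = {l (Suc (Suc k))<..l (Suc k)} \<union> {l (Suc k)<..l j}" using le by auto
  then have "(\<Prod>i\<in>{l (Suc (Suc k))<..l j}. b_weight q t lam (i, j)) =
      (\<Prod>i\<in>{l (Suc (Suc k))<..l (Suc k)}. b_weight q t lam (i, j)) * (\<Prod>i\<in>{l (Suc k)<..l j}. b_weight q t lam (i, j))"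
    by (simp add: prod.union_disjoint)
  also have "(\<Prod>i\<in>{l (Suc (Suc k))<..l (Suc k)}. b_weight q t lam (i, j)) =
     num_prod (Suc k - j) (l j - l (Suc (Suc k))) / num_prod (Suc k - j) (l j - l (Suc k)) *
    (den_prod (Suc (Suc k - j)) (l j - l (Suc k)) / den_prod (Suc (Suc k - j)) (l j - l (Suc (Suc k))))"
    unfolding l_def using column_rows[OF lam assms(2), of "Suc k"] step by simp
  also note step.IH
  also have "{j<..Suc k} = insert (Suc k) {j<..k}" using step by auto
  then have "(\<Prod>i\<in>{j<..Suc k}. col_factor (i - j) (l j - l i)) =
     col_factor (Suc k - j) (l j - l (Suc k)) * (\<Prod>i\<in>{j<..k}. col_factor (i - j) (l j - l i))" by simp
  moreover have "Suc k - j - 1 = k - j" "Suc (k - j) = Suc k - j" using step by auto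
  ultimately show ?case unfolding col_factor_def by (simp add: mult_ac)
qed

text \<open>Column \<open>N + 1\<close> is empty, so the partial product up to row length
  \<open>N\<close> is already the whole column.\<close>

lemma column_weight_eq:
  assumes lam: "is_partition lam" and "part lam 1 \<le> N" "1 \<le> j" "j \<le> N"
  defines "l \<equiv> conj_part lam"
  shows "column_weight q t lam j = num_prod (N - j) (l j) / den_prod (Suc (N - j)) (l j) *
    (\<Prod>i\<in>{j<..N}. col_factor (i - j) (l j - l i))"
proof -
  have z: "conj_part lam (Suc N) = 0" using conj_part_eq_0[OF lam assms(2)] by simp
  have "{0<..conj_part lam j} = {1..conj_part lam j}" by auto
  then show ?thesis
    using column_weight_partial[OF lam assms(3,4)] unfolding column_weight_def z l_def by simp
qed

section \<open>Nodes and the change of the interaction of two columns\<close>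

abbreviation F where "F \<equiv> pair_factor q t"

text \<open>The ratio of two nodes records the distance of the columns in the exponent of
  \<open>q\<close> and their height difference in that of \<open>t\<close>; raising a column
  multiplies its node by \<open>t\<close>.\<close>

definition node :: "(nat \<Rightarrow> nat) \<Rightarrow> nat \<Rightarrow> 'a" where
  "node m k = t ^ m k / q ^ k"

lemma node_nonzero: "node m k \<noteq> 0"
  using q_nonzero t_nonzero by (simp add: node_def)

lemma node_ratio:
  assumes "j \<le> k" "m k \<le> m j"
  shows "node m j / node m k = q ^ (k - j) * t ^ (m j - m k)"
proof -
  have "q ^ k = q ^ j * q ^ (k - j)" "t ^ m j = t ^ m k * t ^ (m j - m k)"
    using assms by (simp_all flip: power_add)
  then show ?thesis using q_nonzero t_nonzero unfolding node_def by simp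
qed

lemma col_factor_nonzero: "a > 0 \<Longrightarrow> col_factor a d \<noteq> 0"
  unfolding col_factor_def using num_prod_nonzero den_prod_nonzero by simp

text \<open>The origin of the pair factor. All but one factor of each of the four products cancel
  between consecutive height differences.\<close>

lemma col_factor_Suc:
  assumes "a > 0"
  shows "col_factor a (Suc d) = col_factor a d * F (q ^ a * t ^ d)"
proof -
  have e: "q * (q ^ a * t ^ d) = q ^ Suc a * t ^ d" "t * (q ^ a * t ^ d) / q = q ^ (a - 1) * t ^ Suc d"
    "t * (q ^ a * t ^ d) = q ^ a * t ^ Suc d"
    using assms q_nonzero by (cases a; simp)+
  have "num_prod b (Suc d) = num_prod b d * (1 - q ^ b * t ^ Suc d)"
    "den_prod b (Suc d) = den_prod b d * (1 - q ^ b * t ^ d)" for b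
    unfolding num_prod_def den_prod_def by (simp_all add: mult.commute)
  then show ?thesis unfolding col_factor_def pair_factor_def e(1,2) unfolding e(3) by (simp only: times_divide_times_eq mult_ac)
qed

text \<open>The change of the boundary term at column \<open>N\<close> when a column with node
  \<open>x\<close> is raised.\<close>

definition tail :: "nat \<Rightarrow> 'a \<Rightarrow> 'a" where
  "tail N x = (1 - t * q ^ N * x) / (1 - q ^ Suc N * x)"

text \<open>Towards raised columns on the right the height difference is unchanged, towards unraised
  ones it grows by one. Everything else cancels except the boundary term.\<close>

lemma column_ratio_raised:
  assumes lam: "is_partition lam" and mu: "is_partition mu" and hs: "horizontal_strip lam mu"
    and N: "part lam 1 \<le> N" and j: "j \<in> raised lam mu"
  defines "m \<equiv> conj_part mu"
  shows "column_weight q t lam j / column_weight q t mu j =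
    tail N (node m j) * (\<Prod>k\<in>{j<..N}. if k \<in> raised lam mu then 1 else F (node m j / node m k))"
proof -
  define l where "l = conj_part lam"
  note strip = hs[unfolded horizontal_strip_iff[OF lam mu]]
  have muN: "part mu 1 \<le> N" using hs N unfolding horizontal_strip_def by (meson le_refl le_trans)
  have j1: "1 \<le> j" "m j < l j" using j unfolding raised_def m_def l_def by auto
  have jN: "j \<le> N" using conj_part_eq_0[OF lam N, of j] j1 unfolding l_def by (cases "j \<le> N") auto
  have lj: "l j = Suc (m j)" using strip j1 unfolding m_def l_def by (metis le_antisym Suc_leI)
  have c: "col_factor (k - j) (l j - l k) = col_factor (k - j) (m j - m k) *
      (if k \<in> raised lam mu then 1 else F (node m j / node m k))" if k: "k \<in> {j<..N}" for k
  proof -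
    have le: "m k \<le> m j" using conj_part_antimono[OF mu, of j k] k j1 unfolding m_def by auto
    have lk: "l k = (if k \<in> raised lam mu then Suc (m k) else m k)"
      using strip k j1 unfolding raised_def m_def l_def by (auto simp: le_antisym Suc_leI not_less)
    show ?thesis using le k lk lj col_factor_Suc[of "k - j" "m j - m k"] node_ratio[of j k m]
      by (auto simp: Suc_diff_le)
  qed
  have t1: "num_prod (N - j) (l j) / den_prod (Suc (N - j)) (l j) =
      num_prod (N - j) (m j) / den_prod (Suc (N - j)) (m j) * tail N (node m j)"
  proof -
    have "q ^ N = q ^ (N - j) * q ^ j" using jN by (simp flip: power_add)
    then have e: "t * q ^ N * node m j = q ^ (N - j) * t ^ Suc (m j)" "q ^ Suc N * node m j = q ^ Suc (N - j) * t ^ m j"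
      using q_nonzero by (auto simp: node_def)
    have "tail N (node m j) = (1 - q ^ (N - j) * t ^ Suc (m j)) / (1 - q ^ Suc (N - j) * t ^ m j)"
      unfolding tail_def e ..
    then show ?thesis unfolding lj num_prod_def den_prod_def by (simp add: mult_ac del: power_Suc)
  qed
  have pc: "(\<Prod>k\<in>{j<..N}. col_factor (k - j) (l j - l k)) = (\<Prod>k\<in>{j<..N}. col_factor (k - j) (m j - m k)) *
      (\<Prod>k\<in>{j<..N}. if k \<in> raised lam mu then 1 else F (node m j / node m k))"
    unfolding prod.distrib[symmetric] by (rule prod.cong[OF refl c])
  have nz: "(\<Prod>k\<in>{j<..N}. col_factor (k - j) (m j - m k)) \<noteq> 0" by (auto simp: col_factor_nonzero)
  have nz2: "num_prod (N - j) (m j) / den_prod (Suc (N - j)) (m j) \<noteq> 0"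
    using num_prod_nonzero den_prod_nonzero by simp
  have "a * T * (b * P) / (a * b) = T * P" if "a \<noteq> 0" "b \<noteq> 0" for a b T P :: 'a using that by simp
  from this[OF nz2 nz] show ?thesis
    unfolding column_weight_eq[OF lam N j1(1) jN] column_weight_eq[OF mu muN j1(1) jN]
      m_def[symmetric] l_def[symmetric] t1 pc .
qed

lemma F_inverse: "x \<noteq> 0 \<Longrightarrow> F (1 / x) = F (x / t)"
  using pair_factor_inverse[OF q_nonzero t_nonzero] .

lemma F_flip: "x \<noteq> 0 \<Longrightarrow> y \<noteq> 0 \<Longrightarrow> F (x / y) = F (y / (t * x))"
  using pair_factor_flip[OF q_nonzero t_nonzero] .

text \<open>A column of unchanged height loses one unit of height difference towards each raised
  column on its right. The involution expresses the resulting factor at the nodes of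
  \<open>mu\<close>; the boundary term is unchanged and cancels.\<close>

lemma column_ratio_unraised:
  assumes lam: "is_partition lam" and mu: "is_partition mu" and hs: "horizontal_strip lam mu"
    and N: "part lam 1 \<le> N" and j: "j \<in> {1..N} - raised lam mu"
  defines "m \<equiv> conj_part mu"
  shows "column_weight q t mu j / column_weight q t lam j =
    (\<Prod>k\<in>{j<..N}. if k \<in> raised lam mu then F (node m k / node m j) else 1)"
proof -
  define l where "l = conj_part lam"
  note strip = hs[unfolded horizontal_strip_iff[OF lam mu]]
  have muN: "part mu 1 \<le> N" using hs N unfolding horizontal_strip_def by (meson le_refl le_trans)
  have j1: "1 \<le> j" "j \<le> N" using j by auto
  have lj: "l j = m j" using strip j j1 unfolding m_def l_def raised_def by (auto simp: le_antisym)
  have c: "col_factor (k - j) (m j - m k) = col_factor (k - j) (l j - l k) *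
      (if k \<in> raised lam mu then F (node m k / node m j) else 1)" if k: "k \<in> {j<..N}" for k
  proof (cases "k \<in> raised lam mu")
    case True
    then have "m k < l k" unfolding raised_def m_def l_def by auto
    then have lk: "l k = Suc (m k)" using strip k j1 unfolding m_def l_def
      by (metis greaterThanAtMost_iff le_antisym Suc_leI le_trans less_imp_le_nat)
    \<comment> \<open>The raised column \<open>k\<close> still does not exceed the unraised column
      \<open>j\<close>, so in \<open>mu\<close> the height difference is positive.\<close>
    have "l k \<le> l j" using conj_part_antimono[OF lam, of j k] k j1 unfolding l_def by auto
    then obtain d where d: "m j = m k + Suc d" using lk lj by (metis Suc_le_eq less_imp_Suc_add add_Suc_right)
    have "F (node m k / node m j) = F (1 / (node m j / node m k))" by simp
    also have "\<dots> = F (node m j / node m k / t)" by (rule F_inverse) (simp add: node_nonzero)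
    also have "node m j / node m k / t = q ^ (k - j) * t ^ d"
      using node_ratio[of j k m] k d t_nonzero by simp
    finally show ?thesis using k True lk lj d col_factor_Suc[of "k - j" d] by simp
  next
    case False
    then have "l k = m k" using strip k j1 unfolding m_def l_def raised_def by (auto simp: le_antisym)
    then show ?thesis using False lj by simp
  qed
  have pc: "(\<Prod>k\<in>{j<..N}. col_factor (k - j) (m j - m k)) = (\<Prod>k\<in>{j<..N}. col_factor (k - j) (l j - l k)) *
      (\<Prod>k\<in>{j<..N}. if k \<in> raised lam mu then F (node m k / node m j) else 1)"
    unfolding prod.distrib[symmetric] by (rule prod.cong[OF refl c])
  have nz: "(\<Prod>k\<in>{j<..N}. col_factor (k - j) (l j - l k)) \<noteq> 0" by (auto simp: col_factor_nonzero)
  have nz2: "num_prod (N - j) (m j) / den_prod (Suc (N - j)) (m j) \<noteq> 0"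
    using num_prod_nonzero den_prod_nonzero by simp
  have "a * (b * P) / (a * b) = P" if "a \<noteq> 0" "b \<noteq> 0" for a b P :: 'a using that by simp
  from this[OF nz2 nz] show ?thesis
    unfolding column_weight_eq[OF lam N j1] column_weight_eq[OF mu muN j1]
      m_def[symmetric] l_def[symmetric] lj pc .
qed

definition pair_prod :: "nat \<Rightarrow> (nat \<Rightarrow> nat \<Rightarrow> 'a) \<Rightarrow> 'a" where
  "pair_prod N f = (\<Prod>a\<in>{1..N}. \<Prod>b\<in>{a<..N}. f a b)"

lemma pair_prod_cong:
  "(\<And>a b. 1 \<le> a \<Longrightarrow> a < b \<Longrightarrow> b \<le> N \<Longrightarrow> f a b = g a b) \<Longrightarrow> pair_prod N f = pair_prod N g"
  unfolding pair_prod_def by (intro prod.cong refl) auto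

lemma pair_prod_mult: "pair_prod N f * pair_prod N g = pair_prod N (\<lambda>a b. f a b * g a b)"
  unfolding pair_prod_def by (simp add: prod.distrib)

lemma raised_subset:
  assumes "is_partition lam" "part lam 1 \<le> N"
  shows "raised lam mu \<subseteq> {1..N}"
proof
  fix j assume "j \<in> raised lam mu"
  then show "j \<in> {1..N}" using conj_part_eq_0[OF assms, of j] by (cases "j \<le> N") (auto simp: raised_def)
qed

lemma phi_eq_pair_prod:
  assumes lam: "is_partition lam" and mu: "is_partition mu" and hs: "horizontal_strip lam mu"
    and N: "part lam 1 \<le> N"
  defines "m \<equiv> conj_part mu" and "J \<equiv> raised lam mu"
  shows "phi q t lam mu = (\<Prod>j\<in>J. tail N (node m j)) *
    pair_prod N (\<lambda>a b. if a \<in> J \<and> b \<notin> J then F (node m a / node m b) else 1)"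
proof -
  have J: "J \<subseteq> {1..N}" using raised_subset[OF lam N] unfolding J_def .
  have "phi q t lam mu = (\<Prod>j\<in>J. tail N (node m j) * (\<Prod>k\<in>{j<..N}. if k \<in> J then 1 else F (node m j / node m k)))"
    unfolding phi_eq_columns[OF lam mu hs N] J_def m_def
    by (rule prod.cong[OF refl], rule column_ratio_raised[OF lam mu hs N])
  also have "(\<Prod>j\<in>J. tail N (node m j) * (\<Prod>k\<in>{j<..N}. if k \<in> J then 1 else F (node m j / node m k))) =
      (\<Prod>j\<in>J. tail N (node m j)) * (\<Prod>j\<in>J. \<Prod>k\<in>{j<..N}. if k \<in> J then 1 else F (node m j / node m k))"
    by (rule prod.distrib)
  also have "(\<Prod>j\<in>J. \<Prod>k\<in>{j<..N}. if k \<in> J then 1 else F (node m j / node m k)) =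
    pair_prod N (\<lambda>a b. if a \<in> J \<and> b \<notin> J then F (node m a / node m b) else 1)"
    unfolding pair_prod_def
    by (rule prod.mono_neutral_cong_left) (use J in \<open>auto intro!: prod.cong\<close>)
  finally show ?thesis .
qed

lemma psi_eq_pair_prod:
  assumes lam: "is_partition lam" and mu: "is_partition mu" and hs: "horizontal_strip lam mu"
    and N: "part lam 1 \<le> N"
  defines "m \<equiv> conj_part mu" and "J \<equiv> raised lam mu"
  shows "psi q t lam mu = pair_prod N (\<lambda>a b. if a \<notin> J \<and> b \<in> J then F (node m b / node m a) else 1)"
proof -
  have "psi q t lam mu = (\<Prod>j\<in>{1..N} - J. \<Prod>k\<in>{j<..N}. if k \<in> J then F (node m k / node m j) else 1)"
    unfolding psi_eq_columns[OF lam mu hs N] J_def m_def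
    by (rule prod.cong[OF refl], rule column_ratio_unraised[OF lam mu hs N])
  also have "\<dots> = pair_prod N (\<lambda>a b. if a \<notin> J \<and> b \<in> J then F (node m b / node m a) else 1)"
    unfolding pair_prod_def
    by (rule prod.mono_neutral_cong_left) (auto intro!: prod.cong)
  finally show ?thesis .
qed

end

section \<open>Commutation of adding and removing horizontal strips\<close>

context generic_parameters
begin

lemma pair_prod_Suc: "pair_prod (Suc N) f = pair_prod N f * (\<Prod>a\<in>{1..N}. f a (Suc N))"
proof -
  have "{a<..Suc N} = insert (Suc N) {a<..N}" if "a \<le> N" for a using that by auto
  then have "(\<Prod>a\<in>{1..N}. \<Prod>b\<in>{a<..Suc N}. f a b) = (\<Prod>a\<in>{1..N}. f a (Suc N) * (\<Prod>b\<in>{a<..N}. f a b))"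
    by (intro prod.cong refl) simp
  then show ?thesis unfolding pair_prod_def by (simp add: prod.distrib mult.commute)
qed

lemma square_prod_eq_pair_prod:
  "(\<Prod>a\<in>{1..N}. \<Prod>b\<in>{1..N}. g a b) = pair_prod N g * pair_prod N (\<lambda>a b. g b a) * (\<Prod>a\<in>{1..N}. g a a)"
proof (induction N)
  case (Suc N)
  have "(\<Prod>a\<in>{1..Suc N}. \<Prod>b\<in>{1..Suc N}. g a b) =
      (\<Prod>a\<in>{1..N}. \<Prod>b\<in>{1..N}. g a b) * (\<Prod>a\<in>{1..N}. g a (Suc N)) *
      ((\<Prod>b\<in>{1..N}. g (Suc N) b) * g (Suc N) (Suc N))"
    by (simp add: prod.distrib mult_ac)
  then show ?case unfolding Suc pair_prod_Suc by (simp add: mult_ac)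
qed (simp add: pair_prod_def)

text \<open>\<open>subset_weight\<close> runs over pairs in either order, the Pieri coefficients
  over positions \<open>a < b\<close>. This form permits a comparison factor by factor.\<close>

lemma pair_prod_subset_weight:
  assumes "S \<subseteq> Z" "Z \<subseteq> {1..N}"
  shows "pair_prod N (\<lambda>a b. if a \<in> S \<and> b \<in> Z - S then f a b else if b \<in> S \<and> a \<in> Z - S then f b a else 1) =
    subset_weight f Z S"
proof -
  define g where "g = (\<lambda>a b. if a \<in> S \<and> b \<in> Z - S then f a b else 1)"
  have "subset_weight f Z S = (\<Prod>a\<in>S. \<Prod>b\<in>{1..N}. g a b)"
    unfolding subset_weight_def
  proof (rule prod.cong[OF refl])
    fix a assume "a \<in> S"
    then show "(\<Prod>b\<in>Z - S. f a b) = (\<Prod>b\<in>{1..N}. g a b)"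
      by (intro prod.mono_neutral_cong_left) (use assms in \<open>auto simp: g_def\<close>)
  qed
  also have "\<dots> = (\<Prod>a\<in>{1..N}. \<Prod>b\<in>{1..N}. g a b)"
    by (intro prod.mono_neutral_left) (use assms in \<open>auto simp: g_def\<close>)
  also have "\<dots> = pair_prod N g * pair_prod N (\<lambda>a b. g b a)"
  proof -
    have "g a a = 1" for a by (auto simp: g_def)
    then show ?thesis unfolding square_prod_eq_pair_prod by simp
  qed
  also have "\<dots> = pair_prod N (\<lambda>a b. if a \<in> S \<and> b \<in> Z - S then f a b else if b \<in> S \<and> a \<in> Z - S then f b a else 1)"
    unfolding pair_prod_mult by (rule pair_prod_cong) (auto simp: g_def)
  finally show ?thesis by simp
qed

end

text \<open>One matrix entry of the commutation relation. If some column lengths differ by more than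
  one, there is no common upper or lower partition; \<open>close\<close> describes the remaining
  case.\<close>

locale two_partitions = generic_parameters q t for q t :: "'a::field" +
  fixes lam mu :: "nat list" and N0 :: nat
  assumes lam: "is_partition lam" and mu: "is_partition mu"
    and lam_N0: "part lam 1 \<le> N0" and mu_N0: "part mu 1 \<le> N0"
    and close: "\<And>k. k \<ge> 1 \<Longrightarrow> conj_part lam k \<le> Suc (conj_part mu k) \<and> conj_part mu k \<le> Suc (conj_part lam k)"
begin

definition l where "l = conj_part lam"
definition m where "m = conj_part mu"
text \<open>In the columns of \<open>P\<close> and \<open>M\<close> every common upper or lower
  partition is forced; in those of \<open>Z N\<close> there is a choice, recorded by a set
  \<open>S\<close>.\<close>

definition P where "P = {k. 1 \<le> k \<and> l k = Suc (m k)}"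
definition M where "M = {k. 1 \<le> k \<and> m k = Suc (l k)}"
definition Z where "Z N = {k \<in> {1..N}. l k = m k}"
definition y where "y = node m"

lemma y_nonzero: "y k \<noteq> 0"
  unfolding y_def by (rule node_nonzero)

lemma trichotomy: "k \<ge> 1 \<Longrightarrow> k \<in> P \<or> k \<in> M \<or> l k = m k"
  using close[of k] unfolding P_def M_def l_def m_def by auto

lemma l_zero: "k > N0 \<Longrightarrow> l k = 0" and m_zero: "k > N0 \<Longrightarrow> m k = 0"
  unfolding l_def m_def using conj_part_eq_0[OF lam lam_N0] conj_part_eq_0[OF mu mu_N0] by auto

lemma P_subset: "P \<subseteq> {1..N0}" and M_subset: "M \<subseteq> {1..N0}"
proof -
  show "P \<subseteq> {1..N0}" using l_zero unfolding P_def by (auto simp: not_less[symmetric])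
  show "M \<subseteq> {1..N0}" using m_zero unfolding M_def by (auto simp: not_less[symmetric])
qed

lemma finite_P: "finite P" and finite_M: "finite M" and finite_Z: "finite (Z N)"
  using finite_subset[OF P_subset] finite_subset[OF M_subset] unfolding Z_def by auto

lemma Z_subset: "Z N \<subseteq> {1..N}"
  unfolding Z_def by auto

lemma disjoint: "P \<inter> M = {}" "P \<inter> Z N = {}" "M \<inter> Z N = {}"
  unfolding P_def M_def Z_def by auto

lemma l_antimono: "1 \<le> i \<Longrightarrow> i \<le> k \<Longrightarrow> l k \<le> l i" and m_antimono: "1 \<le> i \<Longrightarrow> i \<le> k \<Longrightarrow> m k \<le> m i"
  unfolding l_def m_def using conj_part_antimono lam mu by auto

text \<open>
  The pair factors that do not depend on the set \<open>S\<close> of additionally raised or lowered columns.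
  They are the same for adding (\<open>phi_psi_up\<close>) and for removing (\<open>phi_psi_down\<close>) and hence cancel.
\<close>
definition outer_factor :: "nat \<Rightarrow> nat \<Rightarrow> 'a" where
  "outer_factor a b =
    (if a \<in> P \<and> b \<in> M then F (y a / y b) * F (t * y a / y b)
     else if a \<in> P \<and> b \<notin> P \<or> a \<notin> P \<and> a \<notin> M \<and> b \<in> M then F (y a / y b) else 1)"

lemma node_l: "k \<in> P \<Longrightarrow> node l k = t * y k" "k \<in> M \<Longrightarrow> node l k = y k / t" "l k = m k \<Longrightarrow> node l k = y k"
  unfolding P_def M_def y_def node_def using t_nonzero by auto

lemma column_cases:
  assumes "k \<ge> 1" "S \<subseteq> Z N"
  obtains "k \<in> P" "k \<notin> M" "k \<notin> S" "l k = Suc (m k)"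
  | "k \<in> M" "k \<notin> P" "k \<notin> S" "m k = Suc (l k)"
  | "k \<notin> P" "k \<notin> M" "l k = m k"
proof -
  have "k \<in> P \<longleftrightarrow> l k = Suc (m k)" "k \<in> M \<longleftrightarrow> m k = Suc (l k)" "k \<in> S \<longrightarrow> l k = m k"
    using assms unfolding P_def M_def Z_def by auto
  note e = this
  have "l k = Suc (m k) \<or> m k = Suc (l k) \<or> l k = m k"
    using close[OF assms(1)] unfolding l_def m_def by linarith
  then show thesis
  proof (elim disjE)
    assume "l k = Suc (m k)" then show thesis using that(1) e by simp
  next
    assume "m k = Suc (l k)" then show thesis using that(2) e by simp
  next
    assume "l k = m k" then show thesis using that(3) e by simp
  qed
qed

text \<open>For \<open>S \<subseteq> Z N\<close>, raising \<open>P \<union> S\<close> over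
  \<open>mu\<close> is the same as raising \<open>M \<union> S\<close> over \<open>lam\<close>; the
  definition is stated from the side of \<open>mu\<close>, whose nodes are used throughout.\<close>

definition up_pred :: "nat list \<Rightarrow> nat set \<Rightarrow> bool" where
  "up_pred nu S \<longleftrightarrow> is_partition nu \<and> (\<forall>k\<ge>1. conj_part nu k = (if k \<in> P \<union> S then Suc (m k) else m k))"

definition down_pred :: "nat list \<Rightarrow> nat set \<Rightarrow> bool" where
  "down_pred kap S \<longleftrightarrow> is_partition kap \<and> (\<forall>k\<ge>1. m k = (if k \<in> M \<union> S then Suc (conj_part kap k) else conj_part kap k))"

lemma up_predD:
  assumes "up_pred nu S" "S \<subseteq> Z N"
  shows "is_partition nu" "horizontal_strip nu mu" "horizontal_strip nu lam"
    "raised nu mu = P \<union> S" "raised nu lam = M \<union> S"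
proof -
  show nu: "is_partition nu" using assms unfolding up_pred_def by blast
  have c: "conj_part nu k = (if k \<in> P \<union> S then Suc (m k) else m k)" if "k \<ge> 1" for k
    using assms that unfolding up_pred_def by blast
  have c': "conj_part nu k = (if k \<in> M \<union> S then Suc (l k) else l k)" if "k \<ge> 1" for k
    using c[OF that] by (cases rule: column_cases[OF that assms(2)]) simp_all
  have S: "k \<ge> 1" if "k \<in> P \<union> M \<union> S" for k using that assms(2) unfolding P_def M_def Z_def by auto
  show "horizontal_strip nu mu" unfolding horizontal_strip_iff[OF nu mu] using c unfolding m_def by auto
  show "horizontal_strip nu lam" unfolding horizontal_strip_iff[OF nu lam] using c' unfolding l_def by auto
  show "raised nu mu = P \<union> S" unfolding raised_def m_def[symmetric] using c S by (auto split: if_splits)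
  show "raised nu lam = M \<union> S" unfolding raised_def l_def[symmetric] using c' S by (auto split: if_splits)
qed

lemma down_predD:
  assumes "down_pred kap S" "S \<subseteq> Z N"
  shows "is_partition kap" "horizontal_strip mu kap" "horizontal_strip lam kap"
    "raised mu kap = M \<union> S" "raised lam kap = P \<union> S"
proof -
  show kap: "is_partition kap" using assms unfolding down_pred_def by blast
  have c: "m k = (if k \<in> M \<union> S then Suc (conj_part kap k) else conj_part kap k)" if "k \<ge> 1" for k
    using assms that unfolding down_pred_def by blast
  have c': "l k = (if k \<in> P \<union> S then Suc (conj_part kap k) else conj_part kap k)" if "k \<ge> 1" for k
    using c[OF that] by (cases rule: column_cases[OF that assms(2)]) simp_all
  have S: "k \<ge> 1" if "k \<in> P \<union> M \<union> S" for k using that assms(2) unfolding P_def M_def Z_def by auto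
  show "horizontal_strip mu kap" unfolding horizontal_strip_iff[OF mu kap] using c unfolding m_def by auto
  show "horizontal_strip lam kap" unfolding horizontal_strip_iff[OF lam kap] using c' unfolding l_def by auto
  show "raised mu kap = M \<union> S" unfolding raised_def m_def[symmetric] using c S by (auto split: if_splits)
  show "raised lam kap = P \<union> S" unfolding raised_def l_def[symmetric] using c' S by (auto split: if_splits)
qed

text \<open>The coefficient \<open>psi\<close> lives on the nodes of \<open>lam\<close>. Rewritten
  at the nodes of \<open>mu\<close> with the help of the involution, the factors inside
  \<open>Z N\<close> form the subset weight, and all remaining ones are independent of
  \<open>S\<close> apart from the boundary terms.\<close>

lemma phi_psi_up:
  assumes nu: "up_pred nu S" and S: "S \<subseteq> Z N" and N: "part nu 1 \<le> N"
  shows "phi q t nu mu * psi q t nu lam = (\<Prod>j\<in>P \<union> S. tail N (y j)) *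
    (pair_prod N outer_factor * subset_weight (\<lambda>i k. F (y i / y k)) (Z N) S)"
proof -
  note D = up_predD[OF nu S]
  have "pair_prod N (\<lambda>a b. if a \<in> P \<union> S \<and> b \<notin> P \<union> S then F (node m a / node m b) else 1) *
      pair_prod N (\<lambda>a b. if a \<notin> M \<union> S \<and> b \<in> M \<union> S then F (node l b / node l a) else 1) =
    pair_prod N outer_factor * subset_weight (\<lambda>i k. F (y i / y k)) (Z N) S"
    unfolding pair_prod_subset_weight[of S "Z N" N, symmetric, OF S Z_subset]
      pair_prod_mult y_def[symmetric]
  proof (rule pair_prod_cong)
    fix a b assume ab: "1 \<le> a" "a < b" "b \<le> N"
    have nz: "y a \<noteq> 0" "y b \<noteq> 0" "t \<noteq> 0" using y_nonzero t_nonzero by auto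
    \<comment> \<open>Here \<open>lam\<close> has the node \<open>t * y a\<close> for
      \<open>a\<close> in \<open>P\<close> and \<open>y b / t\<close> for \<open>b\<close> in
      \<open>M\<close>.\<close>
    have PM: "F (y b / (t * (t * y a))) = F (t * y a / y b)"
      using F_flip[of "t * y a" "y b"] nz by simp
    have PZ: "F (y b / (t * y a)) = F (y a / y b)" using F_flip[of "y a" "y b"] nz by simp
    have SZ: "k \<in> S \<Longrightarrow> l k = m k" for k using S unfolding Z_def by auto
    have tri: "(k \<in> P \<and> k \<notin> M \<and> k \<notin> Z N \<and> k \<notin> S) \<or> (k \<in> M \<and> k \<notin> P \<and> k \<notin> Z N \<and> k \<notin> S) \<or>
         (k \<in> Z N \<and> k \<notin> P \<and> k \<notin> M)" if "1 \<le> k" "k \<le> N" for k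
      by (cases rule: column_cases[OF that(1) S]) (use that in \<open>simp_all add: Z_def\<close>)
    have tri: "(a \<in> P \<and> a \<notin> M \<and> a \<notin> Z N \<and> a \<notin> S) \<or> (a \<in> M \<and> a \<notin> P \<and> a \<notin> Z N \<and> a \<notin> S) \<or>
         (a \<in> Z N \<and> a \<notin> P \<and> a \<notin> M)"
      "(b \<in> P \<and> b \<notin> M \<and> b \<notin> Z N \<and> b \<notin> S) \<or> (b \<in> M \<and> b \<notin> P \<and> b \<notin> Z N \<and> b \<notin> S) \<or>
         (b \<in> Z N \<and> b \<notin> P \<and> b \<notin> M)"
      using tri[of a] tri[of b] ab by auto
    have nl: "a \<in> Z N \<Longrightarrow> node l a = y a" "b \<in> Z N \<Longrightarrow> node l b = y b" using node_l(3) unfolding Z_def by auto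
    show "(if a \<in> P \<union> S \<and> b \<notin> P \<union> S then F (y a / y b) else 1) *
        (if a \<notin> M \<union> S \<and> b \<in> M \<union> S then F (node l b / node l a) else 1) =
      outer_factor a b *
        (if a \<in> S \<and> b \<in> Z N - S then F (y a / y b) else if b \<in> S \<and> a \<in> Z N - S then F (y b / y a) else 1)"
      using tri(1)
    proof (elim disjE conjE)
      assume a: "a \<in> P" "a \<notin> M" "a \<notin> Z N" "a \<notin> S"
      show ?thesis using tri(2) a by (elim disjE conjE) (auto simp: outer_factor_def node_l PM PZ nl)
    next
      assume a: "a \<in> M" "a \<notin> P" "a \<notin> Z N" "a \<notin> S"
      show ?thesis using tri(2) a by (elim disjE conjE) (auto simp: outer_factor_def)
    next
      assume a: "a \<in> Z N" "a \<notin> P" "a \<notin> M"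
      show ?thesis using tri(2) a by (elim disjE conjE) (auto simp: outer_factor_def node_l PZ nl)
    qed
  qed
  moreover have "part nu 1 \<le> N" by (rule N)
  ultimately show ?thesis
    unfolding phi_eq_pair_prod[OF D(1) mu D(2) N] psi_eq_pair_prod[OF D(1) lam D(3) N] D(4,5)
      l_def[symmetric] m_def[symmetric] y_def[symmetric] by (simp only: mult.assoc)
qed

text \<open>Lowering the columns of \<open>S\<close> instead of raising them inverts the ratios in
  the subset weight; the boundary terms now sit at the nodes of \<open>kap\<close>.\<close>

lemma phi_psi_down:
  assumes kap: "down_pred kap S" and S: "S \<subseteq> Z N" and N: "N0 \<le> N"
  shows "phi q t lam kap * psi q t mu kap = (\<Prod>j\<in>P \<union> S. tail N (node (conj_part kap) j)) *
    (pair_prod N outer_factor * subset_weight (\<lambda>i k. F (y k / y i)) (Z N) S)"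
proof -
  note D = down_predD[OF kap S]
  define n where "n = node (conj_part kap)"
  have n: "n k = (if k \<in> M \<union> S then y k / t else y k)" if "1 \<le> k" for k
    using kap that t_nonzero unfolding down_pred_def n_def y_def node_def by auto
  have "pair_prod N (\<lambda>a b. if a \<in> P \<union> S \<and> b \<notin> P \<union> S then F (n a / n b) else 1) *
      pair_prod N (\<lambda>a b. if a \<notin> M \<union> S \<and> b \<in> M \<union> S then F (n b / n a) else 1) =
    pair_prod N outer_factor * subset_weight (\<lambda>i k. F (y k / y i)) (Z N) S"
    unfolding pair_prod_subset_weight[of S "Z N" N, symmetric, OF S Z_subset]
      pair_prod_mult
  proof (rule pair_prod_cong)
    fix a b assume ab: "1 \<le> a" "a < b" "b \<le> N"
    have nz: "y a \<noteq> 0" "y b \<noteq> 0" "t \<noteq> 0" using y_nonzero t_nonzero by auto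
    have e1: "F (y b / t / y a) = F (y a / y b)" using F_flip[of "y a" "y b"] nz by simp
    have e2: "F (y a / t / y b) = F (y b / y a)" using F_flip[of "y b" "y a"] nz by simp
    have e3: "F (y a / (y b / t)) = F (t * y a / y b)" using nz by (simp add: mult.commute)
    have e4: "F (y a / t / (y b / t)) = F (y a / y b)" using nz by simp
    have tri: "(k \<in> P \<and> k \<notin> M \<and> k \<notin> Z N \<and> k \<notin> S) \<or> (k \<in> M \<and> k \<notin> P \<and> k \<notin> Z N \<and> k \<notin> S) \<or>
         (k \<in> Z N \<and> k \<notin> P \<and> k \<notin> M)" if "1 \<le> k" "k \<le> N" for k
      by (cases rule: column_cases[OF that(1) S]) (use that in \<open>simp_all add: Z_def\<close>)
    have tri: "(a \<in> P \<and> a \<notin> M \<and> a \<notin> Z N \<and> a \<notin> S) \<or> (a \<in> M \<and> a \<notin> P \<and> a \<notin> Z N \<and> a \<notin> S) \<or>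
         (a \<in> Z N \<and> a \<notin> P \<and> a \<notin> M)"
      "(b \<in> P \<and> b \<notin> M \<and> b \<notin> Z N \<and> b \<notin> S) \<or> (b \<in> M \<and> b \<notin> P \<and> b \<notin> Z N \<and> b \<notin> S) \<or>
         (b \<in> Z N \<and> b \<notin> P \<and> b \<notin> M)"
      using tri[of a] tri[of b] ab by auto
    have n': "n a = (if a \<in> M \<union> S then y a / t else y a)" "n b = (if b \<in> M \<union> S then y b / t else y b)"
      using n ab by auto
    show "(if a \<in> P \<union> S \<and> b \<notin> P \<union> S then F (n a / n b) else 1) *
        (if a \<notin> M \<union> S \<and> b \<in> M \<union> S then F (n b / n a) else 1) =
      outer_factor a b *
        (if a \<in> S \<and> b \<in> Z N - S then F (y b / y a) else if b \<in> S \<and> a \<in> Z N - S then F (y a / y b) else 1)"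
      using tri(1)
    proof (elim disjE conjE)
      assume a: "a \<in> P" "a \<notin> M" "a \<notin> Z N" "a \<notin> S"
      show ?thesis using tri(2) a unfolding n'
        by (elim disjE conjE) (auto simp only: outer_factor_def e1 e2 e3 e4 mult_1 mult_1_right if_True if_False simp_thms Un_iff Diff_iff mult.commute split: if_split)
    next
      assume a: "a \<in> M" "a \<notin> P" "a \<notin> Z N" "a \<notin> S"
      show ?thesis using tri(2) a unfolding n'
        by (elim disjE conjE) (auto simp only: outer_factor_def e1 e2 e3 e4 mult_1 mult_1_right if_True if_False simp_thms Un_iff Diff_iff split: if_split)
    next
      assume a: "a \<in> Z N" "a \<notin> P" "a \<notin> M"
      show ?thesis using tri(2) a unfolding n'
        by (elim disjE conjE) (auto simp only: outer_factor_def e1 e2 e3 e4 mult_1 mult_1_right if_True if_False simp_thms Un_iff Diff_iff split: if_split)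
    qed
  qed
  moreover have "part lam 1 \<le> N" "part mu 1 \<le> N" using N lam_N0 mu_N0 by auto
  ultimately show ?thesis
    unfolding phi_eq_pair_prod[OF lam D(1) D(3) \<open>part lam 1 \<le> N\<close>] psi_eq_pair_prod[OF mu D(1) D(2) \<open>part mu 1 \<le> N\<close>] D(4,5)
      n_def by (simp only: mult.assoc)
qed

end

section \<open>Which sets of columns lead to partitions\<close>

context two_partitions
begin

text \<open>Of two neighbouring columns of equal height, the right one may be raised only together
  with the left one; this is what keeps the column lengths weakly decreasing.\<close>

definition valid_up :: "nat set \<Rightarrow> bool" where
  "valid_up S \<longleftrightarrow> (\<forall>k\<ge>1. m (Suc k) = m k \<and> Suc k \<in> P \<union> S \<longrightarrow> k \<in> P \<union> S)"

definition valid_down :: "nat set \<Rightarrow> bool" where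
  "valid_down S \<longleftrightarrow> (\<forall>k\<ge>1. m (Suc k) = m k \<and> k \<in> M \<union> S \<longrightarrow> Suc k \<in> M \<union> S)"

lemma up_pred_unique: "up_pred nu S \<Longrightarrow> up_pred nu' S \<Longrightarrow> nu = nu'"
  unfolding up_pred_def by (metis partition_eqI)

lemma down_pred_unique: "down_pred kap S \<Longrightarrow> down_pred kap' S \<Longrightarrow> kap = kap'"
  unfolding down_pred_def by (rule partition_eqI) (auto split: if_splits)

lemma antimono_from_Suc:
  assumes "\<And>k. 1 \<le> k \<Longrightarrow> f (Suc k) \<le> (f k :: nat)" "1 \<le> i" "i \<le> k"
  shows "f k \<le> f i"
  using assms(3) by (induction k rule: dec_induct) (use assms in \<open>auto intro: order_trans\<close>)

lemma up_pred_exists: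
  assumes "S \<subseteq> Z N" "valid_up S"
  obtains nu where "up_pred nu S"
proof -
  let ?f = "\<lambda>k. if k \<in> P \<union> S then Suc (m k) else m k"
  have "\<exists>nu. is_partition nu \<and> (\<forall>k\<ge>1. conj_part nu k = ?f k)"
  proof (rule partition_exists[of ?f "max N N0"])
    show "?f k \<le> ?f i" if "1 \<le> i" "i \<le> k" for i k
    proof (rule antimono_from_Suc[OF _ that])
      fix k :: nat assume k: "1 \<le> k"
      have "m (Suc k) \<le> m k" using m_antimono k by simp
      then consider "m (Suc k) < m k" | "m (Suc k) = m k" by linarith
      then show "?f (Suc k) \<le> ?f k"
      proof cases
        case 2
        then show ?thesis using assms(2) k unfolding valid_up_def by auto
      qed auto
    qed
    show "?f k = 0" if "max N N0 < k" for k
    proof -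
      have "k \<notin> S" using assms(1) that Z_subset[of N] by auto
      moreover have "k \<notin> P" using P_subset that by auto
      ultimately show ?thesis using m_zero that by simp
    qed
  qed blast
  then show thesis using that unfolding up_pred_def by blast
qed

lemma valid_up_if_up_pred:
  assumes "up_pred nu S"
  shows "valid_up S"
  unfolding valid_up_def
proof (intro allI impI)
  fix k :: nat assume k: "1 \<le> k" "m (Suc k) = m k \<and> Suc k \<in> P \<union> S"
  have "conj_part nu (Suc k) \<le> conj_part nu k"
    using conj_part_antimono[of nu k "Suc k"] assms k unfolding up_pred_def by auto
  then show "k \<in> P \<union> S" using assms k unfolding up_pred_def by (auto split: if_splits)
qed

text \<open>The zero that removes sets \<open>S\<close> not leading to a partition.\<close>

lemma F_inverse_q: "F (1 / q) = 0"
  using q_nonzero by (simp add: pair_factor_def)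

lemma y_Suc: "m (Suc k) = m k \<Longrightarrow> y (Suc k) / y k = 1 / q"
  using q_nonzero t_nonzero unfolding y_def node_def by simp

text \<open>A violation occurs at neighbouring columns of equal height in \<open>mu\<close>, whose
  nodes have ratio \<open>1 / q\<close>.\<close>

lemma invalid_up_weight:
  assumes S: "S \<subseteq> Z N" and "\<not> valid_up S"
  shows "subset_weight (\<lambda>i k. F (y i / y k)) (Z N) S = 0"
proof -
  obtain k where k: "k \<ge> 1" "m (Suc k) = m k" "Suc k \<in> P \<union> S" "k \<notin> P \<union> S"
    using assms(2) unfolding valid_up_def by blast
  have le: "l (Suc k) \<le> l k" using l_antimono k by simp
  \<comment> \<open>The raised right column is not in \<open>P\<close>: since the columns of
    \<open>lam\<close> decrease, \<open>k\<close> would then lie in \<open>P\<close> too.\<close>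
  have "Suc k \<in> S"
  proof (rule ccontr)
    assume "Suc k \<notin> S"
    then have "l (Suc k) = Suc (m k)" using k unfolding P_def by auto
    then show False using le k by (cases rule: column_cases[OF k(1) S]) auto
  qed
  then have "Suc k \<in> Z N" using S by auto
  then have "l (Suc k) = m k" "k \<le> N" using k unfolding Z_def by auto
  then have "k \<in> Z N - S" using le k by (cases rule: column_cases[OF k(1) S]) (auto simp: Z_def)
  moreover have "F (y (Suc k) / y k) = 0" using y_Suc[OF k(2)] F_inverse_q by simp
  ultimately show ?thesis unfolding subset_weight_def using \<open>Suc k \<in> S\<close> finite_Z finite_subset[OF S finite_Z]
    by (auto intro!: prod_zero)
qed

text \<open>The zero comes from the right neighbour of a lowered column, which must itself be among
  the first \<open>N\<close> columns. Sets that contain column \<open>N\<close> escape this argument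
  and are treated in the limit.\<close>

lemma invalid_down_weight:
  assumes S: "S \<subseteq> Z N" and N: "N \<ge> N0" and "\<And>k. k \<in> S \<Longrightarrow> k < N" and "\<not> valid_down S"
  shows "subset_weight (\<lambda>i k. F (y k / y i)) (Z N) S = 0"
proof -
  obtain k where k: "k \<ge> 1" "m (Suc k) = m k" "k \<in> M \<union> S" "Suc k \<notin> M \<union> S"
    using assms(4) unfolding valid_down_def by blast
  have le: "l (Suc k) \<le> l k" using l_antimono k by simp
  have Sk: "1 \<le> Suc k" by simp
  have "k \<in> S"
  proof (rule ccontr)
    assume "k \<notin> S"
    then have "m k = Suc (l k)" using k unfolding M_def by auto
    then show False using le k by (cases rule: column_cases[OF Sk S]) auto
  qed
  then have "k \<in> Z N" "k < N" using S assms(3) by auto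
  then have "l k = m k" "Suc k \<le> N" unfolding Z_def by auto
  then have "Suc k \<in> Z N - S" using le k by (cases rule: column_cases[OF Sk S]) (auto simp: Z_def)
  moreover have "F (y (Suc k) / y k) = 0" using y_Suc[OF k(2)] F_inverse_q by simp
  ultimately show ?thesis unfolding subset_weight_def using \<open>k \<in> S\<close> finite_Z finite_subset[OF S finite_Z]
    by (auto intro!: prod_zero)
qed

text \<open>Beyond \<open>N0\<close> all columns of \<open>mu\<close> are empty, so a raised one
  forces all columns between it and \<open>N0\<close>. The admissible sets of a given size thus stop
  depending on \<open>N\<close>.\<close>

lemma valid_up_bound:
  assumes S: "S \<subseteq> Z N" and v: "valid_up S"
  shows "S \<subseteq> {..N0 + card S}"
proof
  fix i assume i: "i \<in> S"
  show "i \<in> {..N0 + card S}"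
  proof (cases "i \<le> N0")
    case False
    have "k \<in> S" if "N0 < k" "k \<le> i" for k
      using that(2,1)
    proof (induction k rule: inc_induct)
      case (step k)
      then have k: "Suc k \<in> S" "1 \<le> k" "N0 < k" by auto
      have "k \<notin> P" using P_subset k(3) by auto
      moreover have "m (Suc k) = m k" using m_zero k(3) by simp
      ultimately show ?case using v k unfolding valid_up_def by blast
    qed (use i in auto)
    then have "{N0<..i} \<subseteq> S" by auto
    then have "card {N0<..i} \<le> card S" using card_mono finite_subset[OF S finite_Z] by blast
    then show ?thesis by simp
  qed simp
qed

lemma down_pred_exists:
  assumes "S \<subseteq> Z N" "valid_down S"
  obtains kap where "down_pred kap S"
proof -
  \<comment> \<open>A lowered column is nonempty: lowering an empty one would force lowering all
    columns to its right, but \<open>M \<union> S\<close> is bounded. So the subtraction in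
    \<open>?f\<close> does not truncate.\<close>
  have pos: "0 < m k" if "k \<in> M \<union> S" "1 \<le> k" for k
  proof (rule ccontr)
    assume "\<not> 0 < m k"
    then have z: "m k = 0" by simp
    have zz: "m (k + i) = 0 \<and> k + i \<in> M \<union> S" for i
    proof (induction i)
      case (Suc i)
      have "m (Suc (k + i)) \<le> m (k + i)" using m_antimono that by simp
      then have "m (Suc (k + i)) = 0" using Suc by simp
      then show ?case using Suc assms(2) that unfolding valid_down_def by auto
    qed (use z that in auto)
    have "k + (N0 + N) \<in> M \<union> S" using zz by blast
    moreover have "M \<union> S \<subseteq> {1..N0 + N}" using M_subset Z_subset[of N] assms(1) by fastforce
    ultimately show False using that by auto
  qed
  let ?f = "\<lambda>k. if k \<in> M \<union> S then m k - 1 else m k"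
  have "\<exists>kap. is_partition kap \<and> (\<forall>k\<ge>1. conj_part kap k = ?f k)"
  proof (rule partition_exists[of ?f N0])
    show "?f k \<le> ?f i" if "1 \<le> i" "i \<le> k" for i k
    proof (rule antimono_from_Suc[OF _ that])
      fix k :: nat assume k: "1 \<le> k"
      have "m (Suc k) \<le> m k" using m_antimono k by simp
      then consider "m (Suc k) < m k" | "m (Suc k) = m k" by linarith
      then show "?f (Suc k) \<le> ?f k"
      proof cases
        case 2
        then show ?thesis using assms(2) k unfolding valid_down_def by auto
      qed auto
    qed
    show "?f k = 0" if "N0 < k" for k using m_zero[OF that] by simp
  qed blast
  then show thesis using that pos unfolding down_pred_def by (metis Suc_pred' diff_Suc_1)
qed

lemma valid_down_if_down_pred:
  assumes "down_pred kap S"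
  shows "valid_down S"
  unfolding valid_down_def
proof (intro allI impI)
  fix k :: nat assume k: "1 \<le> k" "m (Suc k) = m k \<and> k \<in> M \<union> S"
  have "conj_part kap (Suc k) \<le> conj_part kap k"
    using conj_part_antimono[of kap k "Suc k"] assms k unfolding down_pred_def by auto
  moreover have "m k = Suc (conj_part kap k)" using assms k unfolding down_pred_def by auto
  moreover have "m (Suc k) = (if Suc k \<in> M \<union> S then Suc (conj_part kap (Suc k)) else conj_part kap (Suc k))"
    using assms unfolding down_pred_def by simp
  ultimately show "Suc k \<in> M \<union> S" using k by (auto split: if_splits)
qed

lemma up_pred_if_strips:
  assumes nu: "is_partition nu" and h: "horizontal_strip nu mu" "horizontal_strip nu lam"
  shows "up_pred nu (raised nu mu - P)" "raised nu mu - P \<subseteq> Z (part nu 1)"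
proof -
  have c: "m k \<le> conj_part nu k" "conj_part nu k \<le> Suc (m k)" "l k \<le> conj_part nu k" "conj_part nu k \<le> Suc (l k)" if "k \<ge> 1" for k
    using h that unfolding horizontal_strip_iff[OF nu mu] horizontal_strip_iff[OF nu lam] m_def l_def by auto
  have r: "k \<in> raised nu mu \<longleftrightarrow> conj_part nu k = Suc (m k)" if "k \<ge> 1" for k
    using c[OF that] that unfolding raised_def m_def by auto
  show "up_pred nu (raised nu mu - P)"
    unfolding up_pred_def
  proof (intro conjI allI impI)
    fix k :: nat assume k: "k \<ge> 1"
    have "k \<in> P \<Longrightarrow> conj_part nu k = Suc (m k)" using c[OF k] unfolding P_def by auto
    then show "conj_part nu k = (if k \<in> P \<union> (raised nu mu - P) then Suc (m k) else m k)"
      using r[OF k] c[OF k] by auto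
  qed (rule nu)
  show "raised nu mu - P \<subseteq> Z (part nu 1)"
  proof
    fix k assume k: "k \<in> raised nu mu - P"
    then have k1: "k \<ge> 1" unfolding raised_def by auto
    then have "conj_part nu k = Suc (m k)" using r k by auto
    moreover have "l k \<noteq> Suc (m k)" using k k1 unfolding P_def by auto
    moreover have "k \<le> part nu 1" using raised_subset[OF nu order.refl, of mu] k by auto
    ultimately show "k \<in> Z (part nu 1)" using c[OF k1] k1 unfolding Z_def by auto
  qed
qed

lemma down_pred_if_strips:
  assumes kap: "is_partition kap" and h: "horizontal_strip mu kap" "horizontal_strip lam kap"
  shows "down_pred kap (raised mu kap - M)" "raised mu kap - M \<subseteq> Z N0"
proof -
  have c: "conj_part kap k \<le> m k" "m k \<le> Suc (conj_part kap k)" "conj_part kap k \<le> l k" "l k \<le> Suc (conj_part kap k)" if "k \<ge> 1" for k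
    using h that unfolding horizontal_strip_iff[OF mu kap] horizontal_strip_iff[OF lam kap] m_def l_def by auto
  have r: "k \<in> raised mu kap \<longleftrightarrow> m k = Suc (conj_part kap k)" if "k \<ge> 1" for k
    using c[OF that] that unfolding raised_def m_def by auto
  show "down_pred kap (raised mu kap - M)"
    unfolding down_pred_def
  proof (intro conjI allI impI)
    fix k :: nat assume k: "k \<ge> 1"
    have "k \<in> M \<Longrightarrow> m k = Suc (conj_part kap k)" using c[OF k] unfolding M_def by auto
    then show "m k = (if k \<in> M \<union> (raised mu kap - M) then Suc (conj_part kap k) else conj_part kap k)"
      using r[OF k] c[OF k] by auto
  qed (rule kap)
  show "raised mu kap - M \<subseteq> Z N0"
  proof
    fix k assume k: "k \<in> raised mu kap - M"
    then have k1: "k \<ge> 1" unfolding raised_def by auto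
    then have "m k = Suc (conj_part kap k)" using r k by auto
    moreover have "m k \<noteq> Suc (l k)" using k k1 unfolding M_def by auto
    moreover have "k \<le> N0" using raised_subset[OF mu mu_N0, of kap] k by auto
    ultimately show "k \<in> Z N0" using c[OF k1] k1 unfolding Z_def by auto
  qed
qed

lemma sum_of_raised:
  fixes N :: nat
  assumes "A \<subseteq> {1..N}" and "\<And>k. k \<in> {1..N} \<Longrightarrow> f k = (if k \<in> A then Suc (g k) else g k)"
  shows "(\<Sum>k\<in>{1..N}. f k) = (\<Sum>k\<in>{1..N}. g k) + card A"
proof -
  have "(\<Sum>k\<in>{1..N}. f k) = (\<Sum>k\<in>{1..N}. g k + (if k \<in> A then 1 else 0))"
    by (rule sum.cong) (use assms(2) in auto)
  also have "\<dots> = (\<Sum>k\<in>{1..N}. g k) + card ({1..N} \<inter> A)" by (simp add: sum.distrib sum.If_cases)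
  also have "{1..N} \<inter> A = A" using assms by auto
  finally show ?thesis .
qed

lemma up_pred_part:
  assumes "up_pred nu S" "S \<subseteq> {1..N}" "N0 \<le> N"
  shows "part nu 1 \<le> N"
proof (rule part_le_of_conj_part_eq_0)
  show "is_partition nu" using assms unfolding up_pred_def by blast
  have "Suc N \<notin> P \<union> S" using assms P_subset by auto
  then show "conj_part nu (Suc N) = 0" using assms m_zero[of "Suc N"] unfolding up_pred_def by simp
qed

lemma up_pred_size:
  assumes "up_pred nu S" "S \<subseteq> Z N"
  shows "sum_list nu = sum_list mu + card P + card S"
proof -
  define N' where "N' = max N N0"
  have S: "S \<subseteq> {1..N'}" using assms Z_subset[of N] unfolding N'_def by fastforce
  have P: "P \<subseteq> {1..N'}" using P_subset unfolding N'_def by fastforce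
  have disj: "P \<inter> S = {}" using assms(2) disjoint by blast
  have nu: "is_partition nu" using assms unfolding up_pred_def by blast
  have "sum_list nu = (\<Sum>k\<in>{1..N'}. conj_part nu k)"
    by (rule sum_list_eq_sum_conj_part[OF nu up_pred_part[OF assms(1) S]]) (simp add: N'_def)
  also have "\<dots> = (\<Sum>k\<in>{1..N'}. m k) + card (P \<union> S)"
    by (rule sum_of_raised) (use assms S P in \<open>auto simp: up_pred_def\<close>)
  also have "(\<Sum>k\<in>{1..N'}. m k) = sum_list mu"
    unfolding m_def by (rule sum_list_eq_sum_conj_part[OF mu, symmetric]) (use mu_N0 in \<open>simp add: N'_def\<close>)
  also have "card (P \<union> S) = card P + card S"
    using card_Un_disjoint[OF finite_P finite_subset[OF assms(2) finite_Z] disj] .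
  finally show ?thesis by simp
qed

lemma down_pred_size:
  assumes "down_pred kap S" "S \<subseteq> Z N0"
  shows "sum_list mu = sum_list kap + card M + card S"
proof -
  have S: "S \<subseteq> {1..N0}" using assms Z_subset[of N0] by auto
  have disj: "M \<inter> S = {}" using assms(2) disjoint by blast
  have kap: "is_partition kap" using assms unfolding down_pred_def by blast
  have "conj_part kap (Suc N0) = 0" using assms m_zero[of "Suc N0"] unfolding down_pred_def by (auto split: if_splits)
  then have "part kap 1 \<le> N0" by (rule part_le_of_conj_part_eq_0[OF kap])
  then have "(\<Sum>k\<in>{1..N0}. conj_part kap k) = sum_list kap"
    by (rule sum_list_eq_sum_conj_part[OF kap, symmetric])
  moreover have "sum_list mu = (\<Sum>k\<in>{1..N0}. m k)"
    unfolding m_def by (rule sum_list_eq_sum_conj_part[OF mu mu_N0])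
  moreover have "(\<Sum>k\<in>{1..N0}. m k) = (\<Sum>k\<in>{1..N0}. conj_part kap k) + card (M \<union> S)"
    by (rule sum_of_raised) (use assms S M_subset in \<open>auto simp: down_pred_def\<close>)
  moreover have "card (M \<union> S) = card M + card S"
    using card_Un_disjoint[OF finite_M finite_subset[OF assms(2) finite_Z] disj] .
  ultimately show ?thesis by simp
qed

text \<open>Both sides are the size of the columnwise maximum of the two diagrams.\<close>

lemma lam_size: "sum_list lam + card M = sum_list mu + card P"
proof -
  have "(\<Sum>k\<in>{1..N0}. max (l k) (m k)) = (\<Sum>k\<in>{1..N0}. m k) + card P"
  proof (rule sum_of_raised[OF P_subset])
    fix k assume "k \<in> {1..N0}"
    then show "max (l k) (m k) = (if k \<in> P then Suc (m k) else m k)"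
      using trichotomy[of k] by (auto simp: P_def M_def)
  qed
  moreover have "(\<Sum>k\<in>{1..N0}. max (l k) (m k)) = (\<Sum>k\<in>{1..N0}. l k) + card M"
  proof (rule sum_of_raised[OF M_subset])
    fix k assume "k \<in> {1..N0}"
    then show "max (l k) (m k) = (if k \<in> M then Suc (l k) else l k)"
      using trichotomy[of k] by (auto simp: P_def M_def)
  qed
  moreover have "sum_list mu = (\<Sum>k\<in>{1..N0}. m k)" "sum_list lam = (\<Sum>k\<in>{1..N0}. l k)"
    unfolding m_def l_def by (rule sum_list_eq_sum_conj_part[OF mu mu_N0] sum_list_eq_sum_conj_part[OF lam lam_N0])+
  ultimately show ?thesis by simp
qed

text \<open>The union of the two diagrams has size \<open>sum_list mu + card P\<close>, so
  \<open>r\<close> counts the boxes added beyond it, that is the size of \<open>S\<close>.\<close>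

definition up_set :: "nat \<Rightarrow> nat list set" where
  "up_set r = {nu. is_partition nu \<and> horizontal_strip nu mu \<and> horizontal_strip nu lam \<and>
     sum_list nu = sum_list mu + card P + r}"

definition down_set :: "nat \<Rightarrow> nat list set" where
  "down_set s = {kap. is_partition kap \<and> horizontal_strip mu kap \<and> horizontal_strip lam kap \<and>
     sum_list mu = sum_list kap + card M + s}"

definition up_of :: "nat set \<Rightarrow> nat list" where
  "up_of S = (SOME nu. up_pred nu S)"

definition down_of :: "nat set \<Rightarrow> nat list" where
  "down_of S = (SOME kap. down_pred kap S)"

lemma up_of: "S \<subseteq> Z N \<Longrightarrow> valid_up S \<Longrightarrow> up_pred (up_of S) S"
  unfolding up_of_def using up_pred_exists by (metis someI_ex)

lemma down_of: "S \<subseteq> Z N \<Longrightarrow> valid_down S \<Longrightarrow> down_pred (down_of S) S"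
  unfolding down_of_def using down_pred_exists by (metis someI_ex)

text \<open>The bound on \<open>N\<close> comes from \<open>valid_up_bound\<close>: it puts every
  admissible set of size \<open>r\<close> inside \<open>Z N\<close>.\<close>

lemma up_set_sum:
  assumes N: "N0 + r \<le> N"
  shows "(\<Sum>nu\<in>up_set r. g nu) = (\<Sum>S | S \<subseteq> Z N \<and> card S = r \<and> valid_up S. g (up_of S))"
proof (rule sum.reindex_bij_witness[of _ up_of "\<lambda>nu. raised nu mu - P"])
  fix nu assume "nu \<in> up_set r"
  then have nu: "is_partition nu" "horizontal_strip nu mu" "horizontal_strip nu lam"
    "sum_list nu = sum_list mu + card P + r" unfolding up_set_def by auto
  note u = up_pred_if_strips[OF nu(1-3)]
  have card: "card (raised nu mu - P) = r" using up_pred_size[OF u] nu(4) by simp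
  have v: "valid_up (raised nu mu - P)" using valid_up_if_up_pred[OF u(1)] .
  have "raised nu mu - P \<subseteq> {..N0 + r}" using valid_up_bound[OF u(2) v] card by simp
  then have sub: "raised nu mu - P \<subseteq> Z N" using u(2) N unfolding Z_def by auto
  show "raised nu mu - P \<in> {S. S \<subseteq> Z N \<and> card S = r \<and> valid_up S}" using sub card v by blast
  show e: "up_of (raised nu mu - P) = nu" using up_pred_unique[OF up_of[OF sub v] u(1)] .
  show "g (up_of (raised nu mu - P)) = g nu" unfolding e ..
next
  fix S assume S: "S \<in> {S. S \<subseteq> Z N \<and> card S = r \<and> valid_up S}"
  then have u: "up_pred (up_of S) S" using up_of by blast
  note D = up_predD[OF u, of N]
  have "P \<inter> S = {}" using S disjoint by blast
  then show "raised (up_of S) mu - P = S" using D S by auto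
  show "up_of S \<in> up_set r" using D S up_pred_size[OF u, of N] unfolding up_set_def by auto
qed

lemma down_set_sum:
  "(\<Sum>kap\<in>down_set s. g kap) = (\<Sum>S | S \<subseteq> Z N0 \<and> card S = s \<and> valid_down S. g (down_of S))"
proof (rule sum.reindex_bij_witness[of _ down_of "\<lambda>kap. raised mu kap - M"])
  fix kap assume "kap \<in> down_set s"
  then have kap: "is_partition kap" "horizontal_strip mu kap" "horizontal_strip lam kap"
    "sum_list mu = sum_list kap + card M + s" unfolding down_set_def by auto
  note u = down_pred_if_strips[OF kap(1-3)]
  have card: "card (raised mu kap - M) = s" using down_pred_size[OF u] kap(4) by simp
  have v: "valid_down (raised mu kap - M)" using valid_down_if_down_pred[OF u(1)] .
  show "raised mu kap - M \<in> {S. S \<subseteq> Z N0 \<and> card S = s \<and> valid_down S}" using u card v by blast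
  show e: "down_of (raised mu kap - M) = kap" using down_pred_unique[OF down_of[OF u(2) v] u(1)] .
  show "g (down_of (raised mu kap - M)) = g kap" unfolding e ..
next
  fix S assume S: "S \<in> {S. S \<subseteq> Z N0 \<and> card S = s \<and> valid_down S}"
  then have u: "down_pred (down_of S) S" using down_of by blast
  note D = down_predD[OF u, of N0]
  have "M \<inter> S = {}" using S disjoint by blast
  then show "raised mu (down_of S) - M = S" using D S by auto
  show "down_of S \<in> down_set s" using D S down_pred_size[OF u] unfolding down_set_def by auto
qed

end

section \<open>Limits as the number of columns grows\<close>

lemma generic_parameters_ratfun: "generic_parameters q_var t_var"
  by unfold_locales (rule q_var_nonzero t_var_nonzero one_minus_monomial_nonzero; assumption)+

lemma q_adic_limit_q_power_shift: "q_adic_limit (\<lambda>N. q_var ^ (N - u)) 0"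
  by (rule q_adic_limit_shift[OF q_adic_limit_q_power])

lemma pair_factor_limit:
  assumes "q_adic_limit x 0"
  shows "q_adic_limit (\<lambda>N. pair_factor q_var t_var (x N)) 1"
proof -
  have "q_adic_limit (\<lambda>N. (1 - q_var * x N) * (1 - t_var / q_var * x N) / ((1 - x N) * (1 - t_var * x N)))
      ((1 - q_var * 0) * (1 - t_var / q_var * 0) / ((1 - 0) * (1 - t_var * 0)))"
    by (intro q_adic_limit_divide q_adic_limit_mult q_adic_limit_diff q_adic_limit_const
        q_adic_limit_cmult assms) simp
  then show ?thesis unfolding pair_factor_def by simp
qed

lemma pair_factor_q_power:
  assumes "a > 0"
  shows "pair_factor q_var t_var (q_var ^ a) =
    (1 - q_var ^ Suc a) * (1 - t_var * q_var ^ (a - 1)) / ((1 - q_var ^ a) * (1 - t_var * q_var ^ a))"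
proof -
  have "t_var * q_var ^ a / q_var = t_var * q_var ^ (a - 1)"
    using assms q_var_nonzero by (cases a) auto
  then show ?thesis unfolding pair_factor_def by simp
qed

lemma one_minus_t_q_nonzero: "1 - t_var * q_var ^ a \<noteq> 0"
  using one_minus_monomial_nonzero[of a 1] by (simp add: mult.commute)

text \<open>At \<open>q ^ a\<close> the pair factor is a quotient of consecutive values of
  \<open>1 - q ^ a\<close> and of \<open>1 - t * q ^ a\<close>.\<close>

lemma pair_factor_telescope:
  assumes "p > 0"
  shows "(\<Prod>i<L. pair_factor q_var t_var (q_var ^ (p + i))) =
    (1 - q_var ^ (p + L)) * (1 - t_var * q_var ^ (p - 1)) / ((1 - q_var ^ p) * (1 - t_var * q_var ^ (p + L - 1)))"
proof (induction L)
  case 0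
  then show ?case using one_minus_q_power_nonzero[OF assms] one_minus_t_q_nonzero by simp
next
  case (Suc L)
  have idx: "p + Suc L = Suc (p + L)" "Suc (p + L) - 1 = p + L" "0 < p + L" using assms by auto
  have "a * b / (c * d) * (e * d / (a * g)) = e * b / (c * g)" if "a \<noteq> 0" "d \<noteq> 0" for a b c d e g :: ratfun
    using that by simp
  from this[OF one_minus_q_power_nonzero[OF idx(3)] one_minus_t_q_nonzero[of "p + L - 1"]]
  show ?case unfolding prod.lessThan_Suc Suc pair_factor_q_power[OF idx(3)] idx(1,2) .
qed

lemma pair_factor_telescope_limit:
  assumes "p > 0"
  shows "q_adic_limit (\<lambda>N. \<Prod>i<N - c. pair_factor q_var t_var (q_var ^ (p + i)))
    ((1 - t_var * q_var ^ (p - 1)) / (1 - q_var ^ p))"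
proof -
  have e: "(\<lambda>N. \<Prod>i<N - c. pair_factor q_var t_var (q_var ^ (p + i))) =
    (\<lambda>N. (1 - q_var ^ p * q_var ^ (N - c)) * (1 - t_var * q_var ^ (p - 1)) /
      ((1 - q_var ^ p) * (1 - t_var * q_var ^ (p - 1) * q_var ^ (N - c))))"
  proof
    fix N
    have "p + (N - c) - 1 = p - 1 + (N - c)" using assms by simp
    then show "(\<Prod>i<N - c. pair_factor q_var t_var (q_var ^ (p + i))) =
      (1 - q_var ^ p * q_var ^ (N - c)) * (1 - t_var * q_var ^ (p - 1)) /
      ((1 - q_var ^ p) * (1 - t_var * q_var ^ (p - 1) * q_var ^ (N - c)))"
      unfolding pair_factor_telescope[OF assms] by (simp add: power_add mult.assoc)
  qed
  have "q_adic_limit (\<lambda>N. (1 - q_var ^ p * q_var ^ (N - c)) * (1 - t_var * q_var ^ (p - 1)) /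
      ((1 - q_var ^ p) * (1 - t_var * q_var ^ (p - 1) * q_var ^ (N - c))))
     ((1 - q_var ^ p * 0) * (1 - t_var * q_var ^ (p - 1)) / ((1 - q_var ^ p) * (1 - t_var * q_var ^ (p - 1) * 0)))"
    using one_minus_q_power_nonzero[OF assms]
    by (intro q_adic_limit_divide q_adic_limit_mult q_adic_limit_diff q_adic_limit_const
        q_adic_limit_cmult q_adic_limit_q_power_shift) auto
  then show ?thesis unfolding e by simp
qed

text \<open>Read backwards, the factors are the telescoping limits above with
  \<open>p = s - u\<close>.\<close>

lemma ratio_coeff_prod: "ratio_coeff s = (\<Prod>u<s. (1 - t_var * q_var ^ (s - u - 1)) / (1 - q_var ^ (s - u)))"
proof (induction s)
  case (Suc s)
  show ?case unfolding prod.lessThan_Suc_shift using Suc by simp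
qed simp

locale ratfun_partitions = two_partitions q_var t_var lam mu N0 for lam mu N0
begin

lemma tail_limit: "q_adic_limit (\<lambda>N. tail N x) 1"
proof -
  have "q_adic_limit (\<lambda>N. (1 - t_var * x * q_var ^ N) / (1 - q_var * x * q_var ^ N)) ((1 - t_var * x * 0) / (1 - q_var * x * 0))"
    by (intro q_adic_limit_divide q_adic_limit_diff q_adic_limit_const q_adic_limit_cmult q_adic_limit_q_power) simp
  then show ?thesis unfolding tail_def by (simp add: mult_ac)
qed

lemma tail_nonzero:
  assumes "j \<le> N"
  shows "tail N (node f j) \<noteq> 0"
proof -
  have "q_var ^ N = q_var ^ (N - j) * q_var ^ j" using assms by (simp flip: power_add)
  then have e: "t_var * q_var ^ N * node f j = q_var ^ (N - j) * t_var ^ Suc (f j)"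
    "q_var ^ Suc N * node f j = q_var ^ Suc (N - j) * t_var ^ f j"
    using q_var_nonzero by (auto simp: node_def)
  show ?thesis unfolding tail_def e
    using one_minus_monomial_nonzero[of "N - j" "Suc (f j)"] one_minus_monomial_nonzero[of "Suc (N - j)" "f j"]
    by simp
qed

text \<open>The boundary terms are left out: they are not part of the finite identity and tend to
  1.\<close>

definition up_weight :: "nat \<Rightarrow> nat set \<Rightarrow> ratfun" where
  "up_weight N S = pair_prod N outer_factor * subset_weight (\<lambda>i k. F (y i / y k)) (Z N) S"

definition down_weight :: "nat \<Rightarrow> nat set \<Rightarrow> ratfun" where
  "down_weight N S = pair_prod N outer_factor * subset_weight (\<lambda>i k. F (y k / y i)) (Z N) S"

lemma Z_mono: "N \<le> N' \<Longrightarrow> Z N \<subseteq> Z N'"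
  unfolding Z_def by auto

lemma generic_nodes_Z: "generic_nodes t_var y (Z N)"
  unfolding generic_nodes_def
proof (intro conjI ballI impI)
  show "y i \<noteq> 0" for i by (rule y_nonzero)
  \<comment> \<open>Nodes of distinct columns contain distinct powers of \<open>q\<close>, so no
    power of \<open>t\<close> relates them.\<close>
  have ne: "y i \<noteq> t_var ^ e * y k" if "i \<noteq> k" for i k e
  proof
    assume "y i = t_var ^ e * y k"
    then have "q_var ^ k * t_var ^ m i = q_var ^ i * t_var ^ (e + m k)"
      using q_var_nonzero unfolding y_def node_def by (simp add: field_simps power_add)
    then show False using q_t_independent that by blast
  qed
  fix i k :: nat assume "i \<noteq> k"
  then show "y i \<noteq> y k" "y i \<noteq> t_var * y k" "y i \<noteq> t_var\<^sup>2 * y k"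
    using ne[of i k 0] ne[of i k 1] ne[of i k 2] by auto
qed

lemma weight_sums_eq:
  "(\<Sum>S | S \<subseteq> Z N \<and> card S = r. up_weight N S) = (\<Sum>S | S \<subseteq> Z N \<and> card S = r. down_weight N S)"
proof -
  define h where "h = (\<lambda>k. if k = r then 1 else 0 :: ratfun)"
  have s: "(\<Sum>S | S \<subseteq> Z N \<and> card S = r. subset_weight f (Z N) S) = subset_sum f (Z N) h" for f
    unfolding subset_sum_def h_def
    by (rule sum.mono_neutral_cong_left) (auto simp: finite_Z)
  have t: "t_var \<noteq> 1" "t_var ^ 2 \<noteq> 1"
    using one_minus_monomial_nonzero[of 0 1] one_minus_monomial_nonzero[of 0 2] by auto
  show ?thesis unfolding up_weight_def down_weight_def sum_distrib_left[symmetric] s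
    using subset_sum_reverse[OF finite_Z generic_nodes_Z q_var_nonzero t_var_nonzero t] by metis
qed

lemma up_weight_eq:
  assumes nu: "up_pred nu S" and S: "S \<subseteq> Z N" and N: "N0 \<le> N"
  shows "up_weight N S = phi q_var t_var nu mu * psi q_var t_var nu lam / (\<Prod>j\<in>P \<union> S. tail N (y j))"
proof -
  have p: "part nu 1 \<le> N" using up_pred_part[OF nu _ N] S Z_subset by blast
  have "(\<Prod>j\<in>P \<union> S. tail N (y j)) \<noteq> 0"
  proof -
    have "j \<le> N" if "j \<in> P \<union> S" for j using that P_subset S Z_subset[of N] N by fastforce
    then show ?thesis using tail_nonzero finite_P finite_subset[OF S finite_Z] unfolding y_def by auto
  qed
  then show ?thesis unfolding phi_psi_up[OF nu S p] up_weight_def by simp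
qed

lemma down_weight_eq:
  assumes kap: "down_pred kap S" and S: "S \<subseteq> Z N" and N: "N0 \<le> N"
  shows "down_weight N S = phi q_var t_var lam kap * psi q_var t_var mu kap / (\<Prod>j\<in>P \<union> S. tail N (node (conj_part kap) j))"
proof -
  have "(\<Prod>j\<in>P \<union> S. tail N (node (conj_part kap) j)) \<noteq> 0"
  proof -
    have "j \<le> N" if "j \<in> P \<union> S" for j using that P_subset S Z_subset[of N] N by fastforce
    then show ?thesis using tail_nonzero finite_P finite_subset[OF S finite_Z] by auto
  qed
  then show ?thesis unfolding phi_psi_down[OF kap S N] down_weight_def by simp
qed

text \<open>From \<open>N0 + r\<close> on the contributing sets no longer change with
  \<open>N\<close>; only the boundary terms vary.\<close>

lemma up_limit:
  "q_adic_limit (\<lambda>N. \<Sum>S | S \<subseteq> Z N \<and> card S = r. up_weight N S)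
    (\<Sum>nu\<in>up_set r. phi q_var t_var nu mu * psi q_var t_var nu lam)"
proof -
  define V where "V = {S. S \<subseteq> Z (N0 + r) \<and> card S = r \<and> valid_up S}"
  let ?w = "\<lambda>S. phi q_var t_var (up_of S) mu * psi q_var t_var (up_of S) lam"
  have "q_adic_limit (\<lambda>N. \<Sum>S\<in>V. ?w S / (\<Prod>j\<in>P \<union> S. tail N (y j))) (\<Sum>S\<in>V. ?w S / (\<Prod>j\<in>P \<union> S. 1))"
    by (intro q_adic_limit_sum q_adic_limit_divide q_adic_limit_prod q_adic_limit_const tail_limit) simp
  moreover have "(\<Sum>S\<in>V. ?w S / (\<Prod>j\<in>P \<union> S. 1)) = (\<Sum>nu\<in>up_set r. phi q_var t_var nu mu * psi q_var t_var nu lam)"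
    unfolding up_set_sum[OF order.refl] V_def by simp
  moreover have "\<forall>\<^sub>F N in sequentially. (\<Sum>S\<in>V. ?w S / (\<Prod>j\<in>P \<union> S. tail N (y j))) =
      (\<Sum>S | S \<subseteq> Z N \<and> card S = r. up_weight N S)"
    using eventually_ge_at_top[of "N0 + r"]
  proof eventually_elim
    case (elim N)
    have V: "S \<subseteq> Z N" if "S \<in> V" for S using that Z_mono[OF elim] unfolding V_def by blast
    have "(\<Sum>S\<in>V. ?w S / (\<Prod>j\<in>P \<union> S. tail N (y j))) = (\<Sum>S\<in>V. up_weight N S)"
    proof (rule sum.cong[OF refl])
      fix S assume S: "S \<in> V"
      have "up_pred (up_of S) S" by (rule up_of[of S "N0 + r"]) (use S in \<open>auto simp: V_def\<close>)
      then show "?w S / (\<Prod>j\<in>P \<union> S. tail N (y j)) = up_weight N S"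
        using up_weight_eq[OF _ V[OF S]] elim by simp
    qed
    also have "\<dots> = (\<Sum>S | S \<subseteq> Z N \<and> card S = r. up_weight N S)"
    proof (rule sum.mono_neutral_left)
      show "finite {S. S \<subseteq> Z N \<and> card S = r}" using finite_Z by auto
      show "V \<subseteq> {S. S \<subseteq> Z N \<and> card S = r}" using V unfolding V_def by blast
      show "\<forall>S\<in>{S. S \<subseteq> Z N \<and> card S = r} - V. up_weight N S = 0"
      proof
        fix S assume S: "S \<in> {S. S \<subseteq> Z N \<and> card S = r} - V"
        have "\<not> valid_up S"
        proof
          assume v: "valid_up S"
          then have "S \<subseteq> {..N0 + r}" using valid_up_bound[of S N] S by auto
          then have "S \<subseteq> Z (N0 + r)" using S unfolding Z_def by auto
          then show False using S v unfolding V_def by auto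
        qed
        then show "up_weight N S = 0" using S invalid_up_weight[of S N] unfolding up_weight_def by auto
      qed
    qed
    finally show ?case .
  qed
  ultimately show ?thesis using q_adic_limit_eventually_eq by simp
qed

section \<open>Lowered columns that move off to infinity\<close>

lemma pair_prod_outer_split:
  assumes "N0 \<le> N'" "N' \<le> N"
  shows "pair_prod N outer_factor = pair_prod N' outer_factor * (\<Prod>b\<in>{N'<..N}. \<Prod>a\<in>P. F (y a / y b))"
  using assms(2)
proof (induction N rule: dec_induct)
  case (step N)
  have "{N'<..Suc N} = insert (Suc N) {N'<..N}" using step by auto
  moreover have "(\<Prod>a\<in>{1..N}. outer_factor a (Suc N)) = (\<Prod>a\<in>P. F (y a / y (Suc N)))"
  proof (rule prod.mono_neutral_cong_right)
    show "P \<subseteq> {1..N}" using P_subset assms step by auto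
    have n: "Suc N \<notin> P" "Suc N \<notin> M" using P_subset M_subset assms step by auto
    show "\<forall>i\<in>{1..N} - P. outer_factor i (Suc N) = 1" using n by (auto simp: outer_factor_def)
    show "outer_factor x (Suc N) = F (y x / y (Suc N))" if "x \<in> P" for x
      using n that by (auto simp: outer_factor_def)
  qed simp
  ultimately show ?case unfolding pair_prod_Suc step.IH by (simp add: mult_ac)
qed simp

lemma Z_split:
  assumes "N0 \<le> N"
  shows "Z N = Z N0 \<union> {N0<..N}"
  using assms l_zero m_zero unfolding Z_def by auto

lemma y_beyond: "k > N0 \<Longrightarrow> y k = 1 / q_var ^ k"
  unfolding y_def node_def using m_zero by simp

definition last_columns :: "nat \<Rightarrow> nat \<Rightarrow> nat set" where
  "last_columns N s = {N - s<..N}"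

lemma prod_last_columns:
  assumes "s \<le> N"
  shows "(\<Prod>b\<in>last_columns N s. g b) = (\<Prod>u<s. g (N - u))"
  unfolding last_columns_def
  by (rule prod.reindex_bij_witness[of _ "\<lambda>u. N - u" "\<lambda>b. N - b"]) (use assms in auto)

text \<open>A column \<open>k\<close> beyond \<open>N0\<close> has node \<open>1 / q ^ k\<close>.
  The chosen last columns meet the fixed columns in pair factors at multiples of high powers of
  \<open>q\<close>, and the unchosen empty ones in factors \<open>F (q ^ a)\<close>, which
  telescope.\<close>

lemma down_weight_factor:
  assumes S0: "S0 \<subseteq> Z N0" and N: "N0 + s \<le> N"
  shows "down_weight N (S0 \<union> last_columns N s) = down_weight (N - s) S0 *
    (\<Prod>u<s. (\<Prod>a\<in>P. F (y a * q_var ^ (N - u))) * ((\<Prod>k\<in>Z N0 - S0. F (y k * q_var ^ (N - u))) *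
      (\<Prod>i<N - (N0 + s). F (q_var ^ (s - u + i)))))"
proof -
  let ?E = "last_columns N s"
  have fin: "finite S0" using finite_subset[OF S0 finite_Z] .
  have E: "?E \<subseteq> {N0<..N}" "finite ?E" using N unfolding last_columns_def by auto
  have S0': "S0 \<subseteq> {1..N0}" using S0 Z_subset by blast
  have disj: "S0 \<inter> ?E = {}" using S0' E(1) by fastforce
  \<comment> \<open>All unchosen columns lie among the first \<open>N - s\<close>, so
    \<open>S0\<close> interacts as in the problem with \<open>N - s\<close> columns.\<close>
  have rest: "Z N - (S0 \<union> ?E) = Z (N - s) - S0"
    using N Z_split[of N] Z_split[of "N - s"] Z_subset[of N0] S0' unfolding last_columns_def by auto
  have restsplit: "Z (N - s) - S0 = (Z N0 - S0) \<union> {N0<..N - s}"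
    using N Z_split[of "N - s"] S0' by auto
  have w: "subset_weight (\<lambda>i k. F (y k / y i)) (Z N) (S0 \<union> ?E) =
      subset_weight (\<lambda>i k. F (y k / y i)) (Z (N - s)) S0 * (\<Prod>i\<in>?E. \<Prod>k\<in>Z (N - s) - S0. F (y k / y i))"
    unfolding subset_weight_def rest by (rule prod.union_disjoint[OF fin E(2) disj])
  have inner: "(\<Prod>k\<in>Z (N - s) - S0. F (y k / y (N - u))) =
      (\<Prod>k\<in>Z N0 - S0. F (y k * q_var ^ (N - u))) * (\<Prod>i<N - (N0 + s). F (q_var ^ (s - u + i)))" if u: "u < s" for u
  proof -
    have yb: "y (N - u) = 1 / q_var ^ (N - u)" using u N by (intro y_beyond) auto
    have "(\<Prod>k\<in>Z (N - s) - S0. F (y k / y (N - u))) =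
       (\<Prod>k\<in>Z N0 - S0. F (y k / y (N - u))) * (\<Prod>k\<in>{N0<..N - s}. F (y k / y (N - u)))"
      unfolding restsplit by (rule prod.union_disjoint) (use finite_Z Z_subset[of N0] in auto)
    also have "(\<Prod>k\<in>Z N0 - S0. F (y k / y (N - u))) = (\<Prod>k\<in>Z N0 - S0. F (y k * q_var ^ (N - u)))"
      unfolding yb by simp
    also have "(\<Prod>k\<in>{N0<..N - s}. F (y k / y (N - u))) = (\<Prod>i<N - (N0 + s). F (q_var ^ (s - u + i)))"
    proof (rule prod.reindex_bij_witness[of _ "\<lambda>i. N - s - i" "\<lambda>k. N - s - k"])
      fix k assume k: "k \<in> {N0<..N - s}"
      have "y k = 1 / q_var ^ k" using k by (intro y_beyond) auto
      moreover have "q_var ^ (N - u) = q_var ^ k * q_var ^ (s - u + (N - s - k))"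
      proof -
        have "N - u = k + (s - u + (N - s - k))" using k u N by auto
        then show ?thesis by (simp only: power_add)
      qed
      ultimately show "F (q_var ^ (s - u + (N - s - k))) = F (y k / y (N - u))"
        unfolding yb using q_var_nonzero by simp
    qed (use N in auto)
    finally show ?thesis .
  qed
  have "(\<Prod>i\<in>?E. \<Prod>k\<in>Z (N - s) - S0. F (y k / y i)) = (\<Prod>u<s. (\<Prod>k\<in>Z N0 - S0. F (y k * q_var ^ (N - u))) *
      (\<Prod>i<N - (N0 + s). F (q_var ^ (s - u + i))))"
  proof -
    have "s \<le> N" using N by simp
    then show ?thesis unfolding prod_last_columns[OF \<open>s \<le> N\<close>]
      by (intro prod.cong refl) (use inner in auto)
  qed
  moreover have "(\<Prod>b\<in>{N - s<..N}. \<Prod>a\<in>P. F (y a / y b)) = (\<Prod>u<s. \<Prod>a\<in>P. F (y a * q_var ^ (N - u)))"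
  proof -
    have "(\<Prod>b\<in>{N - s<..N}. \<Prod>a\<in>P. F (y a / y b)) = (\<Prod>u<s. \<Prod>a\<in>P. F (y a / y (N - u)))"
      using prod_last_columns[of s N] N unfolding last_columns_def by simp
    also have "\<dots> = (\<Prod>u<s. \<Prod>a\<in>P. F (y a * q_var ^ (N - u)))"
    proof (rule prod.cong[OF refl])
      fix u assume "u \<in> {..<s}"
      then have "y (N - u) = 1 / q_var ^ (N - u)" using N by (intro y_beyond) auto
      then show "(\<Prod>a\<in>P. F (y a / y (N - u))) = (\<Prod>a\<in>P. F (y a * q_var ^ (N - u)))" by simp
    qed
    finally show ?thesis .
  qed
  ultimately show ?thesis unfolding down_weight_def w
    using pair_prod_outer_split[of "N - s" N] N by (simp add: prod.distrib mult_ac)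
qed

lemma down_weight_limit:
  assumes S0: "S0 \<subseteq> Z N0"
  shows "q_adic_limit (\<lambda>N. down_weight N S0)
    (if valid_down S0 then phi q_var t_var lam (down_of S0) * psi q_var t_var mu (down_of S0) else 0)"
proof (cases "valid_down S0")
  case True
  define kap where "kap = down_of S0"
  have kap: "down_pred kap S0" unfolding kap_def by (rule down_of[OF S0 True])
  have "q_adic_limit (\<lambda>N. phi q_var t_var lam kap * psi q_var t_var mu kap / (\<Prod>j\<in>P \<union> S0. tail N (node (conj_part kap) j)))
      (phi q_var t_var lam kap * psi q_var t_var mu kap / (\<Prod>j\<in>P \<union> S0. 1))"
    by (intro q_adic_limit_divide q_adic_limit_prod q_adic_limit_const tail_limit) simp
  moreover have "\<forall>\<^sub>F N in sequentially. phi q_var t_var lam kap * psi q_var t_var mu kap / (\<Prod>j\<in>P \<union> S0. tail N (node (conj_part kap) j)) = down_weight N S0"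
    using eventually_ge_at_top[of N0]
    by eventually_elim (use down_weight_eq[OF kap] S0 Z_mono in \<open>metis subset_trans\<close>)
  ultimately show ?thesis using True q_adic_limit_eventually_eq unfolding kap_def by simp
next
  case False
  have "\<forall>\<^sub>F N in sequentially. 0 = down_weight N S0"
    \<comment> \<open>Strictly beyond \<open>N0\<close>, so that no column of \<open>S0\<close> is
      the last one.\<close>
    using eventually_gt_at_top[of N0]
  proof eventually_elim
    case (elim N)
    have "S0 \<subseteq> Z N" using S0 Z_mono[of N0 N] elim by auto
    moreover have "k < N" if "k \<in> S0" for k using that S0 Z_subset[of N0] elim by fastforce
    ultimately show ?case using invalid_down_weight[of S0 N] elim False unfolding down_weight_def by simp
  qed
  then show ?thesis using False q_adic_limit_eventually_eq[OF q_adic_limit_const[of 0]] by simp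
qed

text \<open>The interactions with fixed columns tend to 1; the telescoping products have limits
  whose product is \<open>ratio_coeff s\<close>.\<close>

lemma down_weight_last_limit:
  assumes S0: "S0 \<subseteq> Z N0"
  shows "q_adic_limit (\<lambda>N. down_weight N (S0 \<union> last_columns N s))
    ((if valid_down S0 then phi q_var t_var lam (down_of S0) * psi q_var t_var mu (down_of S0) else 0) * ratio_coeff s)"
proof -
  let ?L = "if valid_down S0 then phi q_var t_var lam (down_of S0) * psi q_var t_var mu (down_of S0) else 0"
  have F1: "q_adic_limit (\<lambda>N. F (c * q_var ^ (N - u))) 1" for c u
    using q_adic_limit_cmult[OF q_adic_limit_q_power_shift, of c u] by (intro pair_factor_limit) simp
  have "q_adic_limit (\<lambda>N. down_weight (N - s) S0 *
    (\<Prod>u<s. (\<Prod>a\<in>P. F (y a * q_var ^ (N - u))) * ((\<Prod>k\<in>Z N0 - S0. F (y k * q_var ^ (N - u))) *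
      (\<Prod>i<N - (N0 + s). F (q_var ^ (s - u + i))))))
    (?L * (\<Prod>u<s. (\<Prod>a\<in>P. 1) * ((\<Prod>k\<in>Z N0 - S0. 1) * ((1 - t_var * q_var ^ (s - u - 1)) / (1 - q_var ^ (s - u))))))"
    by (intro q_adic_limit_mult q_adic_limit_shift[OF down_weight_limit[OF S0]] q_adic_limit_prod F1
        pair_factor_telescope_limit) simp
  then have "q_adic_limit (\<lambda>N. down_weight (N - s) S0 *
    (\<Prod>u<s. (\<Prod>a\<in>P. F (y a * q_var ^ (N - u))) * ((\<Prod>k\<in>Z N0 - S0. F (y k * q_var ^ (N - u))) *
      (\<Prod>i<N - (N0 + s). F (q_var ^ (s - u + i)))))) (?L * ratio_coeff s)"
    unfolding ratio_coeff_prod by simp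
  moreover have "\<forall>\<^sub>F N in sequentially. down_weight (N - s) S0 *
    (\<Prod>u<s. (\<Prod>a\<in>P. F (y a * q_var ^ (N - u))) * ((\<Prod>k\<in>Z N0 - S0. F (y k * q_var ^ (N - u))) *
      (\<Prod>i<N - (N0 + s). F (q_var ^ (s - u + i))))) = down_weight N (S0 \<union> last_columns N s)"
    using eventually_ge_at_top[of "N0 + s"] by eventually_elim (rule down_weight_factor[OF S0, symmetric])
  ultimately show ?thesis by (rule q_adic_limit_eventually_eq)
qed

text \<open>Two neighbouring empty columns have nodes in ratio \<open>1 / q\<close>. Beyond
  \<open>N0\<close> a contributing set is therefore closed under successors up to
  \<open>N\<close>.\<close>

lemma down_weight_zero:
  assumes S: "S \<subseteq> Z N" and i: "i \<in> S" "Suc i \<notin> S" "N0 < i" "i < N"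
  shows "down_weight N S = 0"
proof -
  have "Suc i \<in> Z N - S" using i l_zero m_zero unfolding Z_def by auto
  moreover have "F (y (Suc i) / y i) = 0" using y_Suc[of i] m_zero i F_inverse_q by simp
  ultimately show ?thesis unfolding down_weight_def subset_weight_def
    using i finite_Z finite_subset[OF S finite_Z] by (auto intro!: prod_zero)
qed

text \<open>A summand vanishes unless the columns of \<open>S\<close> beyond \<open>N0\<close> are the last ones.\<close>
lemma down_sum_split:
  assumes N: "N0 + r \<le> N"
  shows "(\<Sum>S | S \<subseteq> Z N \<and> card S = r. down_weight N S) =
    (\<Sum>s\<le>r. \<Sum>S0 | S0 \<subseteq> Z N0 \<and> card S0 = r - s. down_weight N (S0 \<union> last_columns N s))"
proof -
  define I where "I = (SIGMA s:{..r}. {S0. S0 \<subseteq> Z N0 \<and> card S0 = r - s})"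
  define f where "f = (\<lambda>(s, S0). S0 \<union> last_columns N s)"
  have finI: "finite {S0. S0 \<subseteq> Z N0 \<and> card S0 = r - s}" for s using finite_Z by auto
  have I: "S0 \<inter> last_columns N s = {}" "S0 = f (s, S0) \<inter> {..N0}" "s = card (f (s, S0) \<inter> {N0<..})"
    "finite S0" "card (last_columns N s) = s" "last_columns N s \<subseteq> Z N" "S0 \<subseteq> Z N"
    if "(s, S0) \<in> I" for s S0
  proof -
    have s: "s \<le> r" "S0 \<subseteq> {1..N0}" using that Z_subset[of N0] unfolding I_def by auto
    show c: "card (last_columns N s) = s" using s N unfolding last_columns_def by simp
    show "finite S0" using s finite_subset by blast
    show "S0 \<inter> last_columns N s = {}" "S0 = f (s, S0) \<inter> {..N0}"
      using s N unfolding f_def last_columns_def by auto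
    have "f (s, S0) \<inter> {N0<..} = last_columns N s" using s N unfolding f_def last_columns_def by auto
    then show "s = card (f (s, S0) \<inter> {N0<..})" using c by simp
    show "last_columns N s \<subseteq> Z N" using s N Z_split[of N] unfolding last_columns_def by auto
    show "S0 \<subseteq> Z N" using that Z_mono[of N0 N] N unfolding I_def by auto
  qed
  have inj: "inj_on f I"
  proof (rule inj_onI)
    fix a b assume ab: "a \<in> I" "b \<in> I" "f a = f b"
    obtain s S0 s' S0' where e: "a = (s, S0)" "b = (s', S0')" by (cases a, cases b)
    have "S0 = S0'" using I(2)[of s S0] I(2)[of s' S0'] ab unfolding e by metis
    moreover have "s = s'" using I(3)[of s S0] I(3)[of s' S0'] ab unfolding e by metis
    ultimately show "a = b" unfolding e by simp
  qed
  have "(\<Sum>s\<le>r. \<Sum>S0 | S0 \<subseteq> Z N0 \<and> card S0 = r - s. down_weight N (S0 \<union> last_columns N s)) =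
      (\<Sum>x\<in>I. down_weight N (f x))"
    unfolding I_def f_def by (subst sum.Sigma) (use finI in \<open>auto simp: case_prod_unfold\<close>)
  also have "\<dots> = (\<Sum>S\<in>f ` I. down_weight N S)" by (simp add: sum.reindex[OF inj])
  also have "\<dots> = (\<Sum>S | S \<subseteq> Z N \<and> card S = r. down_weight N S)"
  proof (rule sum.mono_neutral_left)
    show "finite {S. S \<subseteq> Z N \<and> card S = r}" using finite_Z by auto
    show "f ` I \<subseteq> {S. S \<subseteq> Z N \<and> card S = r}"
    proof
      fix S assume "S \<in> f ` I"
      then obtain s S0 where e: "S = f (s, S0)" "(s, S0) \<in> I" by auto
      have "card S = card S0 + card (last_columns N s)" unfolding e f_def
        using I[OF e(2)] by (simp add: card_Un_disjoint last_columns_def)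
      also have "\<dots> = r" using I[OF e(2)] e(2) unfolding I_def by auto
      finally show "S \<in> {S. S \<subseteq> Z N \<and> card S = r}" using I[OF e(2)] unfolding e f_def by auto
    qed
    show "\<forall>S\<in>{S. S \<subseteq> Z N \<and> card S = r} - f ` I. down_weight N S = 0"
    proof
      fix S assume S: "S \<in> {S. S \<subseteq> Z N \<and> card S = r} - f ` I"
      define E where "E = S \<inter> {N0<..}"
      have Sfin: "finite S" using S finite_subset[OF _ finite_Z] by auto
      have SN: "S \<subseteq> {1..N}" using S Z_subset by blast
      \<comment> \<open>Otherwise the part of \<open>S\<close> beyond \<open>N0\<close> is closed
        under successors up to \<open>N\<close>, hence empty or a run ending at \<open>N\<close>,
        and \<open>S\<close> lies in the image of \<open>f\<close>.\<close>
      have "\<exists>i\<in>S. Suc i \<notin> S \<and> N0 < i \<and> i < N"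
      proof (rule ccontr)
        assume "\<not> ?thesis"
        then have closed: "\<And>i. i \<in> S \<Longrightarrow> N0 < i \<Longrightarrow> i < N \<Longrightarrow> Suc i \<in> S" by blast
        have up: "k \<in> E" if "i \<in> E" "i \<le> k" "k \<le> N" for i k
          using that(2,3)
        proof (induction k rule: dec_induct)
          case (step k)
          then show ?case using closed[of k] unfolding E_def by auto
        qed (rule that(1))
        have "E = last_columns N (card E)"
        proof (cases "E = {}")
          case False
          have fE: "finite E" using Sfin unfolding E_def by auto
          define i where "i = Min E"
          have i: "i \<in> E" "\<And>k. k \<in> E \<Longrightarrow> i \<le> k" unfolding i_def using fE False by auto
          have "E = {i..N}"
          proof
            show "E \<subseteq> {i..N}" using i(2) SN unfolding E_def by auto
            show "{i..N} \<subseteq> E" using up[OF i(1)] by auto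
          qed
          moreover have "1 \<le> i" "i \<le> N" using i(1) SN unfolding E_def by auto
          ultimately show ?thesis unfolding last_columns_def by (auto simp: Suc_le_eq)
        qed (simp add: last_columns_def)
        moreover have "S = (S \<inter> {..N0}) \<union> E" unfolding E_def by auto
        moreover have "S \<inter> {..N0} \<subseteq> Z N0" using S unfolding Z_def by auto
        moreover have "card S = card (S \<inter> {..N0}) + card E"
        proof -
          have "card ((S \<inter> {..N0}) \<union> E) = card (S \<inter> {..N0}) + card E"
            by (rule card_Un_disjoint) (use Sfin in \<open>auto simp: E_def\<close>)
          then show ?thesis using \<open>S = (S \<inter> {..N0}) \<union> E\<close> by simp
        qed
        ultimately have "(card E, S \<inter> {..N0}) \<in> I" "f (card E, S \<inter> {..N0}) = S"
          using S unfolding I_def f_def by auto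
        then show False using S by (metis DiffD2 image_eqI)
      qed
      then show "down_weight N S = 0" using down_weight_zero S by blast
    qed
  qed
  finally show ?thesis by simp
qed

text \<open>Of the \<open>r\<close> chosen columns, \<open>s\<close> move off to infinity and
  \<open>r - s\<close> stay near the diagrams, where they describe a partition
  \<open>kap\<close>.\<close>

lemma down_limit:
  "q_adic_limit (\<lambda>N. \<Sum>S | S \<subseteq> Z N \<and> card S = r. down_weight N S)
    (\<Sum>s\<le>r. (\<Sum>kap\<in>down_set (r - s). phi q_var t_var lam kap * psi q_var t_var mu kap) * ratio_coeff s)"
proof -
  let ?w = "\<lambda>S. phi q_var t_var lam (down_of S) * psi q_var t_var mu (down_of S)"
  have "q_adic_limit (\<lambda>N. \<Sum>s\<le>r. \<Sum>S0 | S0 \<subseteq> Z N0 \<and> card S0 = r - s. down_weight N (S0 \<union> last_columns N s))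
     (\<Sum>s\<le>r. \<Sum>S0 | S0 \<subseteq> Z N0 \<and> card S0 = r - s. (if valid_down S0 then ?w S0 else 0) * ratio_coeff s)"
    by (intro q_adic_limit_sum down_weight_last_limit) auto
  moreover have "(\<Sum>S0 | S0 \<subseteq> Z N0 \<and> card S0 = r - s. (if valid_down S0 then ?w S0 else 0) * ratio_coeff s) =
      (\<Sum>kap\<in>down_set (r - s). phi q_var t_var lam kap * psi q_var t_var mu kap) * ratio_coeff s" for s
    unfolding down_set_sum sum_distrib_right
    by (rule sum.mono_neutral_cong_right) (auto simp: finite_Z)
  moreover have "\<forall>\<^sub>F N in sequentially. (\<Sum>s\<le>r. \<Sum>S0 | S0 \<subseteq> Z N0 \<and> card S0 = r - s. down_weight N (S0 \<union> last_columns N s)) =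
     (\<Sum>S | S \<subseteq> Z N \<and> card S = r. down_weight N S)"
    using eventually_ge_at_top[of "N0 + r"] by eventually_elim (simp add: down_sum_split)
  ultimately show ?thesis using q_adic_limit_eventually_eq by simp
qed

text \<open>By the finite identity both sides are limits of the same sequence.\<close>

lemma commutation:
  "(\<Sum>nu\<in>up_set r. phi q_var t_var nu mu * psi q_var t_var nu lam) =
   (\<Sum>s\<le>r. (\<Sum>kap\<in>down_set (r - s). phi q_var t_var lam kap * psi q_var t_var mu kap) * ratio_coeff s)"
  using q_adic_limit_unique[OF up_limit[of r]] down_limit[of r] unfolding weight_sums_eq by blast

end

section \<open>Column-finite matrices of power series\<close>

text \<open>Cumulative in the exponent, because a coefficient of a product involves all lower
  coefficients of its factors.\<close>

definition column_support :: "('i \<Rightarrow> 'i \<Rightarrow> 'a::zero fps) \<Rightarrow> 'i \<Rightarrow> nat \<Rightarrow> 'i set" where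
  "column_support A z n = {y. \<exists>k\<le>n. fps_nth (A y z) k \<noteq> 0}"

text \<open>
  Infinite matrices with power series entries whose columns have finitely many nonzero entries
  modulo each power of the variable, so that products are defined and associative.
\<close>
typedef (overloaded) ('i, 'a::comm_ring_1) colfin =
  "{A :: 'i \<Rightarrow> 'i \<Rightarrow> 'a fps. \<forall>z n. finite (column_support A z n)}"
  morphisms entry Colfin
  by (rule exI[of _ "\<lambda>_ _. 0"]) (simp add: column_support_def)

lemma finite_column_support: "finite (column_support (entry A) z n)"
  using entry[of A] by simp

lemma colfin_eqI: "(\<And>x z n. fps_nth (entry A x z) n = fps_nth (entry B x z) n) \<Longrightarrow> A = B"
  using entry_inject by (metis fps_ext ext)

lemma entry_Colfin: "(\<And>z n. finite (column_support A z n)) \<Longrightarrow> entry (Colfin A) = A"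
  by (rule Colfin_inverse) simp

text \<open>The summation range comes from the right factor and depends on \<open>n\<close>; any
  larger finite set gives the same value, by \<open>matrix_mult_nth\<close>.\<close>

definition matrix_mult :: "('i \<Rightarrow> 'i \<Rightarrow> 'a::comm_ring_1 fps) \<Rightarrow> ('i \<Rightarrow> 'i \<Rightarrow> 'a fps) \<Rightarrow> 'i \<Rightarrow> 'i \<Rightarrow> 'a fps" where
  "matrix_mult A B x z = Abs_fps (\<lambda>n. \<Sum>y\<in>column_support B z n. fps_nth (A x y * B y z) n)"

lemma fps_mult_nth_eq_0:
  fixes f g :: "'a::comm_ring_1 fps"
  shows "(\<And>k. k \<le> n \<Longrightarrow> fps_nth g k = 0) \<Longrightarrow> fps_nth (f * g) n = 0"
  by (simp add: fps_mult_nth)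

lemma fps_mult_nth_neq_0:
  fixes f g :: "'a::comm_ring_1 fps"
  assumes "fps_nth (f * g) n \<noteq> 0"
  obtains i where "i \<le> n" "fps_nth f i \<noteq> 0" "fps_nth g (n - i) \<noteq> 0"
proof -
  have "\<exists>i\<in>{0..n}. fps_nth f i * fps_nth g (n - i) \<noteq> 0"
    using assms unfolding fps_mult_nth by (metis (no_types, lifting) sum.neutral)
  then show thesis using that by (metis atLeastAtMost_iff mult_zero_left mult_zero_right)
qed

lemma matrix_mult_nth:
  assumes "finite Y" "column_support B z n \<subseteq> Y"
  shows "fps_nth (matrix_mult A B x z) n = (\<Sum>y\<in>Y. fps_nth (A x y * B y z) n)"
  unfolding matrix_mult_def fps_nth_Abs_fps
  by (rule sum.mono_neutral_left[OF assms])
    (auto simp: column_support_def intro!: fps_mult_nth_eq_0)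

lemma column_support_mono: "k \<le> n \<Longrightarrow> column_support A z k \<subseteq> column_support A z n"
  unfolding column_support_def using order_trans by blast

lemma column_support_matrix_mult:
  "column_support (matrix_mult A B) z n \<subseteq> (\<Union>y\<in>column_support B z n. column_support A y n)"
proof
  fix x assume "x \<in> column_support (matrix_mult A B) z n"
  then obtain k where k: "k \<le> n" "fps_nth (matrix_mult A B x z) k \<noteq> 0" unfolding column_support_def by blast
  then have "(\<Sum>y\<in>column_support B z k. fps_nth (A x y * B y z) k) \<noteq> 0" unfolding matrix_mult_def by simp
  then obtain y where y: "y \<in> column_support B z k" "fps_nth (A x y * B y z) k \<noteq> 0"
    by (meson sum.neutral)
  obtain i where "i \<le> k" "fps_nth (A x y) i \<noteq> 0" using fps_mult_nth_neq_0[OF y(2)] .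
  moreover have "i \<le> n" using k(1) calculation(1) by simp
  ultimately have "x \<in> column_support A y n" unfolding column_support_def by blast
  then show "x \<in> (\<Union>y\<in>column_support B z n. column_support A y n)"
    using subsetD[OF column_support_mono[OF k(1)] y(1)] by (rule UN_I[rotated])
qed

lemma matrix_mult_assoc:
  fixes A B C :: "'i \<Rightarrow> 'i \<Rightarrow> 'a::comm_ring_1 fps"
  assumes "\<And>z n. finite (column_support B z n)" "\<And>z n. finite (column_support C z n)"
  shows "matrix_mult (matrix_mult A B) C x w = matrix_mult A (matrix_mult B C) x w"
proof (rule fps_ext)
  fix n
  \<comment> \<open>Finite sets containing all intermediate indices for exponents up to
    \<open>n\<close>, which turn both bracketings into the same finite double sum.\<close>
  define Zs where "Zs = column_support C w n"
  define Ys where "Ys = (\<Union>z\<in>Zs. column_support B z n)"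
  have fin: "finite Zs" "finite Ys" unfolding Zs_def Ys_def using assms by auto
  have AB: "fps_nth (matrix_mult A B x z) k = (\<Sum>y\<in>Ys. fps_nth (A x y * B y z) k)" if "z \<in> Zs" "k \<le> n" for z k
    by (rule matrix_mult_nth[OF fin(2)]) (use that column_support_mono[of k n B z] in \<open>auto simp: Ys_def\<close>)
  have BC: "fps_nth (matrix_mult B C y w) k = (\<Sum>z\<in>Zs. fps_nth (B y z * C z w) k)" if "k \<le> n" for y k
    by (rule matrix_mult_nth[OF fin(1)]) (use that column_support_mono[of k n C w] in \<open>auto simp: Zs_def\<close>)
  have "fps_nth (matrix_mult (matrix_mult A B) C x w) n = (\<Sum>z\<in>Zs. fps_nth (matrix_mult A B x z * C z w) n)"
    by (rule matrix_mult_nth[OF fin(1)]) (simp add: Zs_def)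
  also have "\<dots> = (\<Sum>z\<in>Zs. fps_nth ((\<Sum>y\<in>Ys. A x y * B y z) * C z w) n)"
    by (rule sum.cong[OF refl]) (simp add: fps_mult_nth AB fps_sum_nth)
  also have "\<dots> = (\<Sum>z\<in>Zs. \<Sum>y\<in>Ys. fps_nth (A x y * B y z * C z w) n)"
    by (simp add: sum_distrib_right fps_sum_nth)
  also have "\<dots> = (\<Sum>y\<in>Ys. \<Sum>z\<in>Zs. fps_nth (A x y * B y z * C z w) n)" by (rule sum.swap)
  also have "\<dots> = (\<Sum>y\<in>Ys. fps_nth (A x y * (\<Sum>z\<in>Zs. B y z * C z w)) n)"
    by (simp add: sum_distrib_left fps_sum_nth mult.assoc)
  also have "\<dots> = (\<Sum>y\<in>Ys. fps_nth (A x y * matrix_mult B C y w) n)"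
    by (rule sum.cong[OF refl]) (simp add: fps_mult_nth BC fps_sum_nth)
  also have "\<dots> = fps_nth (matrix_mult A (matrix_mult B C) x w) n"
    by (rule matrix_mult_nth[OF fin(2), symmetric]) (use column_support_matrix_mult[of B C w n] in \<open>auto simp: Ys_def Zs_def\<close>)
  finally show "fps_nth (matrix_mult (matrix_mult A B) C x w) n = fps_nth (matrix_mult A (matrix_mult B C) x w) n" .
qed

instantiation colfin :: (type, comm_ring_1) monoid_mult
begin

definition one_colfin :: "('a, 'b) colfin" where
  "one_colfin = Colfin (\<lambda>x z. if x = z then 1 else 0)"

definition times_colfin :: "('a, 'b) colfin \<Rightarrow> ('a, 'b) colfin \<Rightarrow> ('a, 'b) colfin" where
  "times_colfin A B = Colfin (matrix_mult (entry A) (entry B))"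

lemma entry_one: "entry (1 :: ('a, 'b) colfin) = (\<lambda>x z. if x = z then 1 else 0)"
  unfolding one_colfin_def
proof (rule entry_Colfin)
  fix z :: 'a and n
  show "finite (column_support (\<lambda>x z. if x = z then 1 else 0 :: 'b fps) z n)"
    by (rule finite_subset[of _ "{z}"]) (auto simp: column_support_def split: if_splits)
qed

lemma entry_times: "entry (A * B) = matrix_mult (entry A) (entry (B :: ('a, 'b) colfin))"
  unfolding times_colfin_def
  by (rule entry_Colfin, rule finite_subset[OF column_support_matrix_mult])
    (simp add: finite_column_support)

instance
proof
  fix A B C :: "('a, 'b) colfin"
  show "A * B * C = A * (B * C)"
    by (rule colfin_eqI) (simp add: entry_times matrix_mult_assoc finite_column_support)
  show "1 * A = A"
  proof (rule colfin_eqI)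
    fix x z n
    have "fps_nth (entry (1 * A) x z) n = (\<Sum>y\<in>insert x (column_support (entry A) z n). fps_nth ((if x = y then 1 else 0) * entry A y z) n)"
      unfolding entry_times entry_one by (rule matrix_mult_nth) (auto simp: finite_column_support)
    also have "\<dots> = (\<Sum>y\<in>{x}. fps_nth ((if x = y then 1 else 0) * entry A y z) n)"
      by (rule sum.mono_neutral_right) (auto simp: finite_column_support)
    finally show "fps_nth (entry (1 * A) x z) n = fps_nth (entry A x z) n" by simp
  qed
  show "A * 1 = A"
  proof (rule colfin_eqI)
    fix x z n
    have "fps_nth (entry (A * 1) x z) n = (\<Sum>y\<in>{z}. fps_nth (entry A x y * (if y = z then 1 else 0)) n)"
      unfolding entry_times entry_one by (rule matrix_mult_nth) (auto simp: column_support_def split: if_splits)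
    then show "fps_nth (entry (A * 1) x z) n = fps_nth (entry A x z) n" by simp
  qed
qed

end

lemma times_nth:
  assumes "finite Y" "column_support (entry B) z n \<subseteq> Y"
  shows "fps_nth (entry (A * B) x z) n = (\<Sum>y\<in>Y. fps_nth (entry A x y * entry B y z) n)"
  unfolding entry_times by (rule matrix_mult_nth[OF assms])

lemma times_nth_neq_0:
  assumes "fps_nth (entry (A * B) x z) n \<noteq> 0"
  obtains y i where "i \<le> n" "fps_nth (entry A x y) i \<noteq> 0" "fps_nth (entry B y z) (n - i) \<noteq> 0"
proof -
  have "(\<Sum>y\<in>column_support (entry B) z n. fps_nth (entry A x y * entry B y z) n) \<noteq> 0"
    using assms times_nth[OF finite_column_support order.refl, of A B x z n] by simp
  then obtain y where "fps_nth (entry A x y * entry B y z) n \<noteq> 0"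
    by (meson sum.neutral)
  then obtain i where "i \<le> n" "fps_nth (entry A x y) i \<noteq> 0" "fps_nth (entry B y z) (n - i) \<noteq> 0"
    by (rule fps_mult_nth_neq_0)
  then show thesis by (rule that)
qed

text \<open>For products in which a single intermediate index contributes, as with diagonal or
  triangular factors.\<close>

lemma times_nth_single:
  assumes "\<And>y i. i \<le> n \<Longrightarrow> y \<noteq> y0 \<Longrightarrow> fps_nth (entry A x y) i \<noteq> 0 \<Longrightarrow> fps_nth (entry B y z) (n - i) \<noteq> 0 \<Longrightarrow> False"
  shows "fps_nth (entry (A * B) x z) n = fps_nth (entry A x y0 * entry B y0 z) n"
proof -
  have "fps_nth (entry (A * B) x z) n = (\<Sum>y\<in>insert y0 (column_support (entry B) z n). fps_nth (entry A x y * entry B y z) n)"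
    by (rule times_nth) (auto simp: finite_column_support)
  also have "\<dots> = (\<Sum>y\<in>{y0}. fps_nth (entry A x y * entry B y z) n)"
  proof (rule sum.mono_neutral_right)
    show "\<forall>y\<in>insert y0 (column_support (entry B) z n) - {y0}. fps_nth (entry A x y * entry B y z) n = 0"
    proof (rule ballI, rule ccontr)
      fix y assume y: "y \<in> insert y0 (column_support (entry B) z n) - {y0}" and ne: "fps_nth (entry A x y * entry B y z) n \<noteq> 0"
      obtain i where "i \<le> n" "fps_nth (entry A x y) i \<noteq> 0" "fps_nth (entry B y z) (n - i) \<noteq> 0"
        using fps_mult_nth_neq_0[OF ne] .
      then show False using assms y by blast
    qed
  qed (auto simp: finite_column_support)
  finally show ?thesis by simp
qed

section \<open>Scalar multiples and traces\<close>

definition scale :: "'a::comm_ring_1 fps \<Rightarrow> ('i, 'a) colfin \<Rightarrow> ('i, 'a) colfin" where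
  "scale g A = Colfin (\<lambda>x z. g * entry A x z)"

lemma entry_scale: "entry (scale g A) = (\<lambda>x z. g * entry A x z)"
  unfolding scale_def
proof (rule entry_Colfin)
  fix z n
  have "column_support (\<lambda>x z. g * entry A x z) z n \<subseteq> column_support (entry A) z n"
  proof
    fix y assume "y \<in> column_support (\<lambda>x z. g * entry A x z) z n"
    then obtain k where k: "k \<le> n" "fps_nth (g * entry A y z) k \<noteq> 0" unfolding column_support_def by blast
    obtain i where "i \<le> k" "fps_nth (entry A y z) (k - i) \<noteq> 0" using fps_mult_nth_neq_0[OF k(2)] .
    moreover have "k - i \<le> n" using k(1) by simp
    ultimately show "y \<in> column_support (entry A) z n" unfolding column_support_def by blast
  qed
  then show "finite (column_support (\<lambda>x z. g * entry A x z) z n)"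
    by (rule finite_subset[OF _ finite_column_support])
qed

lemma fps_nth_mult_sum:
  fixes g :: "'a::comm_ring_1 fps"
  assumes "\<And>k. k \<le> n \<Longrightarrow> fps_nth f k = (\<Sum>y\<in>Y. fps_nth (h y) k)"
  shows "fps_nth (g * f) n = (\<Sum>y\<in>Y. fps_nth (g * h y) n)"
proof -
  have "fps_nth (g * f) n = fps_nth (g * (\<Sum>y\<in>Y. h y)) n"
    by (simp add: fps_mult_nth assms fps_sum_nth)
  then show ?thesis by (simp add: sum_distrib_left fps_sum_nth)
qed

lemma scale_mult_left: "scale g A * B = scale g (A * B)"
proof (rule colfin_eqI)
  fix x z n
  have "fps_nth (g * entry (A * B) x z) n = (\<Sum>y\<in>column_support (entry B) z n. fps_nth (g * (entry A x y * entry B y z)) n)"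
    by (rule fps_nth_mult_sum, rule times_nth[OF finite_column_support column_support_mono])
  then show "fps_nth (entry (scale g A * B) x z) n = fps_nth (entry (scale g (A * B)) x z) n"
    unfolding entry_scale times_nth[OF finite_column_support order.refl] by (simp add: mult.assoc)
qed

lemma scale_mult_right: "A * scale g B = scale g (A * B)"
proof (rule colfin_eqI)
  fix x z n
  have sub: "column_support (entry (scale g B)) z n \<subseteq> column_support (entry B) z n"
  proof
    fix y assume "y \<in> column_support (entry (scale g B)) z n"
    then obtain k where k: "k \<le> n" "fps_nth (g * entry B y z) k \<noteq> 0"
      unfolding column_support_def entry_scale by blast
    obtain i where "i \<le> k" "fps_nth (entry B y z) (k - i) \<noteq> 0" using fps_mult_nth_neq_0[OF k(2)] .
    moreover have "k - i \<le> n" using k(1) by simp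
    ultimately show "y \<in> column_support (entry B) z n" unfolding column_support_def by blast
  qed
  have "fps_nth (g * entry (A * B) x z) n = (\<Sum>y\<in>column_support (entry B) z n. fps_nth (g * (entry A x y * entry B y z)) n)"
    by (rule fps_nth_mult_sum, rule times_nth[OF finite_column_support column_support_mono])
  then show "fps_nth (entry (A * scale g B) x z) n = fps_nth (entry (scale g (A * B)) x z) n"
    unfolding times_nth[OF finite_column_support sub] unfolding entry_scale by (simp add: mult.left_commute)
qed

lemma scale_scale: "scale g (scale h A) = scale (g * h) A"
  by (rule colfin_eqI) (simp add: entry_scale mult.assoc)

lemma scale_1: "scale 1 A = A"
  by (rule colfin_eqI) (simp add: entry_scale)

text \<open>Meaningful when only finitely many diagonal entries reach the exponent \<open>n\<close>;
  over an infinite index set the sum takes the default value 0.\<close>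

definition colfin_trace :: "('i, 'a::comm_ring_1) colfin \<Rightarrow> 'a fps" where
  "colfin_trace A = Abs_fps (\<lambda>n. \<Sum>x | fps_nth (entry A x x) n \<noteq> 0. fps_nth (entry A x x) n)"

lemma trace_nth:
  assumes "finite X" "\<And>x. fps_nth (entry A x x) n \<noteq> 0 \<Longrightarrow> x \<in> X"
  shows "fps_nth (colfin_trace A) n = (\<Sum>x\<in>X. fps_nth (entry A x x) n)"
  unfolding colfin_trace_def fps_nth_Abs_fps by (rule sum.mono_neutral_left) (use assms in auto)

definition total_support :: "('i, 'a::comm_ring_1) colfin \<Rightarrow> nat \<Rightarrow> ('i \<times> 'i) set" where
  "total_support A n = {(x, z). \<exists>k\<le>n. fps_nth (entry A x z) k \<noteq> 0}"

text \<open>Stronger than column finiteness, since rows and columns are bounded at once. The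
  identity on infinitely many indices is column finite but has no meaningful trace.\<close>

definition totally_finite :: "('i, 'a::comm_ring_1) colfin \<Rightarrow> bool" where
  "totally_finite A \<longleftrightarrow> (\<forall>n. finite (total_support A n))"

text \<open>One totally finite factor is enough: in either order it confines both summation indices
  to finite sets, and the finite double sum can be exchanged.\<close>

lemma trace_commute:
  fixes A B :: "('i, 'a::comm_ring_1) colfin"
  assumes "totally_finite A"
  shows "colfin_trace (A * B) = colfin_trace (B * A)"
proof (rule fps_ext)
  fix n
  define X where "X = fst ` total_support A n"
  define Z where "Z = snd ` total_support A n"
  have fin: "finite X" "finite Z" using assms unfolding X_def Z_def totally_finite_def by auto
  have mem: "x \<in> X \<and> z \<in> Z" if "k \<le> n" "fps_nth (entry A x z) k \<noteq> 0" for x z k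
  proof -
    have "(x, z) \<in> total_support A n" using that unfolding total_support_def by blast
    then show ?thesis unfolding X_def Z_def by force
  qed
  have "fps_nth (colfin_trace (A * B)) n = (\<Sum>x\<in>X. fps_nth (entry (A * B) x x) n)"
  proof (rule trace_nth[OF fin(1)])
    fix x assume "fps_nth (entry (A * B) x x) n \<noteq> 0"
    then obtain z i where "i \<le> n" "fps_nth (entry A x z) i \<noteq> 0" by (rule times_nth_neq_0)
    then show "x \<in> X" using mem by blast
  qed
  also have "\<dots> = (\<Sum>x\<in>X. \<Sum>z\<in>Z. fps_nth (entry A x z * entry B z x) n)"
  proof (rule sum.cong[OF refl])
    fix x assume "x \<in> X"
    have "fps_nth (entry (A * B) x x) n = (\<Sum>z\<in>Z \<union> column_support (entry B) x n. fps_nth (entry A x z * entry B z x) n)"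
      by (rule times_nth) (use fin finite_column_support in auto)
    also have "\<dots> = (\<Sum>z\<in>Z. fps_nth (entry A x z * entry B z x) n)"
    proof (rule sum.mono_neutral_right)
      show "\<forall>z\<in>Z \<union> column_support (entry B) x n - Z. fps_nth (entry A x z * entry B z x) n = 0"
      proof (rule ballI, rule ccontr)
        fix z assume z: "z \<in> Z \<union> column_support (entry B) x n - Z" and ne: "fps_nth (entry A x z * entry B z x) n \<noteq> 0"
        obtain i where "i \<le> n" "fps_nth (entry A x z) i \<noteq> 0" using fps_mult_nth_neq_0[OF ne] .
        then show False using mem z by blast
      qed
    qed (use fin finite_column_support in auto)
    finally show "fps_nth (entry (A * B) x x) n = (\<Sum>z\<in>Z. fps_nth (entry A x z * entry B z x) n)" .
  qed
  also have "\<dots> = (\<Sum>z\<in>Z. \<Sum>x\<in>X. fps_nth (entry B z x * entry A x z) n)"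
    unfolding mult.commute[of "entry A _ _"] by (rule sum.swap)
  also have "\<dots> = (\<Sum>z\<in>Z. fps_nth (entry (B * A) z z) n)"
  proof (rule sum.cong[OF refl])
    fix z assume "z \<in> Z"
    have "column_support (entry A) z n \<subseteq> X" using mem unfolding column_support_def by blast
    then show "(\<Sum>x\<in>X. fps_nth (entry B z x * entry A x z) n) = fps_nth (entry (B * A) z z) n"
      by (rule times_nth[OF fin(1), symmetric])
  qed
  also have "\<dots> = fps_nth (colfin_trace (B * A)) n"
  proof (rule trace_nth[OF fin(2), symmetric])
    fix z assume "fps_nth (entry (B * A) z z) n \<noteq> 0"
    then obtain x i where "fps_nth (entry A x z) (n - i) \<noteq> 0" by (rule times_nth_neq_0)
    moreover have "n - i \<le> n" by simp
    ultimately show "z \<in> Z" using mem by blast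
  qed
  finally show "fps_nth (colfin_trace (A * B)) n = fps_nth (colfin_trace (B * A)) n" .
qed

text \<open>Total finiteness provides one finite set carrying the diagonal for all exponents up to
  \<open>n\<close>.\<close>

lemma trace_scale:
  assumes "totally_finite A"
  shows "colfin_trace (scale g (A * B)) = g * colfin_trace (A * B)"
proof (rule fps_ext)
  fix n
  define X where "X = fst ` total_support A n"
  have fin: "finite X" using assms unfolding X_def totally_finite_def by auto
  have mem: "x \<in> X" if k: "k \<le> n" "fps_nth (entry (A * B) x x) k \<noteq> 0" for x k
  proof -
    obtain y i where "i \<le> k" "fps_nth (entry A x y) i \<noteq> 0" using times_nth_neq_0[OF k(2)] .
    moreover have "i \<le> n" using k(1) calculation(1) by simp
    ultimately have "(x, y) \<in> total_support A n" unfolding total_support_def by blast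
    then show ?thesis unfolding X_def by force
  qed
  have "fps_nth (g * colfin_trace (A * B)) n = (\<Sum>x\<in>X. fps_nth (g * entry (A * B) x x) n)"
    by (rule fps_nth_mult_sum, rule trace_nth[OF fin]) (use mem in blast)
  also have "\<dots> = fps_nth (colfin_trace (scale g (A * B))) n"
    unfolding entry_scale[of g "A * B", THEN fun_cong, THEN fun_cong, symmetric]
  proof (rule trace_nth[OF fin, symmetric])
    fix x assume "fps_nth (entry (scale g (A * B)) x x) n \<noteq> 0"
    then obtain i where "i \<le> n" "fps_nth (entry (A * B) x x) (n - i) \<noteq> 0"
      unfolding entry_scale by (rule fps_mult_nth_neq_0)
    then show "x \<in> X" using mem diff_le_self by blast
  qed
  finally show "fps_nth (colfin_trace (scale g (A * B))) n = fps_nth (g * colfin_trace (A * B)) n" by simp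
qed

section \<open>Operators adding and removing horizontal strips\<close>

lemma finite_partitions_le: "finite {lam. is_partition lam \<and> sum_list lam \<le> n}"
proof (rule finite_subset[OF _ finite_lists_length_le[of "{..n}" n]])
  show "{lam. is_partition lam \<and> sum_list lam \<le> n} \<subseteq> {xs. set xs \<subseteq> {..n} \<and> length xs \<le> n}"
  proof
    fix lam assume "lam \<in> {lam. is_partition lam \<and> sum_list lam \<le> n}"
    then have lam: "0 \<notin> set lam" "sum_list lam \<le> n" unfolding is_partition_def by auto
    have "length lam \<le> sum_list lam" using lam(1) by (induction lam) (auto simp: Suc_le_eq)
    moreover have "x \<le> n" if "x \<in> set lam" for x using member_le_sum_list[OF that] lam(2) by simp
    ultimately show "lam \<in> {xs. set xs \<subseteq> {..n} \<and> length xs \<le> n}" using lam(2) by auto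
  qed
qed simp

definition strip :: "nat list \<Rightarrow> nat list \<Rightarrow> bool" where
  "strip lam mu \<longleftrightarrow> is_partition lam \<and> is_partition mu \<and> horizontal_strip lam mu"

text \<open>Makes the strip operators triangular with respect to size.\<close>

lemma strip_size:
  assumes "strip lam mu"
  shows "sum_list mu \<le> sum_list lam" "sum_list lam \<le> sum_list mu \<Longrightarrow> lam = mu"
proof -
  have p: "is_partition lam" "is_partition mu" and h: "horizontal_strip lam mu" using assms unfolding strip_def by auto
  define N where "N = part lam 1"
  have mN: "part mu 1 \<le> N" using h unfolding horizontal_strip_def N_def by simp
  have le: "conj_part mu j \<le> conj_part lam j" if "j \<ge> 1" for j using h that unfolding horizontal_strip_iff[OF p] by blast
  have e: "sum_list lam = (\<Sum>j\<in>{1..N}. conj_part lam j)" "sum_list mu = (\<Sum>j\<in>{1..N}. conj_part mu j)"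
    using sum_list_eq_sum_conj_part[OF p(1), of N] sum_list_eq_sum_conj_part[OF p(2) mN] by (auto simp: N_def)
  show "sum_list mu \<le> sum_list lam" unfolding e by (rule sum_mono) (use le in auto)
  assume "sum_list lam \<le> sum_list mu"
  then have eq: "(\<Sum>j\<in>{1..N}. conj_part mu j) = (\<Sum>j\<in>{1..N}. conj_part lam j)"
    using \<open>sum_list mu \<le> sum_list lam\<close> e by simp
  show "lam = mu"
  proof (rule partition_eqI[OF p])
    fix j :: nat assume j: "j \<ge> 1"
    show "conj_part lam j = conj_part mu j"
    proof (cases "j \<le> N")
      case True
      then show ?thesis using sum_mono_inv[OF eq, of j] le j by auto
    next
      case False
      then show ?thesis using conj_part_eq_0[OF p(1), of N j] conj_part_eq_0[OF p(2) mN, of j] by (auto simp: N_def)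
    qed
  qed
qed

lemma strip_refl: "is_partition mu \<Longrightarrow> strip mu mu"
  unfolding strip_def by (simp add: horizontal_strip_iff)

lemma C_boxes_refl: "C_boxes mu mu = {}"
  unfolding C_boxes_def by auto

lemma phi_refl: "phi q_var t_var mu mu = 1"
  unfolding phi_def C_boxes_refl by simp

lemma psi_refl: "psi q_var t_var mu mu = 1"
proof -
  have "b_weight q_var t_var mu s \<noteq> 0" for s
    using one_minus_monomial_nonzero[of "arm mu s" "Suc (leg mu s)"] one_minus_monomial_nonzero[of "Suc (arm mu s)" "leg mu s"]
    unfolding b_weight_def by simp
  then show ?thesis unfolding psi_def by simp
qed

section \<open>The skew Cauchy identity\<close>

definition upper :: "nat list \<Rightarrow> nat list \<Rightarrow> nat \<Rightarrow> nat list set" where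
  "upper lam mu n = {nu. strip nu lam \<and> strip nu mu \<and> sum_list nu = n}"

definition lower :: "nat list \<Rightarrow> nat list \<Rightarrow> nat list set" where
  "lower lam mu = {kap. strip lam kap \<and> strip mu kap}"

lemma finite_upper: "finite (upper lam mu n)"
  by (rule finite_subset[OF _ finite_partitions_le[of n]]) (auto simp: upper_def strip_def)

lemma finite_lower: "finite (lower lam mu)"
  by (rule finite_subset[OF _ finite_partitions_le[of "sum_list mu"]]) (auto simp: lower_def strip_size(1) strip_def dest: strip_size(1)[unfolded strip_def])

lemma lower_size: "kap \<in> lower lam mu \<Longrightarrow> sum_list kap \<le> sum_list lam \<and> sum_list kap \<le> sum_list mu"
  unfolding lower_def using strip_size(1) by blast

text \<open>The identity with one variable on each side, graded by the size \<open>n\<close> of the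
  upper partitions. The excess of \<open>n + sum_list kap\<close> over
  \<open>sum_list lam + sum_list mu\<close> is the degree supplied by the scalar factor.\<close>

theorem skew_cauchy:
  assumes "is_partition lam" "is_partition mu"
  shows "(\<Sum>nu\<in>upper lam mu n. phi q_var t_var nu mu * psi q_var t_var nu lam) =
    (\<Sum>kap\<in>lower lam mu. if sum_list lam + sum_list mu \<le> n + sum_list kap
       then phi q_var t_var lam kap * psi q_var t_var mu kap * ratio_coeff (n + sum_list kap - (sum_list lam + sum_list mu)) else 0)"
proof (cases "\<forall>k\<ge>1. conj_part lam k \<le> Suc (conj_part mu k) \<and> conj_part mu k \<le> Suc (conj_part lam k)")
  case False
  then obtain k where k: "k \<ge> 1" "\<not> (conj_part lam k \<le> Suc (conj_part mu k) \<and> conj_part mu k \<le> Suc (conj_part lam k))" by blast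
  \<comment> \<open>If some column lengths differ by more than one, both sums are empty.\<close>
  have "upper lam mu n = {}"
  proof (rule ccontr)
    assume "upper lam mu n \<noteq> {}"
    then obtain nu where nu: "is_partition nu" "horizontal_strip nu lam" "horizontal_strip nu mu"
      unfolding upper_def strip_def by blast
    have "conj_part lam k \<le> conj_part nu k" "conj_part nu k \<le> Suc (conj_part mu k)"
      "conj_part mu k \<le> conj_part nu k" "conj_part nu k \<le> Suc (conj_part lam k)"
      using nu(2,3) k(1) unfolding horizontal_strip_iff[OF nu(1) assms(1)] horizontal_strip_iff[OF nu(1) assms(2)] by blast+
    then show False using k(2) by linarith
  qed
  moreover have "lower lam mu = {}"
  proof (rule ccontr)
    assume "lower lam mu \<noteq> {}"
    then obtain nu where nu: "is_partition nu" "horizontal_strip lam nu" "horizontal_strip mu nu"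
      unfolding lower_def strip_def by blast
    have "conj_part nu k \<le> conj_part lam k" "conj_part lam k \<le> Suc (conj_part nu k)"
      "conj_part nu k \<le> conj_part mu k" "conj_part mu k \<le> Suc (conj_part nu k)"
      using nu(2,3) k(1) unfolding horizontal_strip_iff[OF assms(1) nu(1)] horizontal_strip_iff[OF assms(2) nu(1)] by blast+
    then show False using k(2) by linarith
  qed
  ultimately show ?thesis by simp
next
  case True
  interpret ratfun_partitions lam mu "max (part lam 1) (part mu 1)"
    by (intro ratfun_partitions.intro two_partitions.intro generic_parameters_ratfun two_partitions_axioms.intro)
      (use assms True in auto)
  let ?p = "phi q_var t_var" and ?s = "psi q_var t_var"
  have down: "kap \<in> lower lam mu \<longleftrightarrow> (\<exists>s. kap \<in> down_set s)" for kap
  proof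
    assume "kap \<in> lower lam mu"
    then have kap: "is_partition kap" "horizontal_strip mu kap" "horizontal_strip lam kap"
      unfolding lower_def strip_def by auto
    note u = down_pred_if_strips[OF kap]
    have "kap \<in> down_set (card (raised mu kap - M))"
      using kap down_pred_size[OF u] unfolding down_set_def by auto
    then show "\<exists>s. kap \<in> down_set s" by blast
  qed (use assms in \<open>auto simp: down_set_def lower_def strip_def\<close>)
  have fin: "finite (down_set s)" for s
    by (rule finite_subset[OF _ finite_lower[of lam mu]]) (use down in blast)
  show ?thesis
  proof (cases "sum_list mu + card P \<le> n")
    case False
    \<comment> \<open>Below the size of the union of the two diagrams there is no upper partition,
      and the condition in the sum over \<open>kap\<close> fails as well.\<close>
    have "nu \<notin> upper lam mu n" for nu
    proof
      assume "nu \<in> upper lam mu n"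
      then have nu: "is_partition nu" "horizontal_strip nu mu" "horizontal_strip nu lam" "sum_list nu = n"
        unfolding upper_def strip_def by auto
      show False using up_pred_size[OF up_pred_if_strips[OF nu(1-3)]] nu(4) False by simp
    qed
    then have "upper lam mu n = {}" by blast
    moreover have "\<not> sum_list lam + sum_list mu \<le> n + sum_list kap" if kap: "kap \<in> lower lam mu" for kap
    proof -
      obtain s where "kap \<in> down_set s" using kap down by blast
      then have "sum_list mu = sum_list kap + card M + s" unfolding down_set_def by auto
      then show ?thesis using lam_size False by linarith
    qed
    ultimately show ?thesis by simp
  next
    case True
    then obtain r where r: "n = sum_list mu + card P + r" using le_Suc_ex by blast
    \<comment> \<open>\<open>lam_size\<close> translates the numbers of chosen columns into sizes of
      partitions.\<close>
    have idx: "sum_list lam + sum_list mu \<le> n + sum_list kap \<longleftrightarrow> s \<le> r"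
      "n + sum_list kap - (sum_list lam + sum_list mu) = r - s" if "kap \<in> down_set s" for kap s
    proof -
      have "sum_list mu = sum_list kap + card M + s" using that unfolding down_set_def by auto
      then show "sum_list lam + sum_list mu \<le> n + sum_list kap \<longleftrightarrow> s \<le> r"
        "n + sum_list kap - (sum_list lam + sum_list mu) = r - s"
        using lam_size unfolding r by linarith+
    qed
    have "upper lam mu n = up_set r" using assms unfolding upper_def up_set_def strip_def r by auto
    then have "(\<Sum>nu\<in>upper lam mu n. ?p nu mu * ?s nu lam) =
        (\<Sum>s\<le>r. (\<Sum>kap\<in>down_set (r - s). ?p lam kap * ?s mu kap) * ratio_coeff s)"
      using commutation[of r] by simp
    also have "\<dots> = (\<Sum>s\<le>r. (\<Sum>kap\<in>down_set s. ?p lam kap * ?s mu kap) * ratio_coeff (r - s))"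
      by (rule sum.reindex_bij_witness[of _ "\<lambda>s. r - s" "\<lambda>s. r - s"]) auto
    also have "\<dots> = (\<Sum>s\<le>r. \<Sum>kap\<in>down_set s. ?p lam kap * ?s mu kap * ratio_coeff (n + sum_list kap - (sum_list lam + sum_list mu)))"
      unfolding sum_distrib_right by (intro sum.cong refl) (simp add: idx)
    also have "\<dots> = (\<Sum>kap\<in>(\<Union>s\<le>r. down_set s). ?p lam kap * ?s mu kap * ratio_coeff (n + sum_list kap - (sum_list lam + sum_list mu)))"
      by (rule sum.UNION_disjoint[symmetric]) (use fin in \<open>auto simp: down_set_def\<close>)
    also have "\<dots> = (\<Sum>kap\<in>lower lam mu. if sum_list lam + sum_list mu \<le> n + sum_list kap
       then ?p lam kap * ?s mu kap * ratio_coeff (n + sum_list kap - (sum_list lam + sum_list mu)) else 0)"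
    proof (rule sum.mono_neutral_cong_left[OF finite_lower])
      show "(\<Union>s\<le>r. down_set s) \<subseteq> lower lam mu" using down by blast
      show "\<forall>i\<in>lower lam mu - (\<Union>s\<le>r. down_set s). (if sum_list lam + sum_list mu \<le> n + sum_list i
       then ?p lam i * ?s mu i * ratio_coeff (n + sum_list i - (sum_list lam + sum_list mu)) else 0) = 0"
      proof
        fix i assume i: "i \<in> lower lam mu - (\<Union>s\<le>r. down_set s)"
        then obtain s where s: "i \<in> down_set s" using down by blast
        then have "\<not> s \<le> r" using i by auto
        then show "(if sum_list lam + sum_list mu \<le> n + sum_list i
       then ?p lam i * ?s mu i * ratio_coeff (n + sum_list i - (sum_list lam + sum_list mu)) else 0) = 0"
          using idx(1)[OF s] by simp
      qed
    next
      fix i assume "i \<in> (\<Union>s\<le>r. down_set s)"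
      then obtain s where s: "s \<le> r" "i \<in> down_set s" by blast
      then show "?p lam i * ?s mu i * ratio_coeff (n + sum_list i - (sum_list lam + sum_list mu)) =
        (if sum_list lam + sum_list mu \<le> n + sum_list i
       then ?p lam i * ?s mu i * ratio_coeff (n + sum_list i - (sum_list lam + sum_list mu)) else 0)"
        using idx(1)[OF s(2)] by simp
    qed
    finally show ?thesis .
  qed
qed

section \<open>Operators and their exchange relations\<close>

type_synonym partition_op = "(nat list, ratfun) colfin"

text \<open>
  \<open>Up_op a\<close> adds a horizontal strip with weight \<open>a + 1\<close> per box, \<open>Down_op b\<close> removes one with
  weight \<open>b\<close> per box. The shift makes the exponent of \<open>Up_op\<close> positive, as column finiteness requires.
\<close>
definition Up_op :: "nat \<Rightarrow> partition_op" where
  "Up_op a = Colfin (\<lambda>lam mu. if strip lam mu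
     then fps_const (phi q_var t_var lam mu) * fps_X ^ (Suc a * (sum_list lam - sum_list mu)) else 0)"

definition Down_op :: "nat \<Rightarrow> partition_op" where
  "Down_op b = Colfin (\<lambda>lam mu. if strip mu lam
     then fps_const (psi q_var t_var mu lam) * fps_X ^ (b * (sum_list mu - sum_list lam)) else 0)"

text \<open>The indices are arbitrary lists; besides recording the size, this operator projects onto
  partitions.\<close>

definition Size_op :: partition_op where
  "Size_op = Colfin (\<lambda>lam mu. if lam = mu \<and> is_partition mu then fps_X ^ sum_list mu else 0)"

lemma fps_nth_const_X: "fps_nth (fps_const c * fps_X ^ e) n = (if n = e then c else (0 :: 'a::comm_ring_1))"
  by simp

lemma entry_Up: "entry (Up_op a) lam mu = (if strip lam mu
     then fps_const (phi q_var t_var lam mu) * fps_X ^ (Suc a * (sum_list lam - sum_list mu)) else 0)"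
proof -
  have "entry (Up_op a) = (\<lambda>lam mu. if strip lam mu
     then fps_const (phi q_var t_var lam mu) * fps_X ^ (Suc a * (sum_list lam - sum_list mu)) else 0)"
    unfolding Up_op_def
  proof (rule entry_Colfin, rule finite_subset[OF _ finite_partitions_le])
    fix z n
    show "column_support (\<lambda>lam mu. if strip lam mu
       then fps_const (phi q_var t_var lam mu) * fps_X ^ (Suc a * (sum_list lam - sum_list mu)) else 0) z n \<subseteq>
       {lam. is_partition lam \<and> sum_list lam \<le> n + sum_list z}"
    proof
      fix lam assume "lam \<in> column_support (\<lambda>lam mu. if strip lam mu
       then fps_const (phi q_var t_var lam mu) * fps_X ^ (Suc a * (sum_list lam - sum_list mu)) else 0) z n"
      then obtain k where k: "k \<le> n" "strip lam z" "k = Suc a * (sum_list lam - sum_list z)"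
        unfolding column_support_def by (auto simp: fps_nth_const_X split: if_splits)
      have "sum_list lam - sum_list z \<le> k" unfolding k(3) by simp
      then show "lam \<in> {lam. is_partition lam \<and> sum_list lam \<le> n + sum_list z}" using k unfolding strip_def by simp
    qed
  qed
  then show ?thesis by simp
qed

lemma entry_Down: "entry (Down_op b) lam mu = (if strip mu lam
     then fps_const (psi q_var t_var mu lam) * fps_X ^ (b * (sum_list mu - sum_list lam)) else 0)"
proof -
  have "entry (Down_op b) = (\<lambda>lam mu. if strip mu lam
     then fps_const (psi q_var t_var mu lam) * fps_X ^ (b * (sum_list mu - sum_list lam)) else 0)"
    unfolding Down_op_def
  proof (rule entry_Colfin, rule finite_subset[OF _ finite_partitions_le])
    fix z n
    show "column_support (\<lambda>lam mu. if strip mu lam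
       then fps_const (psi q_var t_var mu lam) * fps_X ^ (b * (sum_list mu - sum_list lam)) else 0) z n \<subseteq>
       {lam. is_partition lam \<and> sum_list lam \<le> sum_list z}"
    proof
      fix lam assume "lam \<in> column_support (\<lambda>lam mu. if strip mu lam
       then fps_const (psi q_var t_var mu lam) * fps_X ^ (b * (sum_list mu - sum_list lam)) else 0) z n"
      then have "strip z lam" unfolding column_support_def by (auto split: if_splits)
      then show "lam \<in> {lam. is_partition lam \<and> sum_list lam \<le> sum_list z}"
        using strip_size(1) unfolding strip_def by auto
    qed
  qed
  then show ?thesis by simp
qed

lemma entry_Size: "entry Size_op lam mu = (if lam = mu \<and> is_partition mu then fps_X ^ sum_list mu else 0)"
proof -
  have "entry Size_op = (\<lambda>lam mu. if lam = mu \<and> is_partition mu then fps_X ^ sum_list mu else 0)"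
    unfolding Size_op_def
  proof (rule entry_Colfin)
    fix z :: "nat list" and n
    show "finite (column_support (\<lambda>lam mu. if lam = mu \<and> is_partition mu then fps_X ^ sum_list mu else 0 :: ratfun fps) z n)"
      by (rule finite_subset[of _ "{z}"]) (auto simp: column_support_def split: if_splits)
  qed
  then show ?thesis by simp
qed

lemma entry_Size_times: "entry (Size_op * A) x z = (if is_partition x then fps_X ^ sum_list x * entry A x z else 0)"
proof (rule fps_ext)
  fix n
  have "fps_nth (entry (Size_op * A) x z) n = fps_nth (entry Size_op x x * entry A x z) n"
    by (rule times_nth_single) (auto simp: entry_Size split: if_splits)
  then show "fps_nth (entry (Size_op * A) x z) n = fps_nth (if is_partition x then fps_X ^ sum_list x * entry A x z else 0) n"
    by (simp add: entry_Size)
qed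

lemma entry_times_Size: "entry (A * Size_op) x z = (if is_partition z then entry A x z * fps_X ^ sum_list z else 0)"
proof (rule fps_ext)
  fix n
  have "fps_nth (entry (A * Size_op) x z) n = fps_nth (entry A x z * entry Size_op z z) n"
    by (rule times_nth_single) (auto simp: entry_Size split: if_splits)
  then show "fps_nth (entry (A * Size_op) x z) n = fps_nth (if is_partition z then entry A x z * fps_X ^ sum_list z else 0) n"
    by (simp add: entry_Size)
qed

text \<open>Moving \<open>Size_op\<close> across a strip operator changes the recorded size by the
  number of boxes of the strip, which shifts the weight per box by one.\<close>

lemma Size_Up: "Size_op * Up_op a = Up_op (Suc a) * Size_op"
proof (rule colfin_eqI)
  fix x z n
  have "entry (Size_op * Up_op a) x z = entry (Up_op (Suc a) * Size_op) x z"
  proof (cases "strip x z")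
    case True
    have "sum_list x + Suc a * (sum_list x - sum_list z) = Suc (Suc a) * (sum_list x - sum_list z) + sum_list z"
      using strip_size(1)[OF True] by simp
    then have "fps_X ^ sum_list x * fps_X ^ (Suc a * (sum_list x - sum_list z)) =
        fps_X ^ (Suc (Suc a) * (sum_list x - sum_list z)) * (fps_X ^ sum_list z :: ratfun fps)"
      by (simp only: power_add[symmetric])
    then show ?thesis using True unfolding entry_Size_times entry_times_Size entry_Up strip_def
      by (simp add: mult.left_commute mult.assoc del: mult_Suc power_Suc)
  qed (auto simp: entry_Size_times entry_times_Size entry_Up)
  then show "fps_nth (entry (Size_op * Up_op a) x z) n = fps_nth (entry (Up_op (Suc a) * Size_op) x z) n" by simp
qed

lemma Down_Size: "Down_op b * Size_op = Size_op * Down_op (Suc b)"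
proof (rule colfin_eqI)
  fix x z n
  have "entry (Down_op b * Size_op) x z = entry (Size_op * Down_op (Suc b)) x z"
  proof (cases "strip z x")
    case True
    have "b * (sum_list z - sum_list x) + sum_list z = sum_list x + Suc b * (sum_list z - sum_list x)"
      using strip_size(1)[OF True] by simp
    then have "fps_X ^ (b * (sum_list z - sum_list x)) * fps_X ^ sum_list z =
        fps_X ^ sum_list x * (fps_X ^ (Suc b * (sum_list z - sum_list x)) :: ratfun fps)"
      by (simp only: power_add[symmetric])
    then show ?thesis using True unfolding entry_Size_times entry_times_Size entry_Down strip_def
      by (simp add: mult.left_commute mult.assoc del: mult_Suc power_Suc)
  qed (auto simp: entry_Size_times entry_times_Size entry_Down)
  then show "fps_nth (entry (Down_op b * Size_op) x z) n = fps_nth (entry (Size_op * Down_op (Suc b)) x z) n" by simp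
qed

lemma spread_mult_X_nth:
  assumes "d > 0"
  shows "fps_nth (spread f d * fps_X ^ e) m = (if e \<le> m \<and> d dvd (m - e) then f ((m - e) div d) else 0)"
  by (simp add: fps_X_power_mult_right_nth spread_def)

text \<open>Entrywise this is \<open>skew_cauchy\<close>. One more box in the upper partition is
  weighted \<open>a + 1\<close> when added and \<open>b\<close> when removed, hence the spacing
  \<open>a + b + 1\<close> of the scalar series.\<close>

theorem Down_Up: "Down_op b * Up_op a = scale (spread ratio_coeff (Suc (a + b))) (Up_op a * Down_op b)"
proof (rule colfin_eqI)
  fix lam mu m
  let ?p = "phi q_var t_var" and ?s = "psi q_var t_var"
  show "fps_nth (entry (Down_op b * Up_op a) lam mu) m =
    fps_nth (entry (scale (spread ratio_coeff (Suc (a + b))) (Up_op a * Down_op b)) lam mu) m"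
  proof (cases "is_partition lam \<and> is_partition mu")
    case False
    have "fps_nth (entry (Down_op b * Up_op a) lam mu) k = 0" for k
    proof (rule ccontr)
      assume "fps_nth (entry (Down_op b * Up_op a) lam mu) k \<noteq> 0"
      then show False by (rule times_nth_neq_0) (use False in \<open>auto simp: entry_Down entry_Up strip_def split: if_splits\<close>)
    qed
    moreover have "fps_nth (entry (Up_op a * Down_op b) lam mu) k = 0" for k
    proof (rule ccontr)
      assume "fps_nth (entry (Up_op a * Down_op b) lam mu) k \<noteq> 0"
      then show False by (rule times_nth_neq_0) (use False in \<open>auto simp: entry_Down entry_Up strip_def split: if_splits\<close>)
    qed
    ultimately show ?thesis by (simp add: entry_scale fps_mult_nth_eq_0)
  next
    case True
    define L where "L = sum_list lam"
    define U where "U = sum_list mu"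
    \<comment> \<open>The exponent in \<open>Up_op a\<close> is at least the number of added boxes,
      so partitions larger than \<open>B\<close> do not reach the exponent \<open>m\<close>.\<close>
    define B where "B = m + U"
    define e where "e = (\<lambda>n. b * (n - L) + Suc a * (n - U))"
    define e' where "e' = (\<lambda>kap. Suc a * (L - sum_list kap) + b * (U - sum_list kap))"
    let ?d = "Suc (a + b)"
    have term_up: "entry (Down_op b) lam nu * entry (Up_op a) nu mu =
        (if strip nu lam \<and> strip nu mu then fps_const (?p nu mu * ?s nu lam) * fps_X ^ e (sum_list nu) else 0)" for nu
      unfolding entry_Down entry_Up e_def L_def U_def
      by (simp add: power_add mult_ac flip: fps_const_mult del: mult_Suc power_Suc)
    have term_down: "entry (Up_op a) lam kap * entry (Down_op b) kap mu =
        (if kap \<in> lower lam mu then fps_const (?p lam kap * ?s mu kap) * fps_X ^ e' kap else 0)" for kap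
      unfolding entry_Down entry_Up e'_def L_def U_def lower_def
      by (simp add: power_add mult_ac flip: fps_const_mult del: mult_Suc power_Suc)
    have sub: "column_support (entry (Up_op a)) mu m \<subseteq> {nu. is_partition nu \<and> sum_list nu \<le> B}"
    proof
      fix nu assume "nu \<in> column_support (entry (Up_op a)) mu m"
      then obtain k where k: "k \<le> m" "strip nu mu" "k = Suc a * (sum_list nu - sum_list mu)"
        unfolding column_support_def by (auto simp: entry_Up fps_nth_const_X split: if_splits)
      have "sum_list nu - sum_list mu \<le> k" unfolding k(3) by simp
      then show "nu \<in> {nu. is_partition nu \<and> sum_list nu \<le> B}" using k unfolding strip_def B_def U_def by simp
    qed
    have "fps_nth (entry (Down_op b * Up_op a) lam mu) m =
        (\<Sum>nu | is_partition nu \<and> sum_list nu \<le> B. fps_nth (entry (Down_op b) lam nu * entry (Up_op a) nu mu) m)"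
      by (rule times_nth[OF finite_partitions_le sub])
    also have "\<dots> = (\<Sum>nu\<in>(\<Union>n\<le>B. upper lam mu n). if e (sum_list nu) = m then ?p nu mu * ?s nu lam else 0)"
      by (rule sum.mono_neutral_cong_right[OF finite_partitions_le]) (auto simp: term_up upper_def strip_def fps_nth_const_X)
    also have "\<dots> = (\<Sum>n\<le>B. \<Sum>nu\<in>upper lam mu n. if e (sum_list nu) = m then ?p nu mu * ?s nu lam else 0)"
      by (rule sum.UNION_disjoint) (use finite_upper in \<open>auto simp: upper_def\<close>)
    also have "\<dots> = (\<Sum>n\<le>B. if e n = m then (\<Sum>nu\<in>upper lam mu n. ?p nu mu * ?s nu lam) else 0)"
      by (intro sum.cong refl) (auto simp: upper_def)
    also have "\<dots> = (\<Sum>n\<le>B. \<Sum>kap\<in>lower lam mu. if e n = m \<and> L + U \<le> n + sum_list kap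
        then ?p lam kap * ?s mu kap * ratio_coeff (n + sum_list kap - (L + U)) else 0)"
      unfolding skew_cauchy[OF conjunct1[OF True] conjunct2[OF True]] L_def U_def by (intro sum.cong refl) auto
    also have "\<dots> = (\<Sum>kap\<in>lower lam mu. \<Sum>n\<le>B. if e n = m \<and> L + U \<le> n + sum_list kap
        then ?p lam kap * ?s mu kap * ratio_coeff (n + sum_list kap - (L + U)) else 0)"
      by (rule sum.swap)
    also have "\<dots> = (\<Sum>kap\<in>lower lam mu. fps_nth (spread ratio_coeff ?d * (entry (Up_op a) lam kap * entry (Down_op b) kap mu)) m)"
    proof (rule sum.cong[OF refl])
      fix kap assume kap: "kap \<in> lower lam mu"
      define s where "s = sum_list kap"
      have s: "s \<le> L" "s \<le> U" using lower_size[OF kap] unfolding s_def L_def U_def by auto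
      \<comment> \<open>The path through an upper partition of size \<open>n\<close> exceeds the
        path through \<open>kap\<close> by \<open>a + b + 1\<close> for each unit of degree supplied
        by the scalar.\<close>
      have en: "e n = ?d * (n + s - (L + U)) + e' kap" if "L + U \<le> n + s" for n
      proof -
        from le_Suc_ex[OF that] obtain r where r: "n + s = L + U + r" by blast
        define u v where "u = U - s" and "v = L - s"
        have n: "n - L = u + r" "n - U = v + r" "n + s - (L + U) = r"
          using r s unfolding u_def v_def by linarith+
        have "b * (u + r) + Suc a * (v + r) = ?d * r + (Suc a * v + b * u)" by (simp add: algebra_simps)
        then show ?thesis unfolding e_def e'_def s_def[symmetric] n u_def[symmetric] v_def[symmetric] .
      qed
      have R: "fps_nth (spread ratio_coeff ?d * (entry (Up_op a) lam kap * entry (Down_op b) kap mu)) m =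
          ?p lam kap * ?s mu kap * (if e' kap \<le> m \<and> ?d dvd (m - e' kap) then ratio_coeff ((m - e' kap) div ?d) else 0)"
      proof -
        have "spread ratio_coeff ?d * (entry (Up_op a) lam kap * entry (Down_op b) kap mu) =
            fps_const (?p lam kap * ?s mu kap) * (spread ratio_coeff ?d * fps_X ^ e' kap)"
          unfolding term_down using kap by (simp add: mult.left_commute)
        then show ?thesis by (simp only: fps_mult_left_const_nth spread_mult_X_nth[OF zero_less_Suc])
      qed
      show "(\<Sum>n\<le>B. if e n = m \<and> L + U \<le> n + sum_list kap
        then ?p lam kap * ?s mu kap * ratio_coeff (n + sum_list kap - (L + U)) else 0) =
        fps_nth (spread ratio_coeff ?d * (entry (Up_op a) lam kap * entry (Down_op b) kap mu)) m"
        unfolding R s_def[symmetric]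
      proof (cases "e' kap \<le> m \<and> ?d dvd (m - e' kap)")
        case True
        then obtain r where r: "m - e' kap = ?d * r" by blast
        then have m: "m = ?d * r + e' kap" using True by linarith
        \<comment> \<open>The only size with total exponent \<open>m\<close>; it respects the bound
          \<open>B\<close> because its exponent is \<open>m\<close>.\<close>
        define n0 where "n0 = r + (L + U - s)"
        have n0: "L + U \<le> n0 + s" "n0 + s - (L + U) = r" using s unfolding n0_def by auto
        have iff: "e n = m \<and> L + U \<le> n + s \<longleftrightarrow> n = n0" for n
        proof
          assume h: "e n = m \<and> L + U \<le> n + s"
          then have "?d * (n + s - (L + U)) = ?d * r" using en[of n] m by simp
          then have "n + s - (L + U) = r" by (metis nat_mult_eq_cancel1 zero_less_Suc)
          then show "n = n0" using h s unfolding n0_def by linarith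
        qed (use en[OF n0(1)] n0 m in simp)
        have "Suc a * (n0 - U) \<le> m" using iff[of n0] unfolding e_def by auto
        moreover have "n0 - U \<le> Suc a * (n0 - U)" by simp
        ultimately have "n0 \<le> B" unfolding B_def by linarith
        then have "(\<Sum>n\<le>B. if e n = m \<and> L + U \<le> n + s then ?p lam kap * ?s mu kap * ratio_coeff (n + s - (L + U)) else 0) =
            ?p lam kap * ?s mu kap * ratio_coeff r"
          unfolding iff using n0(2) by (simp add: sum.delta)
        moreover have "(m - e' kap) div ?d = r" unfolding r by (metis nonzero_mult_div_cancel_left nat.distinct(1))
        ultimately show "(\<Sum>n\<le>B. if e n = m \<and> L + U \<le> n + s then ?p lam kap * ?s mu kap * ratio_coeff (n + s - (L + U)) else 0) =
          ?p lam kap * ?s mu kap * (if e' kap \<le> m \<and> ?d dvd (m - e' kap) then ratio_coeff ((m - e' kap) div ?d) else 0)"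
          using True by simp
      next
        case False
        have "\<not> (e n = m \<and> L + U \<le> n + s)" for n
        proof
          assume h: "e n = m \<and> L + U \<le> n + s"
          then have "m = ?d * (n + s - (L + U)) + e' kap" using en[of n] by simp
          then have "e' kap \<le> m" "m - e' kap = ?d * (n + s - (L + U))" by linarith+
          then show False using False by (metis dvd_triv_left)
        qed
        then have "(\<Sum>n\<le>B. if e n = m \<and> L + U \<le> n + s then ?p lam kap * ?s mu kap * ratio_coeff (n + s - (L + U)) else 0) = 0"
          by (intro sum.neutral) metis
        then show "(\<Sum>n\<le>B. if e n = m \<and> L + U \<le> n + s then ?p lam kap * ?s mu kap * ratio_coeff (n + s - (L + U)) else 0) =
          ?p lam kap * ?s mu kap * (if e' kap \<le> m \<and> ?d dvd (m - e' kap) then ratio_coeff ((m - e' kap) div ?d) else 0)"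
          using False by (simp only: if_False mult_zero_right)
      qed
    qed
    also have "\<dots> = fps_nth (spread ratio_coeff ?d * entry (Up_op a * Down_op b) lam mu) m"
    proof (rule fps_nth_mult_sum[symmetric])
      fix k
      have "fps_nth (entry (Up_op a * Down_op b) lam mu) k =
        (\<Sum>y\<in>lower lam mu \<union> column_support (entry (Down_op b)) mu k. fps_nth (entry (Up_op a) lam y * entry (Down_op b) y mu) k)"
        by (rule times_nth) (use finite_lower finite_column_support in auto)
      also have "\<dots> = (\<Sum>y\<in>lower lam mu. fps_nth (entry (Up_op a) lam y * entry (Down_op b) y mu) k)"
        by (rule sum.mono_neutral_right) (use finite_lower finite_column_support in \<open>auto simp: term_down\<close>)
      finally show "fps_nth (entry (Up_op a * Down_op b) lam mu) k =
        (\<Sum>y\<in>lower lam mu. fps_nth (entry (Up_op a) lam y * entry (Down_op b) y mu) k)" .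
    qed
    finally show ?thesis unfolding entry_scale .
  qed
qed

section \<open>Normal ordering and the trace\<close>

text \<open>In both cases the entry is weighted by the size of the new partition. For a digit 1,
  \<open>Up_op 0\<close> already carries one factor per added box, so \<open>Size_op\<close> stands
  on its right and records the old size.\<close>

definition letter_op :: "bool \<Rightarrow> partition_op" where
  "letter_op b = (if b then Up_op 0 * Size_op else Size_op * Down_op 0)"

text \<open>Reversed, because the column index of a matrix is the starting partition: the first
  letter acts first and stands rightmost.\<close>

definition word_op :: "bool list \<Rightarrow> partition_op" where
  "word_op bs = prod_list (map letter_op (rev bs))"

definition Up_list :: "nat list \<Rightarrow> partition_op" where
  "Up_list as = prod_list (map Up_op as)"

definition Down_list :: "nat list \<Rightarrow> partition_op" where
  "Down_list bs = prod_list (map Down_op bs)"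

lemma word_op_simps: "word_op [] = 1" "word_op (bs @ [b]) = letter_op b * word_op bs"
  by (simp_all add: word_op_def)

lemma Up_list_simps: "Up_list [] = 1" "Up_list (a # as) = Up_op a * Up_list as"
  by (simp_all add: Up_list_def)

lemma Down_list_simps: "Down_list [] = 1" "Down_list (b # bs) = Down_op b * Down_list bs"
  by (simp_all add: Down_list_def)

abbreviation cross :: "nat \<Rightarrow> ratfun fps" where "cross \<equiv> spread ratio_coeff"

lemma Down_Up_list: "Down_op b * Up_list as = scale (\<Prod>a\<leftarrow>as. cross (Suc (a + b))) (Up_list as * Down_op b)"
proof (induction as)
  case (Cons a as)
  have "Down_op b * Up_list (a # as) = (Down_op b * Up_op a) * Up_list as"
    by (simp add: Up_list_simps mult.assoc)
  also have "\<dots> = scale (cross (Suc (a + b))) (Up_op a * (Down_op b * Up_list as))"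
    by (simp add: Down_Up scale_mult_left mult.assoc)
  also have "\<dots> = scale (\<Prod>a\<leftarrow>a # as. cross (Suc (a + b))) (Up_list (a # as) * Down_op b)"
    unfolding Cons by (simp add: scale_mult_right scale_scale Up_list_simps mult.assoc)
  finally show ?case .
qed (simp add: Up_list_simps scale_1)

lemma Down_list_Up_list:
  "Down_list bs * Up_list as = scale (\<Prod>b\<leftarrow>bs. \<Prod>a\<leftarrow>as. cross (Suc (a + b))) (Up_list as * Down_list bs)"
proof (induction bs)
  case (Cons b bs)
  have "Down_list (b # bs) * Up_list as = Down_op b * (Down_list bs * Up_list as)"
    by (simp add: Down_list_simps mult.assoc)
  also have "\<dots> = scale (\<Prod>b\<leftarrow>bs. \<Prod>a\<leftarrow>as. cross (Suc (a + b))) ((Down_op b * Up_list as) * Down_list bs)"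
    unfolding Cons by (simp add: scale_mult_right mult.assoc)
  also have "\<dots> = scale (\<Prod>b\<leftarrow>b # bs. \<Prod>a\<leftarrow>as. cross (Suc (a + b))) (Up_list as * Down_list (b # bs))"
    unfolding Down_Up_list by (simp add: scale_mult_left scale_scale Down_list_simps mult_ac)
  finally show ?case .
qed (simp add: Down_list_simps scale_1)

lemma Size_Up_list: "Size_op * Up_list as = Up_list (map Suc as) * Size_op"
proof (induction as)
  case (Cons a as)
  have "Size_op * Up_list (a # as) = (Size_op * Up_op a) * Up_list as" by (simp add: Up_list_simps mult.assoc)
  also have "\<dots> = Up_op (Suc a) * (Size_op * Up_list as)" by (simp add: Size_Up mult.assoc)
  finally show ?case unfolding Cons by (simp add: Up_list_simps mult.assoc)
qed (simp add: Up_list_simps)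

lemma Down_Size_power: "Down_op b * Size_op ^ k = Size_op ^ k * Down_op (b + k)"
proof (induction k arbitrary: b)
  case (Suc k)
  have "Down_op b * Size_op ^ Suc k = (Down_op b * Size_op) * Size_op ^ k" by (simp add: mult.assoc)
  also have "\<dots> = Size_op * (Down_op (Suc b) * Size_op ^ k)" by (simp add: Down_Size mult.assoc)
  also have "\<dots> = Size_op ^ Suc k * Down_op (b + Suc k)" unfolding Suc by (simp add: mult.assoc)
  finally show ?case .
qed simp

lemma Down_list_Size_power: "Down_list bs * Size_op ^ k = Size_op ^ k * Down_list (map (\<lambda>b. b + k) bs)"
proof (induction bs)
  case (Cons b bs)
  have "Down_list (b # bs) * Size_op ^ k = Down_op b * (Down_list bs * Size_op ^ k)"
    by (simp add: Down_list_simps mult.assoc)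
  also have "\<dots> = (Down_op b * Size_op ^ k) * Down_list (map (\<lambda>b. b + k) bs)" unfolding Cons by (simp add: mult.assoc)
  finally show ?case unfolding Down_Size_power by (simp add: Down_list_simps mult.assoc)
qed (simp add: Down_list_simps)

text \<open>Positions count from 0 and are listed in decreasing order, as the letters stand in the
  operator product.\<close>

definition up_positions :: "bool list \<Rightarrow> nat list" where
  "up_positions bs = filter (\<lambda>i. bs ! i) (rev [0..<length bs])"

definition down_positions :: "bool list \<Rightarrow> nat list" where
  "down_positions bs = filter (\<lambda>j. \<not> bs ! j) (rev [0..<length bs])"

text \<open>Each letter after position \<open>i\<close> leaves one \<open>Size_op\<close> to the
  left of this \<open>Up_op\<close>, and crossing it raises the parameter by one.\<close>

definition up_exponents :: "bool list \<Rightarrow> nat list" where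
  "up_exponents bs = map (\<lambda>i. length bs - 1 - i) (up_positions bs)"

definition inversions :: "bool list \<Rightarrow> (nat \<times> nat) set" where
  "inversions bs = {(i, j). i < j \<and> j < length bs \<and> bs ! i \<and> \<not> bs ! j}"

lemma positions_snoc:
  "up_positions (bs @ [b]) = (if b then [length bs] else []) @ up_positions bs"
  "down_positions (bs @ [b]) = (if b then [] else [length bs]) @ down_positions bs"
  unfolding up_positions_def down_positions_def by (auto simp: nth_append intro!: filter_cong)

lemma up_positions_less: "i \<in> set (up_positions bs) \<longleftrightarrow> i < length bs \<and> bs ! i"
  and down_positions_less: "j \<in> set (down_positions bs) \<longleftrightarrow> j < length bs \<and> \<not> bs ! j"
  unfolding up_positions_def down_positions_def by auto

lemma distinct_positions: "distinct (up_positions bs)" "distinct (down_positions bs)"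
  unfolding up_positions_def down_positions_def by auto

lemma up_exponents_snoc: "up_exponents (bs @ [b]) = (if b then [0] else []) @ map Suc (up_exponents bs)"
proof -
  have "map (\<lambda>i. length bs - i) (up_positions bs) = map Suc (up_exponents bs)"
    unfolding up_exponents_def by (auto simp: up_positions_less)
  then show ?thesis unfolding up_exponents_def[of "bs @ [b]"] positions_snoc by auto
qed

lemma finite_inversions: "finite (inversions bs)"
  by (rule finite_subset[of _ "{..<length bs} \<times> {..<length bs}"]) (auto simp: inversions_def)

lemma prod_list_positions:
  "(\<Prod>i\<leftarrow>up_positions bs. f i) = (\<Prod>i | i < length bs \<and> bs ! i. f i)"
  "(\<Prod>j\<leftarrow>down_positions bs. f j) = (\<Prod>j | j < length bs \<and> \<not> bs ! j. f j)"
  for f :: "nat \<Rightarrow> 'a::comm_monoid_mult"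
proof -
  have "set (up_positions bs) = {i. i < length bs \<and> bs ! i}" "set (down_positions bs) = {j. j < length bs \<and> \<not> bs ! j}"
    using up_positions_less down_positions_less by auto
  then show "(\<Prod>i\<leftarrow>up_positions bs. f i) = (\<Prod>i | i < length bs \<and> bs ! i. f i)"
    "(\<Prod>j\<leftarrow>down_positions bs. f j) = (\<Prod>j | j < length bs \<and> \<not> bs ! j. f j)"
    using prod.distinct_set_conv_list[OF distinct_positions(1)[of bs], of f]
      prod.distinct_set_conv_list[OF distinct_positions(2)[of bs], of f] by simp_all
qed

lemma inversions_snoc:
  "inversions (bs @ [b]) = inversions bs \<union> (if b then {} else (\<lambda>i. (i, length bs)) ` {i. i < length bs \<and> bs ! i})"
  unfolding inversions_def by (auto simp: nth_append less_Suc_eq)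

text \<open>A new letter multiplies from the left. A new \<open>Down_op 0\<close> crosses every
  \<open>Up_op\<close>, whose parameter plus one is the distance of the two positions, and then all
  size operators, which turn its parameter 0 into its own position.\<close>

theorem word_op_normal_order:
  "word_op bs = scale (\<Prod>(i, j)\<in>inversions bs. cross (j - i))
     (Up_list (up_exponents bs) * Size_op ^ length bs * Down_list (down_positions bs))"
proof (induction bs rule: rev_induct)
  case Nil
  show ?case by (simp add: word_op_simps inversions_def up_exponents_def up_positions_def down_positions_def
        Up_list_simps Down_list_simps scale_1)
next
  case (snoc b bs)
  define G where "G = (\<Prod>(i, j)\<in>inversions bs. cross (j - i))"
  define U where "U = Up_list (up_exponents bs)"
  define U' where "U' = Up_list (map Suc (up_exponents bs))"
  define D where "D = Down_list (down_positions bs)"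
  define k where "k = length bs"
  have SU: "Size_op * U = U' * Size_op" unfolding U_def U'_def by (rule Size_Up_list)
  show ?case
  proof (cases b)
    case True
    have "word_op (bs @ [b]) = scale G (Up_op 0 * (Size_op * U) * Size_op ^ k * D)"
      unfolding word_op_simps snoc letter_op_def using True
      by (simp add: scale_mult_right mult.assoc G_def U_def D_def k_def)
    also have "\<dots> = scale G ((Up_op 0 * U') * Size_op ^ Suc k * D)"
      unfolding SU by (simp add: mult.assoc)
    finally show ?thesis using True
      by (simp add: G_def U'_def D_def k_def inversions_snoc up_exponents_snoc positions_snoc Up_list_simps)
  next
    case False
    define c where "c = (\<Prod>a\<leftarrow>up_exponents bs. cross (Suc (a + 0)))"
    have "word_op (bs @ [b]) = scale G (Size_op * (Down_op 0 * U) * Size_op ^ k * D)"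
      unfolding word_op_simps snoc letter_op_def using False
      by (simp add: scale_mult_right mult.assoc G_def U_def D_def k_def)
    also have "\<dots> = scale (G * c) ((Size_op * U) * (Down_op 0 * Size_op ^ k) * D)"
      unfolding U_def Down_Up_list c_def[symmetric] by (simp add: scale_mult_left scale_mult_right scale_scale mult.assoc)
    also have "\<dots> = scale (G * c) (U' * Size_op ^ Suc k * (Down_op k * D))"
      unfolding SU Down_Size_power by (simp add: mult.assoc)
    also have "G * c = (\<Prod>(i, j)\<in>inversions (bs @ [b]). cross (j - i))"
    proof -
      have "c = (\<Prod>i\<leftarrow>up_positions bs. cross (length bs - i))"
        unfolding c_def up_exponents_def map_map
        by (intro arg_cong[where f = prod_list] map_cong refl) (auto simp: up_positions_less Suc_diff_Suc)
      also have "\<dots> = (\<Prod>i | i < length bs \<and> bs ! i. cross (length bs - i))" by (rule prod_list_positions)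
      also have "\<dots> = (\<Prod>(i, j)\<in>(\<lambda>i. (i, length bs)) ` {i. i < length bs \<and> bs ! i}. cross (j - i))"
        by (subst prod.reindex) (auto simp: inj_on_def)
      finally have c: "c = (\<Prod>(i, j)\<in>(\<lambda>i. (i, length bs)) ` {i. i < length bs \<and> bs ! i}. cross (j - i))" .
      have "inversions bs \<inter> (\<lambda>i. (i, length bs)) ` {i. i < length bs \<and> bs ! i} = {}"
        by (auto simp: inversions_def)
      then show ?thesis unfolding G_def c inversions_snoc using False
        by (subst prod.union_disjoint[OF finite_inversions]) auto
    qed
    finally show ?thesis using False
      by (simp add: U'_def D_def k_def up_exponents_snoc positions_snoc Down_list_simps)
  qed
qed

section \<open>Cyclicity of the trace\<close>

lemma entry_times_Size_power:
  "entry (A * Size_op ^ Suc k) x z = (if is_partition z then entry A x z * fps_X ^ (Suc k * sum_list z) else 0)"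
proof (induction k arbitrary: A)
  case 0
  show ?case by (simp add: entry_times_Size)
next
  case (Suc k)
  have eq: "A * Size_op ^ Suc (Suc k) = (A * Size_op) * Size_op ^ Suc k" by (simp add: mult.assoc)
  show ?case unfolding eq Suc entry_times_Size by (simp add: power_add mult_ac)
qed

text \<open>A positive power of \<open>Size_op\<close> bounds the column index, and column
  finiteness then bounds the row index.\<close>

lemma totally_finite_Size_power:
  assumes "T \<ge> 1"
  shows "totally_finite (A * Size_op ^ T)"
  unfolding totally_finite_def
proof
  fix n
  obtain k where T: "T = Suc k" using assms by (cases T) auto
  let ?M = "{mu. is_partition mu \<and> sum_list mu \<le> n}"
  have "total_support (A * Size_op ^ T) n \<subseteq> (\<Union>z\<in>?M. (\<lambda>x. (x, z)) ` column_support (entry (A * Size_op ^ T)) z n)"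
  proof
    fix p assume "p \<in> total_support (A * Size_op ^ T) n"
    then obtain x z i where p: "p = (x, z)" "i \<le> n" "fps_nth (entry (A * Size_op ^ T) x z) i \<noteq> 0"
      unfolding total_support_def by auto
    have "is_partition z" "Suc k * sum_list z \<le> i" using p(3) unfolding T entry_times_Size_power
      by (auto simp: fps_X_power_mult_right_nth not_le split: if_splits)
    then have "z \<in> ?M" using p(2) by simp
    moreover have "x \<in> column_support (entry (A * Size_op ^ T)) z n" using p unfolding column_support_def by blast
    ultimately show "p \<in> (\<Union>z\<in>?M. (\<lambda>x. (x, z)) ` column_support (entry (A * Size_op ^ T)) z n)"
      unfolding p(1) by - (rule UN_I, assumption, rule rev_image_eqI, assumption, rule refl)
  qed
  then show "finite (total_support (A * Size_op ^ T) n)"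
    by (rule finite_subset) (intro finite_UN_I finite_imageI finite_partitions_le finite_column_support)
qed

definition shifted_trace :: "bool list \<Rightarrow> nat \<Rightarrow> ratfun fps" where
  "shifted_trace bs c = colfin_trace (Up_list (up_exponents bs) * Size_op ^ length bs * Down_list (map (\<lambda>j. j + c) (down_positions bs)))"

definition lap_factor :: "bool list \<Rightarrow> nat \<Rightarrow> ratfun fps" where
  "lap_factor bs c = (\<Prod>j | j < length bs \<and> \<not> bs ! j. \<Prod>i | i < length bs \<and> bs ! i. cross (j + c + length bs - i))"

text \<open>The removing operators move cyclically to the front, cross all adding operators, and
  return through \<open>Size_op ^ length bs\<close>, which raises their parameters. Cyclicity
  applies because the rest of the product contains this power and is totally finite.\<close>

lemma shifted_trace_lap:
  assumes "bs \<noteq> []"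
  shows "shifted_trace bs c = lap_factor bs c * shifted_trace bs (c + length bs)"
proof -
  define U where "U = Up_list (up_exponents bs)"
  define D where "D = Down_list (map (\<lambda>j. j + c) (down_positions bs))"
  define D' where "D' = Down_list (map (\<lambda>j. j + (c + length bs)) (down_positions bs))"
  let ?T = "length bs"
  define X where "X = U * Size_op ^ ?T"
  have X: "totally_finite X" unfolding X_def by (rule totally_finite_Size_power) (use assms in \<open>simp add: Suc_le_eq\<close>)
  have DS: "D * Size_op ^ ?T = Size_op ^ ?T * D'"
    unfolding D_def D'_def Down_list_Size_power by (simp add: o_def add.assoc)
  have DU: "D * U = scale (lap_factor bs c) (U * D)"
  proof -
    have "(\<Prod>b\<leftarrow>map (\<lambda>j. j + c) (down_positions bs). \<Prod>a\<leftarrow>up_exponents bs. cross (Suc (a + b))) =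
        (\<Prod>j\<leftarrow>down_positions bs. \<Prod>i\<leftarrow>up_positions bs. cross (j + c + ?T - i))"
      unfolding up_exponents_def map_map o_def
      by (intro arg_cong[where f = prod_list] map_cong refl arg_cong[where f = cross]) (auto simp: up_positions_less)
    then show ?thesis unfolding D_def U_def Down_list_Up_list lap_factor_def prod_list_positions by simp
  qed
  have "shifted_trace bs c = colfin_trace (X * D)" unfolding shifted_trace_def X_def U_def D_def ..
  also have "\<dots> = colfin_trace (D * X)" by (rule trace_commute[OF X])
  also have "D * X = scale (lap_factor bs c) (X * D')"
    unfolding X_def mult.assoc[symmetric] DU scale_mult_left
    by (simp add: mult.assoc DS)
  also have "colfin_trace \<dots> = lap_factor bs c * colfin_trace (X * D')" by (rule trace_scale[OF X])
  finally show ?thesis unfolding shifted_trace_def X_def U_def D'_def .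
qed

lemma trace_word_op:
  assumes "bs \<noteq> []"
  shows "colfin_trace (word_op bs) = (\<Prod>(i, j)\<in>inversions bs. cross (j - i)) *
    (\<Prod>n<N. lap_factor bs (n * length bs)) * shifted_trace bs (N * length bs)"
proof -
  have "totally_finite (Up_list (up_exponents bs) * Size_op ^ length bs)"
    by (rule totally_finite_Size_power) (use assms in \<open>simp add: Suc_le_eq\<close>)
  then have "colfin_trace (word_op bs) = (\<Prod>(i, j)\<in>inversions bs. cross (j - i)) * shifted_trace bs 0"
    unfolding word_op_normal_order shifted_trace_def by (subst trace_scale) simp_all
  moreover have "shifted_trace bs 0 = (\<Prod>n<N. lap_factor bs (n * length bs)) * shifted_trace bs (N * length bs)"
  proof (induction N)
    case (Suc N)
    have "shifted_trace bs (N * length bs) = lap_factor bs (N * length bs) * shifted_trace bs (Suc N * length bs)"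
      using shifted_trace_lap[OF assms, of "N * length bs"] by (simp add: add.commute)
    then show ?case unfolding Suc by (simp add: mult_ac)
  qed simp
  ultimately show ?thesis by (simp add: mult.assoc)
qed

section \<open>The trace after many laps\<close>

lemma Up_list_triangular:
  assumes "fps_nth (entry (Up_list as) lam mu) k \<noteq> 0"
  shows "sum_list mu \<le> sum_list lam \<and> (sum_list lam \<le> sum_list mu \<longrightarrow> lam = mu)"
  using assms
proof (induction as arbitrary: lam k)
  case Nil
  then show ?case by (auto simp: Up_list_simps entry_one split: if_splits)
next
  case (Cons a as)
  obtain nu i where nu: "fps_nth (entry (Up_op a) lam nu) i \<noteq> 0" "fps_nth (entry (Up_list as) nu mu) (k - i) \<noteq> 0"
    using times_nth_neq_0[OF Cons.prems[unfolded Up_list_simps]] .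
  have "strip lam nu" using nu(1) by (auto simp: entry_Up split: if_splits)
  note s = strip_size[OF this] and IH = Cons.IH[OF nu(2)]
  show ?case
  proof (intro conjI impI)
    show "sum_list mu \<le> sum_list lam" using s(1) IH by linarith
    assume "sum_list lam \<le> sum_list mu"
    then have "lam = nu" "nu = mu" using s IH by auto
    then show "lam = mu" by simp
  qed
qed

lemma Up_list_diagonal:
  assumes "is_partition mu"
  shows "entry (Up_list as) mu mu = 1"
proof (induction as)
  case (Cons a as)
  show ?case
  proof (rule fps_ext)
    fix n
    have "fps_nth (entry (Up_op a * Up_list as) mu mu) n = fps_nth (entry (Up_op a) mu mu * entry (Up_list as) mu mu) n"
    proof (rule times_nth_single)
      fix nu i assume nu: "nu \<noteq> mu" "fps_nth (entry (Up_op a) mu nu) i \<noteq> 0" "fps_nth (entry (Up_list as) nu mu) (n - i) \<noteq> 0"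
      have "strip mu nu" using nu(2) by (auto simp: entry_Up split: if_splits)
      then show False using strip_size(1) Up_list_triangular[OF nu(3)] nu(1) by auto
    qed
    then show "fps_nth (entry (Up_list (a # as)) mu mu) n = fps_nth 1 n"
      unfolding Up_list_simps using Cons assms by (simp add: entry_Up strip_refl phi_refl)
  qed
qed (simp add: Up_list_simps entry_one)

text \<open>With parameters above \<open>m\<close>, removing a single box already exceeds the
  exponent \<open>m\<close>; to this order the operators act as the identity on partitions.\<close>

lemma Down_list_large:
  assumes "\<And>b. b \<in> set bs \<Longrightarrow> m < b" "is_partition mu" "k \<le> m"
  shows "fps_nth (entry (Down_list bs) lam mu) k = (if lam = mu \<and> k = 0 then 1 else 0)"
  using assms(1,3)
proof (induction bs arbitrary: lam k)
  case Nil
  then show ?case by (auto simp: Down_list_simps entry_one)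
next
  case (Cons b bs)
  have IH: "fps_nth (entry (Down_list bs) nu mu) i = (if nu = mu \<and> i = 0 then 1 else 0)" if "i \<le> m" for nu i
    using Cons.IH Cons.prems(1) that by simp
  have b: "m < b" using Cons.prems by simp
  have "fps_nth (entry (Down_op b * Down_list bs) lam mu) k = fps_nth (entry (Down_op b) lam mu * entry (Down_list bs) mu mu) k"
  proof (rule times_nth_single)
    fix nu i assume "i \<le> k" "nu \<noteq> mu" "fps_nth (entry (Down_list bs) nu mu) (k - i) \<noteq> 0"
    then show False using IH[of "k - i" nu] Cons.prems(2) by simp
  qed
  also have "\<dots> = (\<Sum>i=0..k. fps_nth (entry (Down_op b) lam mu) i * (if k - i = 0 then 1 else 0))"
    unfolding fps_mult_nth by (rule sum.cong[OF refl]) (use IH Cons.prems(2) in simp)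
  also have "\<dots> = (\<Sum>i\<in>{k}. fps_nth (entry (Down_op b) lam mu) i)"
    by (rule sum.mono_neutral_cong_right) auto
  also have "\<dots> = (if lam = mu \<and> k = 0 then 1 else 0)"
  proof (cases "strip mu lam")
    case True
    show ?thesis
    proof (cases "lam = mu")
      case True
      then show ?thesis using \<open>strip mu lam\<close> by (simp add: entry_Down psi_refl)
    next
      case False
      then have "0 < sum_list mu - sum_list lam" using strip_size(2)[OF True] by (cases "sum_list mu \<le> sum_list lam") auto
      then have "b * 1 \<le> b * (sum_list mu - sum_list lam)" by (intro mult_le_mono2) simp
      then have "k \<noteq> b * (sum_list mu - sum_list lam)" using b Cons.prems(2) by linarith
      then show ?thesis using True False by (simp add: entry_Down)
    qed
  next
    case False
    then have "lam \<noteq> mu" using strip_refl assms(2) by blast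
    then show ?thesis using False by (simp add: entry_Down)
  qed
  finally show ?case unfolding Down_list_simps .
qed

lemma Down_list_partition:
  assumes "fps_nth (entry (Down_list bs) lam mu) k \<noteq> 0" "is_partition lam"
  shows "is_partition mu"
  using assms
proof (induction bs arbitrary: lam k)
  case Nil
  then show ?case by (auto simp: Down_list_simps entry_one split: if_splits)
next
  case (Cons b bs)
  obtain nu i where nu: "fps_nth (entry (Down_op b) lam nu) i \<noteq> 0" "fps_nth (entry (Down_list bs) nu mu) (k - i) \<noteq> 0"
    using times_nth_neq_0[OF Cons.prems(1)[unfolded Down_list_simps]] .
  have "is_partition nu" using nu(1) by (auto simp: entry_Down strip_def split: if_splits)
  then show ?case using Cons.IH[OF nu(2)] by blast
qed

definition partition_gf :: "nat \<Rightarrow> ratfun fps" where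
  "partition_gf T = spread (\<lambda>k. of_nat (card {mu. is_partition mu \<and> sum_list mu = k})) T"

text \<open>Once the removing operators act as the identity, only the diagonal of the adding part
  enters, and that diagonal is 1. What remains is the trace of a power of the size operator.\<close>

lemma shifted_trace_large:
  assumes "bs \<noteq> []" "m < c"
  shows "fps_nth (shifted_trace bs c) m = fps_nth (partition_gf (length bs)) m"
proof -
  obtain k where T: "length bs = Suc k" using assms(1) by (cases bs) auto
  define U where "U = Up_list (up_exponents bs)"
  define D where "D = Down_list (map (\<lambda>j. j + c) (down_positions bs))"
  have D: "fps_nth (entry D lam mu) i = (if lam = mu \<and> i = 0 then 1 else 0)" if "is_partition mu" "i \<le> m" for lam mu i
    unfolding D_def by (rule Down_list_large) (use that assms(2) in auto)
  \<comment> \<open>An empty list of operators gives the identity on all lists; the size operators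
    discard those that are not partitions.\<close>
  have zero: "fps_nth (entry (U * Size_op ^ Suc k * D) mu mu) m = 0" if "\<not> is_partition mu" for mu
  proof (rule ccontr)
    assume "fps_nth (entry (U * Size_op ^ Suc k * D) mu mu) m \<noteq> 0"
    then obtain nu i where nu: "fps_nth (entry (U * Size_op ^ Suc k) mu nu) i \<noteq> 0" "fps_nth (entry D nu mu) (m - i) \<noteq> 0"
      by (rule times_nth_neq_0)
    have "is_partition nu" using nu(1) unfolding entry_times_Size_power by (auto split: if_splits)
    then show False using Down_list_partition nu(2) that unfolding D_def by blast
  qed
  have diag: "fps_nth (entry (U * Size_op ^ Suc k * D) mu mu) m = (if m = Suc k * sum_list mu then 1 else 0)"
    if mu: "is_partition mu" for mu
  proof -
    have "fps_nth (entry (U * Size_op ^ Suc k * D) mu mu) m = fps_nth (entry (U * Size_op ^ Suc k) mu mu * entry D mu mu) m"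
    proof (rule times_nth_single)
      fix nu i assume "i \<le> m" "nu \<noteq> mu" "fps_nth (entry D nu mu) (m - i) \<noteq> 0"
      then show False using D[OF mu, of "m - i" nu] by simp
    qed
    also have "entry (U * Size_op ^ Suc k) mu mu = fps_X ^ (Suc k * sum_list mu)"
      unfolding entry_times_Size_power U_def using mu by (simp add: Up_list_diagonal del: mult_Suc)
    also have "fps_nth (fps_X ^ (Suc k * sum_list mu) * entry D mu mu) m = (if m = Suc k * sum_list mu then 1 else 0)"
      using D[OF mu, of "m - Suc k * sum_list mu" mu] unfolding fps_X_power_mult_nth
      by (auto simp del: mult_Suc)
    finally show ?thesis .
  qed
  let ?M = "{mu. is_partition mu \<and> sum_list mu \<le> m}"
  have "fps_nth (shifted_trace bs c) m = (\<Sum>mu\<in>?M. fps_nth (entry (U * Size_op ^ Suc k * D) mu mu) m)"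
    unfolding shifted_trace_def U_def[symmetric] D_def[symmetric] T
  proof (rule trace_nth[OF finite_partitions_le])
    fix mu assume ne: "fps_nth (entry (U * Size_op ^ Suc k * D) mu mu) m \<noteq> 0"
    have mu: "is_partition mu" using zero ne by blast
    then have "m = Suc k * sum_list mu" using diag[OF mu] ne by (simp split: if_splits)
    then show "mu \<in> ?M" using mu by simp
  qed
  also have "\<dots> = (\<Sum>mu\<in>?M. if m = Suc k * sum_list mu then 1 else 0)"
    by (rule sum.cong[OF refl]) (use diag in simp)
  also have "\<dots> = of_nat (card (?M \<inter> {mu. m = Suc k * sum_list mu}))"
    using finite_partitions_le by (simp add: sum.If_cases del: mult_Suc)
  also have "\<dots> = fps_nth (partition_gf (Suc k)) m"
  proof (cases "Suc k dvd m")
    case True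
    then obtain r where r: "m = Suc k * r" by blast
    have "?M \<inter> {mu. m = Suc k * sum_list mu} = {mu. is_partition mu \<and> sum_list mu = r}"
      unfolding r by (auto simp del: mult_Suc)
    moreover have "m div Suc k = r" unfolding r by (rule nonzero_mult_div_cancel_left) simp
    ultimately show ?thesis using True by (simp add: partition_gf_def spread_def)
  next
    case False
    then have "?M \<inter> {mu. m = Suc k * sum_list mu} = {}" by (auto simp del: mult_Suc)
    then show ?thesis using False by (simp add: partition_gf_def spread_def)
  qed
  finally show ?thesis unfolding T .
qed

section \<open>Generating functions of partitions and of cylindric plane partitions\<close>

definition bounded_partitions :: "nat \<Rightarrow> nat \<Rightarrow> nat list set" where
  "bounded_partitions N k = {mu. is_partition mu \<and> (\<forall>x\<in>set mu. x \<le> N) \<and> sum_list mu = k}"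

lemma finite_bounded_partitions: "finite (bounded_partitions N k)"
  by (rule finite_subset[OF _ finite_partitions_le[of k]]) (auto simp: bounded_partitions_def)

lemma is_partition_Cons: "is_partition (a # mu) \<longleftrightarrow> 0 < a \<and> (\<forall>x\<in>set mu. x \<le> a) \<and> is_partition mu"
  unfolding is_partition_def by auto

text \<open>Distinguishes whether the largest part is \<open>Suc N\<close>; if so, one copy of it is
  removed.\<close>

lemma bounded_partitions_Suc:
  "bounded_partitions (Suc N) k = bounded_partitions N k \<union>
     (if Suc N \<le> k then (\<lambda>mu. Suc N # mu) ` bounded_partitions (Suc N) (k - Suc N) else {})"
proof (rule set_eqI)
  fix mu
  show "mu \<in> bounded_partitions (Suc N) k \<longleftrightarrow> mu \<in> bounded_partitions N k \<union>
     (if Suc N \<le> k then (\<lambda>mu. Suc N # mu) ` bounded_partitions (Suc N) (k - Suc N) else {})"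
  proof (cases mu)
    case Nil
    then show ?thesis by (auto simp: bounded_partitions_def)
  next
    case (Cons a nu)
    show ?thesis
    proof (cases "a = Suc N")
      case True
      then show ?thesis unfolding Cons by (auto simp: bounded_partitions_def is_partition_Cons image_iff)
    next
      case False
      then show ?thesis unfolding Cons by (auto simp: bounded_partitions_def is_partition_Cons image_iff)
    qed
  qed
qed

lemma card_bounded_partitions_Suc:
  "card (bounded_partitions (Suc N) k) = card (bounded_partitions N k) +
     (if Suc N \<le> k then card (bounded_partitions (Suc N) (k - Suc N)) else 0)"
proof -
  have "Suc N # mu \<notin> bounded_partitions N k" for mu by (auto simp: bounded_partitions_def)
  then have "bounded_partitions N k \<inter> (\<lambda>mu. Suc N # mu) ` bounded_partitions (Suc N) (k - Suc N) = {}" by auto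
  moreover have "inj_on (\<lambda>mu. Suc N # mu) A" for A by (auto simp: inj_on_def)
  ultimately show ?thesis
    by (subst bounded_partitions_Suc) (simp add: card_Un_disjoint finite_bounded_partitions card_image)
qed

definition bounded_gf :: "nat \<Rightarrow> nat \<Rightarrow> ratfun fps" where
  "bounded_gf T N = spread (\<lambda>k. of_nat (card (bounded_partitions N k))) T"

lemma one_minus_X_power_nonzero: "0 < e \<Longrightarrow> fps_nth (1 - fps_X ^ e :: ratfun fps) 0 \<noteq> 0"
  by simp

lemma bounded_gf_Suc:
  assumes "T > 0"
  shows "bounded_gf T (Suc N) = bounded_gf T N * (1 / (1 - fps_X ^ (Suc N * T)))"
proof -
  let ?e = "Suc N * T"
  have e: "0 < ?e" using assms by simp
  have "bounded_gf T (Suc N) = bounded_gf T N + bounded_gf T (Suc N) * fps_X ^ ?e"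
  proof (rule fps_ext)
    fix n
    have "T dvd n - ?e \<longleftrightarrow> T dvd n" if "?e \<le> n"
      using dvd_diff_nat[of T n ?e] dvd_diffD[of T n ?e] that by (metis dvd_triv_right)
    moreover have "(n - ?e) div T = n div T - Suc N" if "?e \<le> n" "T dvd n"
    proof -
      from that(2) obtain r where r: "n = T * r" by blast
      have "n - ?e = T * (r - Suc N)" unfolding r by (simp only: right_diff_distrib' mult.commute)
      then show ?thesis using assms r by (metis nonzero_mult_div_cancel_left less_numeral_extra(3))
    qed
    moreover have "?e \<le> n \<longleftrightarrow> Suc N \<le> n div T" if "T dvd n"
      using less_eq_div_iff_mult_less_eq[OF assms, of "Suc N" n] by simp
    ultimately show "fps_nth (bounded_gf T (Suc N)) n =
        fps_nth (bounded_gf T N + bounded_gf T (Suc N) * fps_X ^ ?e) n"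
      unfolding fps_add_nth fps_X_power_mult_right_nth bounded_gf_def spread_def fps_nth_Abs_fps
        card_bounded_partitions_Suc[of N "n div T"]
      by (cases "?e \<le> n") (auto simp del: mult_Suc)
  qed
  then have "bounded_gf T (Suc N) * (1 - fps_X ^ ?e) = bounded_gf T N"
    by (simp only: right_diff_distrib mult_1_right diff_eq_eq)
  then have "bounded_gf T N * inverse (1 - fps_X ^ ?e) = bounded_gf T (Suc N) * ((1 - fps_X ^ ?e) * inverse (1 - fps_X ^ ?e))"
    by (simp only: mult.assoc[symmetric])
  then show ?thesis using inverse_mult_eq_1'[OF one_minus_X_power_nonzero[OF e]]
    by (simp add: fps_divide_unit[OF one_minus_X_power_nonzero[OF e]] del: mult_Suc)
qed

lemma bounded_gf_prod:
  assumes "T > 0"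
  shows "(\<Prod>n<N. 1 / (1 - fps_X ^ ((n + 1) * T))) = bounded_gf T N"
proof (induction N)
  case 0
  have "mu \<in> bounded_partitions 0 k \<longleftrightarrow> mu = [] \<and> k = 0" for mu k
    by (cases mu) (auto simp: bounded_partitions_def is_partition_Cons, auto simp: is_partition_def)
  then have "bounded_partitions 0 k = (if k = 0 then {[]} else {})" for k by auto
  then have "bounded_gf T 0 = 1" unfolding bounded_gf_def spread_def
    by (intro fps_ext) (use assms in \<open>auto simp: dvd_div_eq_0_iff\<close>)
  then show ?case by simp
next
  case (Suc N)
  then show ?case using bounded_gf_Suc[OF assms, of N] by simp
qed

text \<open>A partition of \<open>m div T\<close> has no part larger than \<open>m\<close>, so the
  bound \<open>N\<close> is invisible up to this exponent.\<close>

lemma bounded_gf_nth: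
  assumes "T > 0" "m \<le> N"
  shows "fps_nth (bounded_gf T N) m = fps_nth (partition_gf T) m"
proof -
  have "bounded_partitions N (m div T) = {mu. is_partition mu \<and> sum_list mu = m div T}"
  proof -
    have "x \<le> N" if "x \<in> set mu" "sum_list mu = m div T" for x and mu :: "nat list"
      using member_le_sum_list[OF that(1)] that(2) assms(2) div_le_dividend[of m T] by linarith
    then show ?thesis unfolding bounded_partitions_def by blast
  qed
  then show ?thesis by (simp add: bounded_gf_def partition_gf_def spread_def)
qed

section \<open>Sequences of interlacing partitions as paths\<close>

definition step_ok :: "bool \<Rightarrow> nat list \<Rightarrow> nat list \<Rightarrow> bool" where
  "step_ok b mu lam = (if b then horizontal_strip lam mu else horizontal_strip mu lam)"

definition step_weight :: "bool \<Rightarrow> nat list \<Rightarrow> nat list \<Rightarrow> ratfun" where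
  "step_weight b mu lam = (if b then phi q_var t_var lam mu else psi q_var t_var mu lam)"

definition is_path :: "bool list \<Rightarrow> nat list list \<Rightarrow> bool" where
  "is_path bs c \<longleftrightarrow> length c = length bs + 1 \<and> (\<forall>mu\<in>set c. is_partition mu) \<and>
     (\<forall>k<length bs. step_ok (bs ! k) (c ! k) (c ! Suc k))"

lemma CPP_eq: "CPP bs = {c. is_path bs c \<and> c ! 0 = c ! length bs}"
proof -
  have "(\<forall>k\<in>{1..length bs}. if bs ! (k - 1) then horizontal_strip (c ! k) (c ! (k - 1))
        else horizontal_strip (c ! (k - 1)) (c ! k)) \<longleftrightarrow>
      (\<forall>k<length bs. step_ok (bs ! k) (c ! k) (c ! Suc k))" for c
  proof -
    have "{1..length bs} = Suc ` {..<length bs}" by (simp add: image_Suc_lessThan)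
    then show ?thesis unfolding step_ok_def by auto
  qed
  then show ?thesis unfolding CPP_def is_path_def by auto
qed

lemma cpp_weight_eq: "cpp_weight q_var t_var bs c = (\<Prod>k<length bs. step_weight (bs ! k) (c ! k) (c ! Suc k))"
proof -
  have "cpp_weight q_var t_var bs c = (\<Prod>k\<in>{1..length bs}. if bs ! (k - 1) then phi q_var t_var (c ! k) (c ! (k - 1))
     else psi q_var t_var (c ! (k - 1)) (c ! k))"
    unfolding cpp_weight_def by (subst prod.If_cases) (auto simp: Int_def)
  also have "\<dots> = (\<Prod>k<length bs. step_weight (bs ! k) (c ! k) (c ! Suc k))"
    by (rule prod.reindex_bij_witness[of _ Suc "\<lambda>k. k - 1"]) (auto simp: step_weight_def)
  finally show ?thesis .
qed

lemma is_path_snoc: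
  assumes "length c = length bs + 1"
  shows "is_path (bs @ [b]) (c @ [lam]) \<longleftrightarrow> is_path bs c \<and> is_partition lam \<and> step_ok b (c ! length bs) lam"
proof -
  have 1: "step_ok ((bs @ [b]) ! k) ((c @ [lam]) ! k) ((c @ [lam]) ! Suc k) \<longleftrightarrow> step_ok (bs ! k) (c ! k) (c ! Suc k)"
    if "k < length bs" for k using assms that by (simp add: nth_append)
  have 2: "step_ok ((bs @ [b]) ! length bs) ((c @ [lam]) ! length bs) ((c @ [lam]) ! Suc (length bs)) \<longleftrightarrow>
      step_ok b (c ! length bs) lam" using assms by (simp add: nth_append)
  have "(\<forall>k<length (bs @ [b]). step_ok ((bs @ [b]) ! k) ((c @ [lam]) ! k) ((c @ [lam]) ! Suc k)) \<longleftrightarrow>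
      (\<forall>k<length bs. step_ok (bs ! k) (c ! k) (c ! Suc k)) \<and> step_ok b (c ! length bs) lam"
    using 1 2 by (auto simp only: length_append_singleton All_less_Suc)
  then show ?thesis unfolding is_path_def using assms by auto
qed

lemma cpp_weight_snoc:
  assumes "length c = length bs + 1"
  shows "cpp_weight q_var t_var (bs @ [b]) (c @ [lam]) = cpp_weight q_var t_var bs c * step_weight b (c ! length bs) lam"
  using assms unfolding cpp_weight_eq by (simp add: nth_append)

lemma cpp_size_snoc: "length c > 0 \<Longrightarrow> cpp_size (c @ [lam]) = cpp_size c + sum_list lam"
proof -
  assume "length c > 0"
  then have "{1..<Suc (length c)} = insert (length c) {1..<length c}" by (auto simp: Suc_le_eq)
  then show ?thesis unfolding cpp_size_def by (simp add: nth_append)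
qed

definition paths :: "bool list \<Rightarrow> nat list \<Rightarrow> nat \<Rightarrow> nat list list set" where
  "paths bs mu n = {c. is_path bs c \<and> c ! 0 = mu \<and> cpp_size c = n}"

lemma path_bound:
  assumes "c \<in> paths bs mu n" "nu \<in> set c"
  shows "is_partition nu \<and> sum_list nu \<le> n + sum_list mu"
proof -
  have c: "length c = length bs + 1" "is_partition nu" "c ! 0 = mu" "(\<Sum>k\<in>{1..<length c}. sum_list (c ! k)) = n"
    using assms unfolding paths_def is_path_def cpp_size_def by auto
  obtain k where k: "k < length c" "c ! k = nu" using assms(2) by (metis in_set_conv_nth)
  show ?thesis
  proof (cases "k = 0")
    case False
    then have "sum_list (c ! k) \<le> (\<Sum>k\<in>{1..<length c}. sum_list (c ! k))"
      using k by (intro member_le_sum) auto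
    then show ?thesis using c k by simp
  qed (use c k in simp)
qed

lemma finite_paths: "finite (paths bs mu n)"
proof (rule finite_subset[OF _ finite_lists_length_eq[of "{nu. is_partition nu \<and> sum_list nu \<le> n + sum_list mu}" "length bs + 1"]])
  show "paths bs mu n \<subseteq> {c. set c \<subseteq> {nu. is_partition nu \<and> sum_list nu \<le> n + sum_list mu} \<and> length c = length bs + 1}"
  proof
    fix c assume c: "c \<in> paths bs mu n"
    then have "length c = length bs + 1" unfolding paths_def is_path_def by blast
    then show "c \<in> {c. set c \<subseteq> {nu. is_partition nu \<and> sum_list nu \<le> n + sum_list mu} \<and> length c = length bs + 1}"
      using path_bound[OF c] by blast
  qed
qed (rule finite_partitions_le)

lemma entry_letter_op: "entry (letter_op b) lam nu =
  (if is_partition lam \<and> is_partition nu \<and> step_ok b nu lam then fps_const (step_weight b nu lam) * fps_X ^ sum_list lam else 0)"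
proof (cases b)
  case True
  show ?thesis
  proof (cases "strip lam nu")
    case s: True
    have "sum_list lam = (sum_list lam - sum_list nu) + sum_list nu" using strip_size(1)[OF s] by simp
    then have "fps_X ^ (sum_list lam - sum_list nu) * fps_X ^ sum_list nu = (fps_X ^ sum_list lam :: ratfun fps)"
      by (metis power_add)
    then show ?thesis using True s
      by (simp add: letter_op_def entry_times_Size entry_Up step_ok_def step_weight_def strip_def mult.assoc)
  qed (use True in \<open>auto simp: letter_op_def entry_times_Size entry_Up step_ok_def strip_def\<close>)
next
  case False
  then show ?thesis
    by (auto simp: letter_op_def entry_Size_times entry_Down step_ok_def step_weight_def strip_def mult.commute)
qed

text \<open>Transfer matrix principle: expanding the matrix product lists the intermediate
  partitions. Each letter records the partition it produces, so the initial one is not counted, in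
  agreement with \<open>cpp_size\<close>.\<close>

theorem entry_word_op:
  assumes "is_partition mu"
  shows "fps_nth (entry (word_op bs) lam mu) n =
    (\<Sum>c | c \<in> paths bs mu n \<and> c ! length bs = lam. cpp_weight q_var t_var bs c)"
proof (induction bs arbitrary: lam n rule: rev_induct)
  case Nil
  have "{c. c \<in> paths [] mu n \<and> c ! length [] = lam} = (if lam = mu \<and> n = 0 then {[mu]} else {})"
    unfolding paths_def is_path_def cpp_size_def using assms by (auto simp: length_Suc_conv)
  then show ?case by (simp add: word_op_simps entry_one cpp_weight_eq)
next
  case (snoc b bs)
  define Y where "Y = {nu. is_partition nu \<and> sum_list nu \<le> n + sum_list mu}"
  have finY: "finite Y" unfolding Y_def by (rule finite_partitions_le)
  have mem: "c ! length bs \<in> Y" if "c \<in> paths bs mu k" "k \<le> n" for c k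
  proof -
    have "c ! length bs \<in> set c" using that unfolding paths_def is_path_def by auto
    then show ?thesis using path_bound[OF that(1)] that(2) unfolding Y_def by force
  qed
  have sub: "column_support (entry (word_op bs)) mu n \<subseteq> Y"
  proof
    fix nu assume "nu \<in> column_support (entry (word_op bs)) mu n"
    then obtain k where k: "k \<le> n" "fps_nth (entry (word_op bs) nu mu) k \<noteq> 0" unfolding column_support_def by blast
    then have "(\<Sum>c | c \<in> paths bs mu k \<and> c ! length bs = nu. cpp_weight q_var t_var bs c) \<noteq> 0" using snoc by simp
    then have "{c. c \<in> paths bs mu k \<and> c ! length bs = nu} \<noteq> {}" by (metis sum.empty)
    then show "nu \<in> Y" using mem k(1) by blast
  qed
  let ?s = "sum_list lam"
  have e: "fps_nth (entry (letter_op b) lam nu * entry (word_op bs) nu mu) n =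
      (if is_partition lam \<and> step_ok b nu lam \<and> ?s \<le> n then
         (\<Sum>c | c \<in> paths bs mu (n - ?s) \<and> c ! length bs = nu. cpp_weight q_var t_var bs c * step_weight b nu lam) else 0)"
    if "nu \<in> Y" for nu
  proof -
    have p: "is_partition nu" using that unfolding Y_def by blast
    show ?thesis
    proof (cases "is_partition lam \<and> step_ok b nu lam")
      case True
      have "fps_nth (entry (letter_op b) lam nu * entry (word_op bs) nu mu) n =
          step_weight b nu lam * fps_nth (fps_X ^ ?s * entry (word_op bs) nu mu) n"
        unfolding entry_letter_op using True p by (simp add: mult.assoc)
      then show ?thesis using True by (simp add: fps_X_power_mult_nth snoc sum_distrib_left mult.commute not_le)
    qed (auto simp: entry_letter_op)
  qed
  have "fps_nth (entry (word_op (bs @ [b])) lam mu) n =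
      (\<Sum>nu\<in>Y. fps_nth (entry (letter_op b) lam nu * entry (word_op bs) nu mu) n)"
    unfolding word_op_simps by (rule times_nth[OF finY sub])
  also have "\<dots> = (\<Sum>nu\<in>Y. if is_partition lam \<and> step_ok b nu lam \<and> ?s \<le> n then
         (\<Sum>c | c \<in> paths bs mu (n - ?s) \<and> c ! length bs = nu. cpp_weight q_var t_var bs c * step_weight b nu lam) else 0)"
    by (rule sum.cong[OF refl e])
  also have "\<dots> = (\<Sum>c | c \<in> paths (bs @ [b]) mu n \<and> c ! length (bs @ [b]) = lam. cpp_weight q_var t_var (bs @ [b]) c)"
  proof (cases "is_partition lam \<and> ?s \<le> n")
    case True
    \<comment> \<open>Dropping the final \<open>lam\<close> gives a bijection with shorter paths,
      which are then grouped by their endpoint \<open>nu\<close>.\<close>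
    define S where "S = {c \<in> paths bs mu (n - ?s). step_ok b (c ! length bs) lam}"
    have finS: "finite S" unfolding S_def using finite_paths by simp
    have img: "{c. c \<in> paths (bs @ [b]) mu n \<and> c ! length (bs @ [b]) = lam} = (\<lambda>c. c @ [lam]) ` S"
    proof
      show "{c. c \<in> paths (bs @ [b]) mu n \<and> c ! length (bs @ [b]) = lam} \<subseteq> (\<lambda>c. c @ [lam]) ` S"
      proof
        fix c' assume c': "c' \<in> {c. c \<in> paths (bs @ [b]) mu n \<and> c ! length (bs @ [b]) = lam}"
        then have len: "length c' = Suc (length bs + 1)" unfolding paths_def is_path_def by simp
        then obtain c x where cx: "c' = c @ [x]" "length c = length bs + 1" by (metis length_append_singleton length_Suc_conv_rev nat.inject)
        have x: "x = lam" using c' cx by (simp add: nth_append)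
        have "is_path bs c \<and> is_partition lam \<and> step_ok b (c ! length bs) lam" "c ! 0 = mu" "cpp_size c + ?s = n"
          using c' is_path_snoc[OF cx(2)] cpp_size_snoc[of c lam] cx unfolding paths_def x by (auto simp: nth_append)
        then have "c \<in> S" unfolding S_def paths_def by auto
        then show "c' \<in> (\<lambda>c. c @ [lam]) ` S" unfolding cx x by blast
      qed
      show "(\<lambda>c. c @ [lam]) ` S \<subseteq> {c. c \<in> paths (bs @ [b]) mu n \<and> c ! length (bs @ [b]) = lam}"
      proof
        fix c' assume "c' \<in> (\<lambda>c. c @ [lam]) ` S"
        then obtain c where c: "c' = c @ [lam]" "is_path bs c" "c ! 0 = mu" "cpp_size c = n - ?s" "step_ok b (c ! length bs) lam"
          unfolding S_def paths_def by auto
        have len: "length c = length bs + 1" using c(2) unfolding is_path_def by blast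
        show "c' \<in> {c. c \<in> paths (bs @ [b]) mu n \<and> c ! length (bs @ [b]) = lam}"
          using c True is_path_snoc[OF len, of b lam] cpp_size_snoc[of c lam] len unfolding paths_def
          by (auto simp: nth_append)
      qed
    qed
    have "(\<Sum>c | c \<in> paths (bs @ [b]) mu n \<and> c ! length (bs @ [b]) = lam. cpp_weight q_var t_var (bs @ [b]) c) =
        (\<Sum>c\<in>S. cpp_weight q_var t_var (bs @ [b]) (c @ [lam]))"
      unfolding img by (subst sum.reindex) (auto simp: inj_on_def)
    also have "\<dots> = (\<Sum>c\<in>S. cpp_weight q_var t_var bs c * step_weight b (c ! length bs) lam)"
    proof (rule sum.cong[OF refl])
      fix c assume "c \<in> S"
      then have "length c = length bs + 1" unfolding S_def paths_def is_path_def by simp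
      then show "cpp_weight q_var t_var (bs @ [b]) (c @ [lam]) = cpp_weight q_var t_var bs c * step_weight b (c ! length bs) lam"
        by (rule cpp_weight_snoc)
    qed
    also have "\<dots> = (\<Sum>nu\<in>Y. \<Sum>c\<in>{c \<in> S. c ! length bs = nu}. cpp_weight q_var t_var bs c * step_weight b (c ! length bs) lam)"
      by (rule sum.group[OF finS finY, symmetric]) (use mem in \<open>auto simp: S_def\<close>)
    also have "\<dots> = (\<Sum>nu\<in>Y. if is_partition lam \<and> step_ok b nu lam \<and> ?s \<le> n then
         (\<Sum>c | c \<in> paths bs mu (n - ?s) \<and> c ! length bs = nu. cpp_weight q_var t_var bs c * step_weight b nu lam) else 0)"
    proof (rule sum.cong[OF refl])
      fix nu
      have "{c \<in> S. c ! length bs = nu} = (if step_ok b nu lam then {c. c \<in> paths bs mu (n - ?s) \<and> c ! length bs = nu} else {})"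
        unfolding S_def by auto
      then show "(\<Sum>c\<in>{c \<in> S. c ! length bs = nu}. cpp_weight q_var t_var bs c * step_weight b (c ! length bs) lam) =
        (if is_partition lam \<and> step_ok b nu lam \<and> ?s \<le> n then
         (\<Sum>c | c \<in> paths bs mu (n - ?s) \<and> c ! length bs = nu. cpp_weight q_var t_var bs c * step_weight b nu lam) else 0)"
        using True by auto
    qed
    finally show ?thesis by simp
  next
    case False
    \<comment> \<open>The endpoint is a partition that counts towards the size, so here there are no
      paths, and every summand on the other side vanishes too.\<close>
    have empty: "{c. c \<in> paths (bs @ [b]) mu n \<and> c ! length (bs @ [b]) = lam} = {}"
    proof (rule ccontr)
      assume "{c. c \<in> paths (bs @ [b]) mu n \<and> c ! length (bs @ [b]) = lam} \<noteq> {}"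
      then obtain c where c: "is_path (bs @ [b]) c" "cpp_size c = n" "c ! length (bs @ [b]) = lam" unfolding paths_def by blast
      have len: "length c = length (bs @ [b]) + 1" using c(1) unfolding is_path_def by blast
      then have "lam \<in> set c" using c(3) by (metis less_add_one nth_mem)
      then have "is_partition lam" using c(1) unfolding is_path_def by blast
      moreover have "sum_list (c ! length (bs @ [b])) \<le> (\<Sum>k\<in>{1..<length c}. sum_list (c ! k))"
        by (rule member_le_sum) (use len in auto)
      ultimately show False using False c(2,3) unfolding cpp_size_def by simp
    qed
    have "(\<Sum>nu\<in>Y. if is_partition lam \<and> step_ok b nu lam \<and> ?s \<le> n then
         (\<Sum>c | c \<in> paths bs mu (n - ?s) \<and> c ! length bs = nu. cpp_weight q_var t_var bs c * step_weight b nu lam) else 0) = 0"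
      by (rule sum.neutral) (use False in auto)
    then show ?thesis unfolding empty by simp
  qed
  finally show ?case .
qed

text \<open>For a nonempty profile the final partition is counted and equals the initial one, so
  only finitely many starting points occur.\<close>

lemma CPP_size_class:
  assumes "bs \<noteq> []"
  shows "{c \<in> CPP bs. cpp_size c = n} = (\<Union>mu\<in>{mu. is_partition mu \<and> sum_list mu \<le> n}. {c. c \<in> paths bs mu n \<and> c ! length bs = mu})"
proof (rule set_eqI)
  fix c
  show "c \<in> {c \<in> CPP bs. cpp_size c = n} \<longleftrightarrow> c \<in> (\<Union>mu\<in>{mu. is_partition mu \<and> sum_list mu \<le> n}. {c. c \<in> paths bs mu n \<and> c ! length bs = mu})"
  proof
    assume "c \<in> {c \<in> CPP bs. cpp_size c = n}"
    then have c: "is_path bs c" "c ! 0 = c ! length bs" "cpp_size c = n" unfolding CPP_eq by auto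
    have len: "length c = length bs + 1" using c(1) unfolding is_path_def by blast
    have "c ! length bs \<in> set c" using len by simp
    then have "is_partition (c ! length bs)" using c(1) unfolding is_path_def by blast
    moreover have "sum_list (c ! length bs) \<le> (\<Sum>k\<in>{1..<length c}. sum_list (c ! k))"
      by (rule member_le_sum) (use len assms in \<open>auto simp: Suc_le_eq\<close>)
    ultimately show "c \<in> (\<Union>mu\<in>{mu. is_partition mu \<and> sum_list mu \<le> n}. {c. c \<in> paths bs mu n \<and> c ! length bs = mu})"
      using c unfolding paths_def cpp_size_def by auto
  qed (auto simp: CPP_eq paths_def)
qed

lemma trace_word_op_nth:
  assumes "bs \<noteq> []"
  shows "finite {c \<in> CPP bs. cpp_size c = n}"
    "fps_nth (colfin_trace (word_op bs)) n = (\<Sum>c | c \<in> CPP bs \<and> cpp_size c = n. cpp_weight q_var t_var bs c)"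
proof -
  let ?M = "{mu. is_partition mu \<and> sum_list mu \<le> n}"
  let ?C = "\<lambda>mu. {c. c \<in> paths bs mu n \<and> c ! length bs = mu}"
  have finC: "finite (?C mu)" for mu using finite_paths by simp
  show "finite {c \<in> CPP bs. cpp_size c = n}" unfolding CPP_size_class[OF assms]
    using finite_partitions_le finC by (intro finite_UN_I)
  have "(\<Sum>c | c \<in> CPP bs \<and> cpp_size c = n. cpp_weight q_var t_var bs c) = (\<Sum>mu\<in>?M. \<Sum>c\<in>?C mu. cpp_weight q_var t_var bs c)"
    unfolding CPP_size_class[OF assms]
    by (rule sum.UNION_disjoint) (use finite_partitions_le finC in auto)
  also have "\<dots> = (\<Sum>mu\<in>?M. fps_nth (entry (word_op bs) mu mu) n)"
    by (rule sum.cong[OF refl]) (simp add: entry_word_op)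
  also have "\<dots> = fps_nth (colfin_trace (word_op bs)) n"
  proof (rule trace_nth[OF finite_partitions_le, symmetric])
    fix mu assume ne: "fps_nth (entry (word_op bs) mu mu) n \<noteq> 0"
    obtain b bs' where bs: "bs = bs' @ [b]" using assms by (metis rev_exhaust)
    obtain nu i where "i \<le> n" "fps_nth (entry (letter_op b) mu nu) i \<noteq> 0"
      using times_nth_neq_0[OF ne[unfolded bs word_op_simps]] .
    then show "mu \<in> ?M" by (auto simp: entry_letter_op split: if_splits)
  qed
  finally show "fps_nth (colfin_trace (word_op bs)) n = (\<Sum>c | c \<in> CPP bs \<and> cpp_size c = n. cpp_weight q_var t_var bs c)" by simp
qed

text \<open>In the \<open>z\<close>-adic topology a coefficient of the partial sums is constant once
  all objects of the corresponding size are included.\<close>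

lemma fps_has_sum_by_size:
  fixes w :: "'c \<Rightarrow> 'a::comm_ring_1"
  assumes "\<And>n. finite {c \<in> A. s c = n}" "\<And>n. fps_nth F n = (\<Sum>c | c \<in> A \<and> s c = n. w c)"
  shows "((\<lambda>c. fps_const (w c) * fps_X ^ s c) has_sum F) A"
  unfolding has_sum_def
proof (rule tendsto_fpsI)
  fix n
  show "\<forall>\<^sub>F X in finite_subsets_at_top A. fps_nth (\<Sum>c\<in>X. fps_const (w c) * fps_X ^ s c) n = fps_nth F n"
    unfolding eventually_finite_subsets_at_top
  proof (rule exI[of _ "{c \<in> A. s c = n}"], intro conjI allI impI)
    fix X assume X: "finite X \<and> {c \<in> A. s c = n} \<subseteq> X \<and> X \<subseteq> A"
    have "fps_nth (\<Sum>c\<in>X. fps_const (w c) * fps_X ^ s c) n = (\<Sum>c\<in>X. if n = s c then w c else 0)"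
      by (simp add: fps_sum_nth cong: if_cong) (rule sum.cong; simp)
    also have "\<dots> = (\<Sum>c | c \<in> A \<and> s c = n. w c)"
      by (rule sum.mono_neutral_cong_right) (use X in auto)
    finally show "fps_nth (\<Sum>c\<in>X. fps_const (w c) * fps_X ^ s c) n = fps_nth F n" using assms(2) by simp
  qed (use assms(1) in auto)
qed

section \<open>Assembling the infinite product\<close>

definition reverse_inversions :: "bool list \<Rightarrow> (nat \<times> nat) set" where
  "reverse_inversions bs = {(i, j). j < i \<and> i < length bs \<and> bs ! i \<and> \<not> bs ! j}"

definition direct_factor :: "bool list \<Rightarrow> nat \<Rightarrow> ratfun fps" where
  "direct_factor bs n = (\<Prod>(i, j)\<in>inversions bs. cross (j - i + n * length bs))"

definition wrapped_factor :: "bool list \<Rightarrow> nat \<Rightarrow> ratfun fps" where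
  "wrapped_factor bs n = (\<Prod>(i, j)\<in>reverse_inversions bs. cross (j + (n + 1) * length bs - i))"

lemma finite_reverse_inversions: "finite (reverse_inversions bs)"
  by (rule finite_subset[of _ "{..<length bs} \<times> {..<length bs}"]) (auto simp: reverse_inversions_def)

text \<open>In a lap a removing letter at \<open>j\<close> meets all adding letters. It met those at
  \<open>i < j\<close> before, during normal ordering, so they belong to the next index of the
  direct factor; the count for those at \<open>i > j\<close> starts with the laps.\<close>

lemma lap_factor_eq: "lap_factor bs (n * length bs) = direct_factor bs (Suc n) * wrapped_factor bs n"
proof -
  let ?T = "length bs"
  let ?f = "\<lambda>(i, j). cross (j + n * ?T + ?T - i)"
  have "lap_factor bs (n * ?T) = (\<Prod>i | i < ?T \<and> bs ! i. \<Prod>j | j < ?T \<and> \<not> bs ! j. cross (j + n * ?T + ?T - i))"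
    unfolding lap_factor_def by (rule prod.swap)
  also have "\<dots> = prod ?f ({i. i < ?T \<and> bs ! i} \<times> {j. j < ?T \<and> \<not> bs ! j})"
    by (rule prod.cartesian_product)
  also have "{i. i < ?T \<and> bs ! i} \<times> {j. j < ?T \<and> \<not> bs ! j} = inversions bs \<union> reverse_inversions bs"
    unfolding inversions_def reverse_inversions_def by (auto, metis linorder_neqE_nat)
  also have "prod ?f (inversions bs \<union> reverse_inversions bs) = prod ?f (inversions bs) * prod ?f (reverse_inversions bs)"
    by (rule prod.union_disjoint[OF finite_inversions finite_reverse_inversions])
      (auto simp: inversions_def reverse_inversions_def)
  also have "prod ?f (inversions bs) = direct_factor bs (Suc n)"
    unfolding direct_factor_def by (rule prod.cong[OF refl]) (auto simp: inversions_def add_ac intro!: arg_cong[where f = cross])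
  also have "prod ?f (reverse_inversions bs) = wrapped_factor bs n"
    unfolding wrapped_factor_def by (rule prod.cong[OF refl]) (auto simp: add_ac)
  finally show ?thesis .
qed

lemma fps_mult_cong_le:
  fixes f g :: "'a::comm_ring_1 fps"
  assumes "\<And>k. k \<le> m \<Longrightarrow> fps_nth f k = fps_nth f' k" "\<And>k. k \<le> m \<Longrightarrow> fps_nth g k = fps_nth g' k" "k \<le> m"
  shows "fps_nth (f * g) k = fps_nth (f' * g') k"
  unfolding fps_mult_nth by (rule sum.cong[OF refl]) (use assms in auto)

text \<open>All its exponents exceed \<open>n * length bs\<close>, because
  \<open>i < length bs\<close>.\<close>

lemma wrapped_factor_large:
  assumes "m \<le> n" "k \<le> m" "bs \<noteq> []"
  shows "fps_nth (wrapped_factor bs n) k = fps_nth 1 k"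
proof -
  have one: "fps_nth (cross d) i = fps_nth 1 i" if "m < d" "i \<le> m" for d i
    using that by (auto simp: spread_def dest: dvd_imp_le)
  have "\<forall>i\<le>m. fps_nth (\<Prod>(i, j)\<in>A. cross (j + (n + 1) * length bs - i)) i = fps_nth 1 i"
    if "finite A" "A \<subseteq> reverse_inversions bs" for A
    using that
  proof (induction A rule: finite_induct)
    case (insert x A)
    obtain i j where x: "x = (i, j)" by (cases x)
    have ij: "i < length bs" using insert.prems unfolding x reverse_inversions_def by auto
    have "n * 1 \<le> n * length bs" by (rule mult_le_mono2) (use assms(3) in \<open>simp add: Suc_le_eq\<close>)
    moreover have "(n + 1) * length bs = n * length bs + length bs" by simp
    ultimately have "m < j + (n + 1) * length bs - i" using ij assms(1) by linarith
    then have c: "fps_nth (cross (j + (n + 1) * length bs - i)) l = fps_nth 1 l" if "l \<le> m" for l using one that by blast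
    show ?case
    proof (intro allI impI)
      fix l assume l: "l \<le> m"
      have IH: "\<forall>i\<le>m. fps_nth (\<Prod>(i, j)\<in>A. cross (j + (n + 1) * length bs - i)) i = fps_nth 1 i"
        using insert.IH insert.prems by blast
      have "fps_nth (cross (j + (n + 1) * length bs - i) * (\<Prod>(i, j)\<in>A. cross (j + (n + 1) * length bs - i))) l =
          fps_nth (1 * 1) l"
        by (rule fps_mult_cong_le[OF _ _ l]) (use c IH in blast)+
      then show "fps_nth (\<Prod>(i, j)\<in>insert x A. cross (j + (n + 1) * length bs - i)) l = fps_nth 1 l"
        using insert.hyps unfolding x by simp
    qed
  qed simp
  then show ?thesis unfolding wrapped_factor_def using finite_reverse_inversions assms(2) by blast
qed

text \<open>Because the direct factors run one index ahead in the laps, the partial product contains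
  \<open>N\<close> complete laps, the direct factor from normal ordering and one unpaired wrapped
  factor, which is 1 up to order \<open>N\<close>.\<close>

lemma product_partial_eq:
  assumes "bs \<noteq> []"
  shows "(\<Prod>n\<le>N. 1 / (1 - fps_X ^ ((n + 1) * length bs)) * direct_factor bs n * wrapped_factor bs n) =
    bounded_gf (length bs) (Suc N) * (direct_factor bs 0 * (\<Prod>n<N. lap_factor bs (n * length bs))) * wrapped_factor bs N"
proof -
  have "(\<Prod>n\<le>N. direct_factor bs n) = direct_factor bs 0 * (\<Prod>n<N. direct_factor bs (Suc n))"
    by (rule prod.atMost_shift)
  moreover have "(\<Prod>n\<le>N. wrapped_factor bs n) = (\<Prod>n<N. wrapped_factor bs n) * wrapped_factor bs N"
    by (simp add: lessThan_Suc_atMost[symmetric])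
  moreover have "(\<Prod>n\<le>N. 1 / (1 - fps_X ^ ((n + 1) * length bs))) = bounded_gf (length bs) (Suc N)"
    using bounded_gf_prod[of "length bs" "Suc N"] assms by (simp add: lessThan_Suc_atMost)
  ultimately show ?thesis by (simp only: prod.distrib lap_factor_eq mult_ac)
qed

lemma product_partial_nth:
  assumes "bs \<noteq> []" "m < N"
  shows "fps_nth (\<Prod>n\<le>N. 1 / (1 - fps_X ^ ((n + 1) * length bs)) * direct_factor bs n * wrapped_factor bs n) m =
    fps_nth (colfin_trace (word_op bs)) m"
proof -
  let ?T = "length bs"
  define Q where "Q = direct_factor bs 0 * (\<Prod>n<N. lap_factor bs (n * ?T))"
  have T: "0 < ?T" using assms by simp
  have "N * 1 \<le> N * ?T" by (rule mult_le_mono2) (use T in \<open>simp add: Suc_le_eq\<close>)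
  then have NT: "m < N * ?T" using assms(2) by linarith
  have E: "fps_nth (bounded_gf ?T (Suc N)) k = fps_nth (shifted_trace bs (N * ?T)) k" if "k \<le> m" for k
    using bounded_gf_nth[OF T, of k "Suc N"] shifted_trace_large[OF assms(1), of k "N * ?T"] that assms(2) NT by simp
  have W: "fps_nth (wrapped_factor bs N) k = fps_nth 1 k" if "k \<le> m" for k
    using wrapped_factor_large[of m N k bs] that assms by simp
  have "fps_nth (bounded_gf ?T (Suc N) * Q * wrapped_factor bs N) m = fps_nth (shifted_trace bs (N * ?T) * Q * 1) m"
    by (intro fps_mult_cong_le[of m]) (use E W in auto)
  moreover have "colfin_trace (word_op bs) = Q * shifted_trace bs (N * ?T)"
    unfolding trace_word_op[OF assms(1), of N] Q_def direct_factor_def by simp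
  ultimately show ?thesis unfolding product_partial_eq[OF assms(1)] Q_def[symmetric] by (simp add: mult.commute)
qed

lemma prod_Suc_indices:
  fixes f :: "nat \<Rightarrow> nat \<Rightarrow> 'a::comm_monoid_mult"
  assumes "\<And>i j. (i, j) \<in> A \<longleftrightarrow> 1 \<le> i \<and> 1 \<le> j \<and> (i - 1, j - 1) \<in> B"
  shows "(\<Prod>(i, j)\<in>A. f i j) = (\<Prod>(i, j)\<in>B. f (Suc i) (Suc j))"
  by (rule prod.reindex_bij_witness[of _ "\<lambda>(i, j). (Suc i, Suc j)" "\<lambda>(i, j). (i - 1, j - 1)"])
    (use assms in auto)

lemma fps_nth_prod_0: "fps_nth (\<Prod>x\<in>A. f x) 0 = (\<Prod>x\<in>A. fps_nth (f x :: 'a::comm_ring_1 fps) 0)"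
  by (induction A rule: infinite_finite_induct) simp_all

lemma word_product_has_prod:
  assumes "bs \<noteq> []"
  shows "(\<lambda>n. 1 / (1 - fps_X ^ ((n + 1) * length bs)) * direct_factor bs n * wrapped_factor bs n)
    has_prod colfin_trace (word_op bs)" (is "?f has_prod _")
proof -
  have lim: "(\<lambda>N. \<Prod>n\<le>N. ?f n) \<longlonglongrightarrow> colfin_trace (word_op bs)"
  proof (rule tendsto_fpsI)
    fix m
    show "\<forall>\<^sub>F N in sequentially. fps_nth (\<Prod>n\<le>N. ?f n) m = fps_nth (colfin_trace (word_op bs)) m"
      using eventually_gt_at_top[of m] by eventually_elim (rule product_partial_nth[OF assms])
  qed
  have c0: "fps_nth (cross d) 0 = 1" for d by (simp add: spread_def)
  have f0: "fps_nth (?f n) 0 = 1" for n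
  proof -
    have e: "0 < (n + 1) * length bs" using assms by simp
    have "fps_nth (1 / (1 - fps_X ^ ((n + 1) * length bs)) :: ratfun fps) 0 = 1"
      unfolding fps_divide_unit[OF one_minus_X_power_nonzero[OF e]] using e by simp
    then show ?thesis
      by (simp add: direct_factor_def wrapped_factor_def fps_nth_prod_0 c0 case_prod_unfold)
  qed
  \<comment> \<open>\<open>has_prod\<close> excludes the limit 0; a constant coefficient 1 rules it
    out.\<close>
  have "fps_nth (colfin_trace (word_op bs)) 0 = fps_nth (\<Prod>n\<le>1. ?f n) 0"
    using product_partial_nth[OF assms, of 0 1] by simp
  also have "\<dots> = 1" unfolding fps_nth_prod_0 f0 by simp
  finally have "colfin_trace (word_op bs) \<noteq> 0" by auto
  then show ?thesis using lim unfolding has_prod_def raw_has_prod_def by simp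
qed

text \<open>The infinite sum and product refer to the \<open>z\<close>-adic topology on power
  series. In the second inner product \<open>i\<close> is subtracted last, since
  \<open>j - i\<close> would truncate for \<open>j < i\<close>.\<close>

theorem theorem5p1p1:
  fixes \<pi> :: "bool list" and T :: nat
  assumes "length \<pi> = T" and "T \<ge> 1"
  shows "(\<Sum>\<^sub>\<infinity>c\<in>CPP \<pi>. fps_const (cpp_weight q_var t_var \<pi> c) * fps_X ^ cpp_size c) =
    (\<Prod>n. 1 / (1 - fps_X ^ ((n + 1) * T)) *
      (\<Prod>(i, j)\<in>{(i, j). 1 \<le> i \<and> i < j \<and> j \<le> T \<and> \<pi> ! (i - 1) > \<pi> ! (j - 1)}.
         q_pochhammer_inf (fps_const t_var * fps_X ^ (j - i + n * T)) /
         q_pochhammer_inf (fps_X ^ (j - i + n * T))) *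
      (\<Prod>(i, j)\<in>{(i, j). 1 \<le> j \<and> j < i \<and> i \<le> T \<and> \<pi> ! (i - 1) > \<pi> ! (j - 1)}.
         q_pochhammer_inf (fps_const t_var * fps_X ^ (j + (n + 1) * T - i)) /
         q_pochhammer_inf (fps_X ^ (j + (n + 1) * T - i))))"
proof -
  let ?A = "{(i, j). 1 \<le> i \<and> i < j \<and> j \<le> T \<and> \<pi> ! (i - 1) > \<pi> ! (j - 1)}"
  let ?B = "{(i, j). 1 \<le> j \<and> j < i \<and> i \<le> T \<and> \<pi> ! (i - 1) > \<pi> ! (j - 1)}"
  let ?r = "\<lambda>d. q_pochhammer_inf (fps_const t_var * fps_X ^ d) / q_pochhammer_inf (fps_X ^ d)"
  have ne: "\<pi> \<noteq> []" using assms by auto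
  have lhs: "(\<Sum>\<^sub>\<infinity>c\<in>CPP \<pi>. fps_const (cpp_weight q_var t_var \<pi> c) * fps_X ^ cpp_size c) = colfin_trace (word_op \<pi>)"
    by (rule infsumI, rule fps_has_sum_by_size) (use trace_word_op_nth[OF ne] in auto)
  have A: "(\<Prod>(i, j)\<in>?A. ?r (j - i + n * T)) = direct_factor \<pi> n" for n
  proof -
    have "(\<Prod>(i, j)\<in>?A. ?r (j - i + n * T)) = (\<Prod>(i, j)\<in>?A. cross (j - i + n * T))"
      by (rule prod.cong[OF refl]) (auto simp: q_pochhammer_inf_ratio)
    \<comment> \<open>Positions in the statement count from 1, those in \<open>inversions\<close>
      from 0; the differences agree.\<close>
    also have "\<dots> = (\<Prod>(i, j)\<in>inversions \<pi>. cross (Suc j - Suc i + n * T))"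
      by (rule prod_Suc_indices) (use assms(1) in \<open>auto simp: inversions_def less_bool_def\<close>)
    finally show ?thesis unfolding direct_factor_def assms(1) by simp
  qed
  have B: "(\<Prod>(i, j)\<in>?B. ?r (j + (n + 1) * T - i)) = wrapped_factor \<pi> n" for n
  proof -
    have "(\<Prod>(i, j)\<in>?B. ?r (j + (n + 1) * T - i)) = (\<Prod>(i, j)\<in>?B. cross (j + (n + 1) * T - i))"
      by (rule prod.cong[OF refl]) (auto simp: q_pochhammer_inf_ratio)
    also have "\<dots> = (\<Prod>(i, j)\<in>reverse_inversions \<pi>. cross (Suc j + (n + 1) * T - Suc i))"
      by (rule prod_Suc_indices) (use assms(1) in \<open>auto simp: reverse_inversions_def less_bool_def\<close>)
    finally show ?thesis unfolding wrapped_factor_def assms(1) by simp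
  qed
  show ?thesis unfolding lhs A B
    using has_prod_unique[OF word_product_has_prod[OF ne]] unfolding assms(1) .
qed

end
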